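(* Starting from a graph with $n$ vertices, an $O(\log n)$-approximation of Minimum Dominating Set can be maintained over any sequence of $\Omega(n)$ edge insertions and deletions in $O(\Delta \log n)$ amortized time per update, where $\Delta$ is the maximum degree of the graph over the sequence of updates.
   Context: A dynamic graph is a sequence of graphs $G_0, G_1, \dots, G_M$ on a fixed set of $n$ vertices, where $G_{i+1}$ is obtained from $G_i$ by inserting or deleting a single edge (an update). A dominating set of a graph $G=(V,E)$ is a set $\mathcal{D}\subseteq V$ such that every vertex of $V$ is in $\mathcal{D}$ or adjacent to a vertex of $\mathcal{D}$; Minimum Dominating Set asks for a dominating set of minimum size. An $O(\log n)$-approximation means that after every update the maintained set is a dominating set of the current graph of size at most $O(\log n)$ times the minimum size of a dominating set of the current graph. *)

theory Defs
  imports Complex_Main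
begin

section \<open>Graphs, dominating sets and edge updates\<close>

definition simple_graph :: "'a set \<Rightarrow> 'a set set \<Rightarrow> bool" where
  "simple_graph V E \<longleftrightarrow> finite V \<and> E \<subseteq> {{u, v} | u v. u \<in> V \<and> v \<in> V \<and> u \<noteq> v}"

definition degree :: "'a set set \<Rightarrow> 'a \<Rightarrow> nat" where
  "degree E v = card {e \<in> E. v \<in> e}"

definition max_degree :: "'a set \<Rightarrow> 'a set set \<Rightarrow> nat" where
  "max_degree V E = Max (degree E ` V)"

definition dominating_set :: "'a set \<Rightarrow> 'a set set \<Rightarrow> 'a set \<Rightarrow> bool" where
  "dominating_set V E D \<longleftrightarrow> D \<subseteq> V \<and> (\<forall>v\<in>V. v \<in> D \<or> (\<exists>u\<in>D. {u, v} \<in> E))"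

definition min_dominating_size :: "'a set \<Rightarrow> 'a set set \<Rightarrow> nat" where
  "min_dominating_size V E = Min {card D | D. dominating_set V E D}"

datatype 'a update = Insert 'a 'a | Delete 'a 'a

fun apply_update :: "'a update \<Rightarrow> 'a set set \<Rightarrow> 'a set set" where
  "apply_update (Insert u v) E = insert {u, v} E"
| "apply_update (Delete u v) E = E - {{u, v}}"

fun valid_update :: "'a set \<Rightarrow> 'a set set \<Rightarrow> 'a update \<Rightarrow> bool" where
  "valid_update V E (Insert u v) \<longleftrightarrow> u \<in> V \<and> v \<in> V \<and> u \<noteq> v \<and> {u, v} \<notin> E"
| "valid_update V E (Delete u v) \<longleftrightarrow> {u, v} \<in> E"

definition graph_after :: "'a set set \<Rightarrow> 'a update list \<Rightarrow> nat \<Rightarrow> 'a set set" where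
  "graph_after E us i = fold apply_update (take i us) E"

definition valid_updates :: "'a set \<Rightarrow> 'a set set \<Rightarrow> 'a update list \<Rightarrow> bool" where
  "valid_updates V E us \<longleftrightarrow> (\<forall>i<length us. valid_update V (graph_after E us i) (us ! i))"

definition max_degree_over :: "'a set \<Rightarrow> 'a set set \<Rightarrow> 'a update list \<Rightarrow> nat" where
  "max_degree_over V E us = Max ((\<lambda>i. max_degree V (graph_after E us i)) ` {..length us})"


section \<open>Word RAM\<close>

text \<open>
  Running times refer to a unit-cost word RAM, programmed by while-programs. A program is a fixed
  piece of syntax, independent of the input, so it mentions only finitely many registers and
  finitely many arrays (both numbered by constants of the program text). All values and array
  indices are words, i.e. numbers below \<open>2 ^ w\<close>. Having a constant number of disjoint arrays
  instead of one memory changes running times by a constant factor only.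
\<close>

record state =
  regs :: "nat \<Rightarrow> nat"
  arrs :: "nat \<Rightarrow> nat \<Rightarrow> nat"

datatype binop = Add | Sub | Mul | Div | Less | Eq

datatype expr =
    Const nat
  | Reg nat
  | Load nat expr
  | Bin binop expr expr

datatype com =
    Skip
  | Assign nat expr
  | Store nat expr expr
  | Seq com com
  | Cond expr com com
  | While expr com

text \<open>Subtraction is truncated at \<open>0\<close>, and division by \<open>0\<close> yields \<open>0\<close>.\<close>

fun binop_val :: "nat \<Rightarrow> binop \<Rightarrow> nat \<Rightarrow> nat \<Rightarrow> nat" where
  "binop_val w Add a b = (a + b) mod 2 ^ w"
| "binop_val w Sub a b = a - b"
| "binop_val w Mul a b = (a * b) mod 2 ^ w"
| "binop_val w Div a b = a div b"
| "binop_val w Less a b = of_bool (a < b) mod 2 ^ w"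
| "binop_val w Eq a b = of_bool (a = b) mod 2 ^ w"

fun eval :: "nat \<Rightarrow> state \<Rightarrow> expr \<Rightarrow> nat" where
  "eval w s (Const c) = c mod 2 ^ w"
| "eval w s (Reg r) = regs s r"
| "eval w s (Load a e) = arrs s a (eval w s e)"
| "eval w s (Bin f e1 e2) = binop_val w f (eval w s e1) (eval w s e2)"

fun cost :: "expr \<Rightarrow> nat" where
  "cost (Const c) = 1"
| "cost (Reg r) = 1"
| "cost (Load a e) = 1 + cost e"
| "cost (Bin f e1 e2) = 1 + cost e1 + cost e2"

text \<open>
  \<open>exec w c s t s'\<close>: with word length \<open>w\<close>, the program \<open>c\<close> started in \<open>s\<close> terminates
  after \<open>t\<close> steps in \<open>s'\<close>.
\<close>

inductive exec :: "nat \<Rightarrow> com \<Rightarrow> state \<Rightarrow> nat \<Rightarrow> state \<Rightarrow> bool" for w where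
  Skip: "exec w Skip s 1 s"
| Assign: "exec w (Assign r e) s (1 + cost e) (s\<lparr>regs := (regs s)(r := eval w s e)\<rparr>)"
| Store: "exec w (Store a i e) s (1 + cost i + cost e)
    (s\<lparr>arrs := (arrs s)(a := (arrs s a)(eval w s i := eval w s e))\<rparr>)"
| Seq: "exec w c1 s t1 s' \<Longrightarrow> exec w c2 s' t2 s'' \<Longrightarrow> exec w (Seq c1 c2) s (t1 + t2) s''"
| CondTrue: "eval w s b \<noteq> 0 \<Longrightarrow> exec w c1 s t s' \<Longrightarrow> exec w (Cond b c1 c2) s (1 + cost b + t) s'"
| CondFalse: "eval w s b = 0 \<Longrightarrow> exec w c2 s t s' \<Longrightarrow> exec w (Cond b c1 c2) s (1 + cost b + t) s'"
| WhileFalse: "eval w s b = 0 \<Longrightarrow> exec w (While b c) s (1 + cost b) s"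
| WhileTrue: "eval w s b \<noteq> 0 \<Longrightarrow> exec w c s t1 s' \<Longrightarrow> exec w (While b c) s' t2 s''
    \<Longrightarrow> exec w (While b c) s (1 + cost b + t1 + t2) s''"

inductive_cases exec_SkipE: "exec w Skip s t s'"
inductive_cases exec_AssignE: "exec w (Assign r e) s t s'"
inductive_cases exec_StoreE: "exec w (Store a i e) s t s'"
inductive_cases exec_SeqE: "exec w (Seq c1 c2) s t s'"
inductive_cases exec_CondE: "exec w (Cond b c1 c2) s t s'"
inductive_cases exec_WhileE: "exec w (While b c) s t s'"

lemma exec_deterministic:
  "exec w c s t s' \<Longrightarrow> exec w c s u s'' \<Longrightarrow> u = t \<and> s'' = s'"
proof (induction arbitrary: u s'' rule: exec.induct)
  case (Seq c1 s t1 s1 c2 t2 s2)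
  from Seq.prems obtain v1 r v2 where r: "exec w c1 s v1 r" "exec w c2 r v2 s''" "u = v1 + v2"
    by (rule exec_SeqE) simp
  have "v1 = t1" "r = s1" using Seq.IH(1)[OF r(1)] by simp_all
  then show ?case using Seq.IH(2) r by simp
next
  case (CondTrue s b c1 t s' c2)
  from CondTrue.prems CondTrue.hyps(1) obtain v where v: "exec w c1 s v s''" "u = 1 + cost b + v"
    by (auto elim: exec_CondE)
  then show ?case using CondTrue.IH[OF v(1)] by simp
next
  case (CondFalse s b c2 t s' c1)
  from CondFalse.prems CondFalse.hyps(1) obtain v where v: "exec w c2 s v s''" "u = 1 + cost b + v"
    by (auto elim: exec_CondE)
  then show ?case using CondFalse.IH[OF v(1)] by simp
next
  case (WhileFalse s b c)
  from WhileFalse.prems WhileFalse.hyps show ?case by (auto elim: exec_WhileE)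
next
  case (WhileTrue s b c t1 s1 t2 s2)
  from WhileTrue.prems WhileTrue.hyps(1) obtain v1 r v2
    where r: "exec w c s v1 r" "exec w (While b c) r v2 s''" "u = 1 + cost b + v1 + v2"
    by (auto elim: exec_WhileE[of w b c s u s''])
  have "v1 = t1" "r = s1" using WhileTrue.IH(1)[OF r(1)] by simp_all
  then show ?case using WhileTrue.IH(2) r by simp
qed (auto elim: exec_SkipE exec_AssignE exec_StoreE)

definition word_state :: "nat \<Rightarrow> state \<Rightarrow> bool" where
  "word_state w s \<longleftrightarrow> (\<forall>r. regs s r < 2 ^ w) \<and> (\<forall>a i. arrs s a i < 2 ^ w)"

lemma binop_val_word: "a < 2 ^ w \<Longrightarrow> b < 2 ^ w \<Longrightarrow> binop_val w f a b < 2 ^ w"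
  by (cases f) (simp_all add: less_imp_diff_less le_less_trans[OF div_le_dividend])

lemma eval_word: "word_state w s \<Longrightarrow> eval w s e < 2 ^ w"
  by (induction e) (auto simp: word_state_def binop_val_word)

lemma exec_word: "exec w c s t s' \<Longrightarrow> word_state w s \<Longrightarrow> word_state w s'"
proof (induction rule: exec.induct)
  case (Assign r e s)
  then show ?case using eval_word[OF Assign, of e] by (auto simp: word_state_def)
next
  case (Store a i e s)
  then show ?case using eval_word[OF Store, of e] by (auto simp: word_state_def)
qed auto


section \<open>Dynamic graph algorithms\<close>

text \<open>
  The vertices are \<open>0, \<dots>, n - 1\<close>. Words have \<open>\<Theta>(log n)\<close> bits: \<open>n\<close> is written with
  \<open>\<lceil>log 2 (n + 1)\<rceil>\<close> bits, and \<open>k\<close> is a constant of the algorithm.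
\<close>

definition word_length :: "nat \<Rightarrow> nat \<Rightarrow> nat" where
  "word_length k n = k * nat \<lceil>log 2 (real n + 1)\<rceil>"

definition edge_list_of :: "'a set set \<Rightarrow> ('a \<times> 'a) list \<Rightarrow> bool" where
  "edge_list_of E es \<longleftrightarrow>
    distinct (map (\<lambda>(u, v). {u, v}) es) \<and> set (map (\<lambda>(u, v). {u, v}) es) = E"

text \<open>
  Input: registers 0 and 1 hold the numbers of vertices and edges of the initial graph, arrays 0
  and 1 the first and second endpoints of its edges; everything else is zero. An update is passed
  in registers 2 (\<open>1\<close> for an insertion, \<open>0\<close> for a deletion), 3 and 4. The maintained vertex set
  is stored as flags in array 2.
\<close>

definition initial_state :: "nat \<Rightarrow> (nat \<times> nat) list \<Rightarrow> state" where
  "initial_state n es =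
    \<lparr>regs = (\<lambda>_. 0)(0 := n, 1 := length es),
     arrs = (\<lambda>_ _. 0)(0 := (\<lambda>i. if i < length es then fst (es ! i) else 0),
                      1 := (\<lambda>i. if i < length es then snd (es ! i) else 0))\<rparr>"

fun pass_update :: "nat update \<Rightarrow> state \<Rightarrow> state" where
  "pass_update (Insert u v) s = s\<lparr>regs := (regs s)(2 := 1, 3 := u, 4 := v)\<rparr>"
| "pass_update (Delete u v) s = s\<lparr>regs := (regs s)(2 := 0, 3 := u, 4 := v)\<rparr>"

definition output_set :: "nat \<Rightarrow> state \<Rightarrow> nat set" where
  "output_set n s = {v. v < n \<and> arrs s 2 v \<noteq> 0}"

text \<open>
  \<open>S 0\<close> and \<open>T 0\<close> are the state after and the time spent in preprocessing the initial graph with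
  \<open>pre\<close>; \<open>S i\<close> and \<open>T i\<close> for \<open>i > 0\<close> are those of handling the \<open>i\<close>-th update with \<open>upd\<close>. The
  program sees an update only when it is performed, and \<open>S\<close>, \<open>T\<close> are determined by the
  input because execution is deterministic.
\<close>

definition dynamic_run ::
  "nat \<Rightarrow> com \<Rightarrow> com \<Rightarrow> nat \<Rightarrow> (nat \<times> nat) list \<Rightarrow> nat update list
    \<Rightarrow> (nat \<Rightarrow> state) \<Rightarrow> (nat \<Rightarrow> nat) \<Rightarrow> bool" where
  "dynamic_run w pre upd n es us S T \<longleftrightarrow>
    exec w pre (initial_state n es) (T 0) (S 0) \<and>
    (\<forall>i<length us. exec w upd (pass_update (us ! i) (S i)) (T (Suc i)) (S (Suc i)))"

end

theory Submission
  imports Defs "HOL-Library.Discrete_Functions"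
begin

text \<open>
  Every vertex \<open>v\<close> carries a dominator \<open>\<phi> v\<close> in its closed neighbourhood and a level \<open>l v\<close>, a power of
  two; the dominators form the maintained set. A pair \<open>(s, P)\<close> covers the vertices \<open>v\<close> with
  \<open>\<phi> v = s\<close> and \<open>l v = P\<close>. Two local rules are applied until neither is applicable: if at least
  \<open>4 * P\<close> vertices of \<open>N s\<close> have level \<open>P\<close>, all of them move to \<open>(s, 4 * P)\<close>; if \<open>(s, P)\<close>
  covers at least one but fewer than \<open>P / 2\<close> vertices, they move to \<open>(s, P / 2)\<close>.

  In a stable state, charge \<open>2 / l v\<close> to every vertex \<open>v\<close>. A dominator receives at least \<open>1\<close> from
  the vertices it covers, and each closed neighbourhood contains total charge at most \<open>8\<close> per
  level. Comparing with an optimal dominating set gives the factor \<open>O(log n)\<close>.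

  Moving a vertex costs \<open>O(\<Delta>)\<close>, as the level counts of its neighbours have to be updated. The moves
  are paid for by a potential that counts the levels above each vertex twice and the deficit
  \<open>P - c\<close> of each pair \<open>(s, P)\<close> covering \<open>c > 0\<close> vertices three times. A vertex that rises gains two
  levels and causes a deficit of one, so it releases \<open>2 * 2 - 3 = 1\<close>; when \<open>c < P / 2\<close> vertices drop
  one level, a deficit of \<open>P / 2\<close> disappears, which releases at least \<open>3 - 2 = 1\<close> per vertex.
  Inserting an edge does not change the potential; deleting one forces at most two vertices to
  dominate themselves at level \<open>1\<close>, which raises it by \<open>O(log n)\<close>. The initial graph is built by
  insertions, starting from \<open>n\<close> isolated vertices with potential \<open>O(n log n)\<close>.
\<close>

section \<open>Levels and the potential function\<close>

definition is_level :: "nat \<Rightarrow> nat \<Rightarrow> bool" where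
  "is_level n P \<longleftrightarrow> (\<exists>i. P = 2 ^ i) \<and> P \<le> n"

definition cover_count :: "nat \<Rightarrow> (nat \<Rightarrow> nat) \<Rightarrow> (nat \<Rightarrow> nat) \<Rightarrow> nat \<Rightarrow> nat \<Rightarrow> nat" where
  "cover_count n \<phi> l s P = card {x. x < n \<and> \<phi> x = s \<and> l x = P}"

definition level_count :: "(nat \<Rightarrow> nat set) \<Rightarrow> (nat \<Rightarrow> nat) \<Rightarrow> nat \<Rightarrow> nat \<Rightarrow> nat" where
  "level_count N l u P = card {x \<in> N u. l x = P}"

text \<open>For \<open>P \<le> 2\<close> the second disjunct cannot hold, because a nonempty pair
  covers at least one vertex; the second rule therefore never leads below level 1.\<close>

definition unstable :: "nat \<Rightarrow> (nat \<Rightarrow> nat set) \<Rightarrow> (nat \<Rightarrow> nat) \<Rightarrow> (nat \<Rightarrow> nat) \<Rightarrow> nat \<Rightarrow> nat \<Rightarrow> bool" where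
  "unstable n N \<phi> l u P \<longleftrightarrow>
    4 * P \<le> level_count N l u P \<or> 0 < cover_count n \<phi> l u P \<and> 2 * cover_count n \<phi> l u P < P"

text \<open>The empty pair gets deficit 0 although truncated subtraction would give
  \<open>P\<close>. Emptying a pair thus releases all of its deficit, which is the source of the
  gain in \<open>pot_lower\<close>.\<close>

definition deficit :: "nat \<Rightarrow> nat \<Rightarrow> nat" where
  "deficit P c = (if c = 0 then 0 else P - c)"

definition rank_pot :: "nat \<Rightarrow> (nat \<Rightarrow> nat) \<Rightarrow> nat" where
  "rank_pot n l = (\<Sum>v<n. floor_log n - floor_log (l v))"

definition deficit_pot :: "nat \<Rightarrow> (nat \<Rightarrow> nat) \<Rightarrow> (nat \<Rightarrow> nat) \<Rightarrow> nat" where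
  "deficit_pot n \<phi> l =
    (\<Sum>(s, i) \<in> {..<n} \<times> {..floor_log n}. deficit (2 ^ i) (cover_count n \<phi> l s (2 ^ i)))"

definition pot :: "nat \<Rightarrow> (nat \<Rightarrow> nat) \<Rightarrow> (nat \<Rightarrow> nat) \<Rightarrow> nat" where
  "pot n \<phi> l = 2 * rank_pot n l + 3 * deficit_pot n \<phi> l"

text \<open>A whole batch of moves as one function update. The potential is compared only before and
  after a batch, since a single move inside it may increase the potential.\<close>

definition reassign :: "(nat \<Rightarrow> nat) \<Rightarrow> nat set \<Rightarrow> nat \<Rightarrow> nat \<Rightarrow> nat" where
  "reassign f Y a = (\<lambda>x. if x \<in> Y then a else f x)"

lemma is_levelE:
  assumes "is_level n P"
  obtains i where "P = 2 ^ i" "i \<le> floor_log n"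
proof -
  from assms obtain i where i: "P = 2 ^ i" "2 ^ i \<le> n" by (auto simp: is_level_def)
  have "floor_log (2 ^ i) \<le> floor_log n" using i(2) by (rule floor_log_le_iff)
  then show thesis using i that by simp
qed

lemma is_level_bounds: "is_level n P \<Longrightarrow> 0 < P \<and> P \<le> n"
  by (auto simp: is_level_def)

lemma is_level_powI: "0 < n \<Longrightarrow> i \<le> floor_log n \<Longrightarrow> is_level n (2 ^ i)"
  using le_trans[OF power_increasing[of i "floor_log n" "2::nat"] floor_log_exp2_le[of n]]
  by (auto simp: is_level_def)

lemma floor_log_le_self: "floor_log n \<le> n"
proof (cases "n = 0")
  case False
  then have "2 ^ floor_log n \<le> n" by (simp add: floor_log_exp2_le)
  moreover have "floor_log n < 2 ^ floor_log n" by (rule less_exp)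
  ultimately show ?thesis by linarith
qed simp

lemma deficit_diff: "deficit P (c - x) \<le> deficit P c + x"
  by (auto simp: deficit_def)

text \<open>The worst case is \<open>c = 0\<close>, where the arriving vertices open a deficit of
  \<open>P - x\<close>; in a nonempty pair, arrivals can only reduce the deficit.\<close>

lemma deficit_add: "deficit P (c + x) \<le> deficit P c + (P - x)"
  by (auto simp: deficit_def)

lemma deficit_zero: "P \<le> c \<Longrightarrow> deficit P c = 0"
  by (auto simp: deficit_def)

lemma deficit_le: "deficit P c \<le> P"
  by (auto simp: deficit_def)

lemma cover_count_le: "cover_count n \<phi> l s P \<le> n"
  unfolding cover_count_def by (rule order_trans[OF card_mono[of "{..<n}"]]) auto

text \<open>All of \<open>Y\<close> is first removed and then counted at the target, so vertices
  that were already in the target pair cause no special case. The subtraction is exact, because the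
  removed vertices are a subset of the counted ones.\<close>

lemma cover_count_reassign:
  assumes "Y \<subseteq> {..<n}"
  shows "cover_count n (reassign \<phi> Y s) (reassign l Y Q) t P =
    cover_count n \<phi> l t P - card {x \<in> Y. \<phi> x = t \<and> l x = P} + (if (t, P) = (s, Q) then card Y else 0)"
proof -
  have fin: "finite Y" using assms finite_subset by blast
  let ?A = "{x. x < n \<and> \<phi> x = t \<and> l x = P}"
  let ?B = "{x \<in> Y. \<phi> x = t \<and> l x = P}"
  have "{x. x < n \<and> reassign \<phi> Y s x = t \<and> reassign l Y Q x = P} =
      (?A - ?B) \<union> (if (t, P) = (s, Q) then Y else {})"
    using assms by (auto simp: reassign_def)
  moreover have "card ((?A - ?B) \<union> (if (t, P) = (s, Q) then Y else {})) =
      card (?A - ?B) + card (if (t, P) = (s, Q) then Y else {})"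
    using fin by (intro card_Un_disjoint) auto
  moreover have "card (?A - ?B) = card ?A - card ?B"
    using assms fin by (intro card_Diff_subset) auto
  ultimately show ?thesis by (simp add: cover_count_def)
qed

section \<open>Change of the potential under the two rules, a reset and the initialization\<close>

lemma rank_pot_raise:
  assumes "Y \<subseteq> {..<n}" "\<And>x. x \<in> Y \<Longrightarrow> l x = 2 ^ i" "i + 2 \<le> floor_log n"
  shows "rank_pot n (reassign l Y (2 ^ (i + 2))) + 2 * card Y = rank_pot n l"
proof -
  have "rank_pot n (reassign l Y (2 ^ (i + 2))) + (\<Sum>x<n. if x \<in> Y then 2 else 0) = rank_pot n l"
    unfolding rank_pot_def sum.distrib[symmetric]
  proof (rule sum.cong[OF refl])
    fix x
    have "floor_log (2 ^ (i + 2)) = i + 2" "floor_log (2 ^ i) = i" by (rule floor_log_power)+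
    then show "floor_log n - floor_log (reassign l Y (2 ^ (i + 2)) x) + (if x \<in> Y then 2 else 0) =
        floor_log n - floor_log (l x)"
      using assms(2)[of x] assms(3) by (auto simp add: reassign_def simp del: power_Suc)
  qed
  moreover have "(\<Sum>x<n. if x \<in> Y then 2 else 0) = 2 * card Y"
    using assms(1) by (simp add: sum.If_cases Int_absorb1)
  ultimately show ?thesis by simp
qed

lemma rank_pot_lower:
  assumes "Y \<subseteq> {..<n}" "\<And>x. x \<in> Y \<Longrightarrow> l x = 2 ^ Suc i"
  shows "rank_pot n (reassign l Y (2 ^ i)) \<le> rank_pot n l + card Y"
proof -
  have "rank_pot n (reassign l Y (2 ^ i)) \<le> rank_pot n l + (\<Sum>x<n. if x \<in> Y then 1 else 0)"
    unfolding rank_pot_def sum.distrib[symmetric]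
  proof (rule sum_mono)
    fix x
    have "floor_log (2 ^ Suc i) = Suc i" "floor_log (2 ^ i) = i" by (rule floor_log_power)+
    then show "floor_log n - floor_log (reassign l Y (2 ^ i) x) \<le>
        floor_log n - floor_log (l x) + (if x \<in> Y then 1 else 0)"
      using assms(2)[of x] by (auto simp add: reassign_def simp del: power_Suc)
  qed
  moreover have "(\<Sum>x<n. if x \<in> Y then 1 else 0) = card Y"
    using assms(1) by (simp add: sum.If_cases Int_absorb1)
  ultimately show ?thesis by simp
qed

lemma card_fibres:
  assumes "Y \<subseteq> {..<n}" "\<And>x. x \<in> Y \<Longrightarrow> \<phi> x < (n::nat)"
  shows "(\<Sum>t<n. card {x \<in> Y. \<phi> x = t}) = card Y"
proof -
  have "finite Y" using assms(1) finite_subset by blast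
  then show ?thesis
    using sum.group[of Y "{..<n}" \<phi> "\<lambda>_. 1::nat"] assms(2) by (auto simp: image_subset_iff)
qed

lemma sum_pair_delta:
  assumes "finite I" "(a, b) \<in> I"
  shows "(\<Sum>(t, k) \<in> I. if (t, k) = (a, b) then x else 0) = (x :: nat)"
proof -
  have "(\<Sum>(t, k) \<in> I. if (t, k) = (a, b) then x else 0) = (\<Sum>p \<in> I. if p = (a, b) then x else 0)"
    by (rule sum.cong) (auto split: if_splits)
  then show ?thesis using assms by (simp only: sum.delta if_True)
qed

text \<open>The target pair ends with at least \<open>4 * P\<close> vertices and hence without
  deficit, while each vertex adds at most 1 to the deficit of the pair it leaves. Per vertex,
  \<open>2 * 2\<close> is released and at most \<open>3 * 1\<close> is spent. The new level exists
  because \<open>4 * P \<le> card Y \<le> n\<close>.\<close>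

lemma pot_raise:
  assumes n: "0 < n" and Y: "Y \<subseteq> {..<n}" and lY: "\<And>x. x \<in> Y \<Longrightarrow> l x = P"
    and pY: "\<And>x. x \<in> Y \<Longrightarrow> \<phi> x < n" and P: "is_level n P" and big: "4 * P \<le> card Y"
  shows "is_level n (4 * P)" "pot n (reassign \<phi> Y s) (reassign l Y (4 * P)) + card Y \<le> pot n \<phi> l"
proof -
  have "card Y \<le> n" using card_mono[OF _ Y] by simp
  obtain i where i: "P = 2 ^ i" using P by (auto simp: is_level_def)
  have P4: "4 * P = 2 ^ (i + 2)" by (simp add: i power_add)
  show lev4: "is_level n (4 * P)" unfolding is_level_def using P4 big \<open>card Y \<le> n\<close> le_trans by blast
  then have "2 ^ (i + 2) \<le> n" unfolding P4 by (simp add: is_level_def)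
  then have "floor_log (2 ^ (i + 2)) \<le> floor_log n" by (rule floor_log_le_iff)
  then have iL: "i + 2 \<le> floor_log n" by (simp only: floor_log_power)
  let ?c = "\<lambda>t k. cover_count n \<phi> l t (2 ^ k)"
  let ?c' = "\<lambda>t k. cover_count n (reassign \<phi> Y s) (reassign l Y (4 * P)) t (2 ^ k)"
  let ?L = "floor_log n"
  \<comment> \<open>All moved vertices have level \<open>2 ^ i\<close>, so only pairs with this
    exponent are charged; over all \<open>t\<close> the charges add up to
    \<open>card Y\<close>.\<close>
  have pointwise: "deficit (2 ^ k) (?c' t k) \<le>
      deficit (2 ^ k) (?c t k) + (if k = i then card {x \<in> Y. \<phi> x = t} else 0)" for t k
  proof (cases "(t, k) = (s, i + 2)")
    case True
    then have "card Y \<le> ?c' t k" unfolding cover_count_reassign[OF Y] by (simp add: P4)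
    then have "2 ^ k \<le> ?c' t k" using big True unfolding P4 by simp
    then show ?thesis by (simp add: deficit_zero)
  next
    case False
    then have neq: "(t, 2 ^ k) \<noteq> (s, 4 * P)" unfolding P4 using power_inject_exp[of "2::nat" k "i+2"] by simp
    have c': "?c' t k = ?c t k - card {x \<in> Y. \<phi> x = t \<and> l x = 2 ^ k}"
      unfolding cover_count_reassign[OF Y] using neq by auto
    have "card {x \<in> Y. \<phi> x = t \<and> l x = 2 ^ k} \<le> (if k = i then card {x \<in> Y. \<phi> x = t} else 0)"
    proof (cases "k = i")
      case True
      have "finite Y" using Y finite_subset by blast
      then show ?thesis using True by (auto intro: card_mono)
    next
      case False
      then have "{x \<in> Y. \<phi> x = t \<and> l x = 2 ^ k} = {}" using lY i by auto
      then show ?thesis by (simp only: card.empty)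
    qed
    then show ?thesis unfolding c' using deficit_diff[of "2 ^ k" "?c t k"] le_trans by (meson add_left_mono)
  qed
  have "deficit_pot n (reassign \<phi> Y s) (reassign l Y (4 * P)) \<le>
      (\<Sum>(t, k) \<in> {..<n} \<times> {..?L}. deficit (2 ^ k) (?c t k) + (if k = i then card {x \<in> Y. \<phi> x = t} else 0))"
    unfolding deficit_pot_def by (rule sum_mono) (auto intro: pointwise)
  also have "\<dots> = deficit_pot n \<phi> l + (\<Sum>(t, k) \<in> {..<n} \<times> {..?L}. if k = i then card {x \<in> Y. \<phi> x = t} else 0)"
    unfolding deficit_pot_def sum.distrib[symmetric] by (rule sum.cong) auto
  also have "(\<Sum>(t, k) \<in> {..<n} \<times> {..?L}. if k = i then card {x \<in> Y. \<phi> x = t} else 0) = card Y"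
    using iL by (simp add: sum.cartesian_product[symmetric] card_fibres[OF Y pY])
  finally have d: "deficit_pot n (reassign \<phi> Y s) (reassign l Y (4 * P)) \<le> deficit_pot n \<phi> l + card Y" .
  have r: "rank_pot n (reassign l Y (4 * P)) + 2 * card Y = rank_pot n l"
    unfolding P4 using rank_pot_raise[OF Y _ iL] lY i by blast
  show "pot n (reassign \<phi> Y s) (reassign l Y (4 * P)) + card Y \<le> pot n \<phi> l"
    using d r unfolding pot_def by linarith
qed

text \<open>Emptying \<open>(s, P)\<close> removes the deficit \<open>P - card Y\<close>, and
  \<open>(s, P div 2)\<close> gains a deficit of at most \<open>P div 2 - card Y\<close>. The net
  drop is \<open>P div 2 > card Y\<close>; weighted by 3 it exceeds the rank increase, weighted by
  2, by at least \<open>card Y\<close>.\<close>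

lemma pot_lower:
  assumes n: "0 < n" and Y: "Y = {x. x < n \<and> \<phi> x = s \<and> l x = P}" and s: "s < n"
    and P: "is_level n P" and ne: "0 < card Y" and small: "2 * card Y < P"
  shows "is_level n (P div 2)" "pot n (reassign \<phi> Y s) (reassign l Y (P div 2)) + card Y \<le> pot n \<phi> l"
proof -
  have Ysub: "Y \<subseteq> {..<n}" and lY: "\<And>x. x \<in> Y \<Longrightarrow> l x = P" using Y by auto
  obtain i' where i': "P = 2 ^ i'" "i' \<le> floor_log n" using P by (rule is_levelE)
  have "i' \<noteq> 0" using small ne i' by (cases i') auto
  then obtain i where ii: "i' = Suc i" by (cases i') auto
  have i: "P = 2 ^ Suc i" and iL: "Suc i \<le> floor_log n" using i' ii by auto
  have P2: "P div 2 = 2 ^ i" by (simp add: i)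
  show "is_level n (P div 2)" unfolding P2 using iL n by (intro is_level_powI) auto
  let ?c = "\<lambda>t k. cover_count n \<phi> l t (2 ^ k)"
  let ?c' = "\<lambda>t k. cover_count n (reassign \<phi> Y s) (reassign l Y (P div 2)) t (2 ^ k)"
  let ?L = "floor_log n"
  have cY: "?c s (Suc i) = card Y" unfolding cover_count_def Y i ..
  \<comment> \<open>The vanishing deficit is added on the left rather than subtracted on the right,
    which keeps truncated subtraction out of the summation.\<close>
  have pointwise: "deficit (2 ^ k) (?c' t k) + (if (t, k) = (s, Suc i) then P - card Y else 0) \<le>
      deficit (2 ^ k) (?c t k) + (if (t, k) = (s, i) then 2 ^ i - card Y else 0)" for t k
  proof -
    have inj: "(2::nat) ^ k = 2 ^ m \<longleftrightarrow> k = m" for m by simp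
    have c': "?c' t k = ?c t k - card {x \<in> Y. \<phi> x = t \<and> l x = 2 ^ k} + (if (t, k) = (s, i) then card Y else 0)"
      unfolding cover_count_reassign[OF Ysub] P2 by simp
    consider "(t, k) = (s, Suc i)" | "(t, k) = (s, i)" | "(t, k) \<noteq> (s, Suc i)" "(t, k) \<noteq> (s, i)" by blast
    then show ?thesis
    proof cases
      case 1
      then have "{x \<in> Y. \<phi> x = t \<and> l x = 2 ^ k} = Y" using Y i by auto
      then have "?c' t k = 0" using c' cY 1 by simp
      then have "deficit (2 ^ k) (?c' t k) = 0" by (simp add: deficit_def)
      moreover have "deficit (2 ^ k) (?c t k) = P - card Y" using 1 cY ne i by (simp add: deficit_def)
      ultimately show ?thesis using 1 by simp
    next
      case 2
      have "{x \<in> Y. \<phi> x = t \<and> l x = 2 ^ k} = {}" using 2 lY i by auto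
      then have "?c' t k = ?c t k + card Y" using c' 2 by (simp only: card.empty) simp
      then have "deficit (2 ^ k) (?c' t k) \<le> deficit (2 ^ k) (?c t k) + (2 ^ k - card Y)"
        by (simp only: deficit_add)
      then show ?thesis using 2 by simp
    next
      case 3
      have "{x \<in> Y. \<phi> x = t \<and> l x = 2 ^ k} = {}" using 3 i Y inj[of "Suc i"] by (auto simp del: power_Suc)
      then have "?c' t k = ?c t k" using c' 3 by (simp only: card.empty) simp
      then show ?thesis using 3 by (simp only: if_False)
    qed
  qed
  let ?I = "{..<n} \<times> {..?L}"
  have sum1: "(\<Sum>(t, k) \<in> ?I. if (t, k) = (s, m) then x else 0) = x" if "m \<le> ?L" for m and x :: nat
    using that s by (intro sum_pair_delta) auto
  have "deficit_pot n (reassign \<phi> Y s) (reassign l Y (P div 2)) + (P - card Y) \<le> deficit_pot n \<phi> l + (2 ^ i - card Y)"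
  proof -
    have "deficit_pot n (reassign \<phi> Y s) (reassign l Y (P div 2)) + (P - card Y) =
       (\<Sum>(t, k) \<in> ?I. deficit (2 ^ k) (?c' t k) + (if (t, k) = (s, Suc i) then P - card Y else 0))"
      using sum1[of "Suc i" "P - card Y"] iL unfolding deficit_pot_def by (simp add: sum.distrib split_def)
    also have "\<dots> \<le> (\<Sum>(t, k) \<in> ?I. deficit (2 ^ k) (?c t k) + (if (t, k) = (s, i) then 2 ^ i - card Y else 0))"
    proof (rule sum_mono)
      fix p
      show "(case p of (t, k) \<Rightarrow> deficit (2 ^ k) (?c' t k) + (if (t, k) = (s, Suc i) then P - card Y else 0)) \<le>
        (case p of (t, k) \<Rightarrow> deficit (2 ^ k) (?c t k) + (if (t, k) = (s, i) then 2 ^ i - card Y else 0))"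
        using pointwise[of "snd p" "fst p"] by (cases p) simp
    qed
    also have "\<dots> = deficit_pot n \<phi> l + (2 ^ i - card Y)"
      using sum1[of i "2 ^ i - card Y"] iL unfolding deficit_pot_def by (simp add: sum.distrib split_def)
    finally show ?thesis .
  qed
  moreover have "P = 2 ^ i + 2 ^ i" "card Y < 2 ^ i" using i small by auto
  ultimately have d: "deficit_pot n (reassign \<phi> Y s) (reassign l Y (P div 2)) + card Y \<le> deficit_pot n \<phi> l"
    by linarith
  have r: "rank_pot n (reassign l Y (P div 2)) \<le> rank_pot n l + card Y"
    unfolding P2 using rank_pot_lower[OF Ysub] lY i by blast
  show "pot n (reassign \<phi> Y s) (reassign l Y (P div 2)) + card Y \<le> pot n \<phi> l"
    using d r unfolding pot_def by linarith
qed

text \<open>After the move the pair \<open>(v, 1)\<close> has no deficit, the abandoned pair has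
  lost one vertex, and the rank of \<open>v\<close> has grown by at most \<open>floor_log n\<close>.
  The weights 3 and 2 give the bound.\<close>

lemma pot_reset:
  assumes n: "0 < n" and v: "v < n" and pv: "\<phi> v < n" and lv: "is_level n (l v)"
  shows "pot n (\<phi>(v := v)) (l(v := 1)) \<le> pot n \<phi> l + 2 * floor_log n + 3"
proof -
  have re: "\<phi>(v := v) = reassign \<phi> {v} v" "l(v := 1) = reassign l {v} 1" by (auto simp: reassign_def)
  have sub: "{v} \<subseteq> {..<n}" using v by simp
  obtain j where j: "l v = 2 ^ j" "j \<le> floor_log n" using lv by (rule is_levelE)
  let ?L = "floor_log n"
  let ?c = "\<lambda>t k. cover_count n \<phi> l t (2 ^ k)"
  let ?c' = "\<lambda>t k. cover_count n (reassign \<phi> {v} v) (reassign l {v} 1) t (2 ^ k)"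
  have pointwise: "deficit (2 ^ k) (?c' t k) \<le> deficit (2 ^ k) (?c t k) + (if (t, k) = (\<phi> v, j) then 1 else 0)" for t k
  proof (cases "(t, k) = (v, 0)")
    case True
    then have "1 \<le> ?c' t k" unfolding cover_count_reassign[OF sub] by simp
    then show ?thesis using True by (simp add: deficit_zero)
  next
    case False
    then have c': "?c' t k = ?c t k - card {x \<in> {v}. \<phi> x = t \<and> l x = 2 ^ k}"
      unfolding cover_count_reassign[OF sub] by auto
    have "{x \<in> {v}. \<phi> x = t \<and> l x = 2 ^ k} = (if (t, k) = (\<phi> v, j) then {v} else {})"
      using j by auto
    then have "card {x \<in> {v}. \<phi> x = t \<and> l x = 2 ^ k} = (if (t, k) = (\<phi> v, j) then 1 else 0)"
      by (simp only:) simp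
    then show ?thesis unfolding c' using deficit_diff[of "2 ^ k" "?c t k"] by simp
  qed
  have "(\<Sum>(t, k) \<in> {..<n} \<times> {..?L}. if (t, k) = (\<phi> v, j) then 1 else (0::nat)) = 1"
    using pv j by (intro sum_pair_delta) auto
  moreover have "deficit_pot n (reassign \<phi> {v} v) (reassign l {v} 1) \<le>
      (\<Sum>(t, k) \<in> {..<n} \<times> {..?L}. deficit (2 ^ k) (?c t k) + (if (t, k) = (\<phi> v, j) then 1 else 0))"
    unfolding deficit_pot_def
  proof (rule sum_mono)
    fix p
    show "(case p of (t, k) \<Rightarrow> deficit (2 ^ k) (?c' t k)) \<le>
        (case p of (t, k) \<Rightarrow> deficit (2 ^ k) (?c t k) + (if (t, k) = (\<phi> v, j) then 1 else 0))"
      using pointwise[of "snd p" "fst p"] by (cases p) simp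
  qed
  ultimately have d: "deficit_pot n (reassign \<phi> {v} v) (reassign l {v} 1) \<le> deficit_pot n \<phi> l + 1"
    unfolding deficit_pot_def by (simp add: sum.distrib split_def)
  have "rank_pot n (reassign l {v} 1) \<le> (\<Sum>x<n. floor_log n - floor_log (l x) + (if x = v then ?L else 0))"
    unfolding rank_pot_def by (rule sum_mono) (auto simp: reassign_def)
  also have "\<dots> = rank_pot n l + ?L"
    using v by (simp add: sum.distrib rank_pot_def)
  finally show ?thesis using d unfolding re pot_def by linarith
qed

text \<open>A crude polynomial bound. It serves to show that the stack pointer, whose growth is
  controlled by the potential, fits into a word.\<close>

lemma pot_le:
  assumes "0 < n"
  shows "pot n \<phi> l \<le> 8 * (n + 1) ^ 3"
proof -
  have "rank_pot n l \<le> (\<Sum>v<n. n)"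
    unfolding rank_pot_def by (rule sum_mono) (meson diff_le_self floor_log_le_self le_trans)
  then have r: "rank_pot n l \<le> n * n" by simp
  have "deficit_pot n \<phi> l \<le> (\<Sum>p \<in> {..<n} \<times> {..floor_log n}. n)"
    unfolding deficit_pot_def
  proof (rule sum_mono)
    fix p assume "p \<in> {..<n} \<times> {..floor_log n}"
    then show "(case p of (s, i) \<Rightarrow> deficit (2 ^ i) (cover_count n \<phi> l s (2 ^ i))) \<le> n"
      using is_level_powI[OF assms, of "snd p"] le_trans[OF deficit_le, of "2 ^ snd p" n]
      by (auto simp: is_level_def)
  qed
  also have "\<dots> = n * (floor_log n + 1) * n" by (simp add: card_cartesian_product)
  also have "\<dots> \<le> n * (n + 1) * n" using floor_log_le_self by simp
  finally have d: "deficit_pot n \<phi> l \<le> n * (n + 1) * n" .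
  have "2 * (n * n) + 3 * (n * (n + 1) * n) \<le> 8 * (n + 1) ^ 3"
    by (simp add: power3_eq_cube algebra_simps)
  then show ?thesis using r d unfolding pot_def by linarith
qed

text \<open>Each vertex alone fills its own pair at level 1, so no deficit occurs and only the rank
  part remains.\<close>

lemma pot_init:
  assumes "\<And>v. v < n \<Longrightarrow> \<phi> v = v" "\<And>v. v < n \<Longrightarrow> l v = 1"
  shows "pot n \<phi> l \<le> 2 * n * floor_log n"
proof -
  have "rank_pot n l \<le> (\<Sum>v<n. floor_log n)"
    unfolding rank_pot_def by (rule sum_mono) simp
  moreover have "deficit_pot n \<phi> l = 0"
    unfolding deficit_pot_def
  proof (rule sum.neutral, clarsimp)
    fix s i assume "s < n"
    have "1 = (2::nat) ^ i \<longleftrightarrow> i = 0" by (cases i) auto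
    moreover have "{x. x < n \<and> \<phi> x = s \<and> l x = 2 ^ i} = {x. x = s \<and> 1 = (2::nat) ^ i}"
      using \<open>s < n\<close> assms by metis
    ultimately have "{x. x < n \<and> \<phi> x = s \<and> l x = 2 ^ i} = (if i = 0 then {s} else {})" by auto
    then show "deficit (2 ^ i) (cover_count n \<phi> l s (2 ^ i)) = 0"
      unfolding cover_count_def by (simp add: deficit_def)
  qed
  ultimately show ?thesis unfolding pot_def by simp
qed

text \<open>Double counting of the charges \<open>g x\<close>. The cover-count half of stability
  bounds their sum from below by the number of dominators; the level-count half bounds it from above
  by 8 for each level and each member of \<open>D\<close>.\<close>

lemma stable_approx:
  assumes n: "0 < n" and phi: "\<And>v. v < n \<Longrightarrow> \<phi> v < n" and lvl: "\<And>v. v < n \<Longrightarrow> is_level n (l v)"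
    and N: "\<And>u. u < n \<Longrightarrow> N u \<subseteq> {..<n}" and stable: "\<And>u P. u < n \<Longrightarrow> 0 < P \<Longrightarrow> \<not> unstable n N \<phi> l u P"
    and D: "D \<subseteq> {..<n}" and dom: "\<And>v. v < n \<Longrightarrow> \<exists>u\<in>D. v \<in> N u"
  shows "real (card (\<phi> ` {..<n})) \<le> 8 * (real (floor_log n) + 1) * real (card D)"
proof -
  define g where "g x = 2 / real (l x)" for x
  have g0: "0 \<le> g x" for x by (simp add: g_def)
  have finD: "finite D" using D finite_subset by blast
  have "real (card (\<phi> ` {..<n})) = (\<Sum>s\<in>\<phi> ` {..<n}. 1)" by simp
  also have "\<dots> \<le> (\<Sum>s\<in>\<phi> ` {..<n}. \<Sum>x | x \<in> {..<n} \<and> \<phi> x = s. g x)"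
  proof (rule sum_mono)
    fix s assume "s \<in> \<phi> ` {..<n}"
    then obtain x where x: "x < n" "\<phi> x = s" by auto
    then have s: "s < n" using phi by auto
    \<comment> \<open>One nonempty pair of \<open>s\<close> already receives a charge of 1; the
      remaining levels of \<open>s\<close> only add nonnegative terms.\<close>
    let ?P = "l x"
    have P: "0 < ?P" using lvl[OF x(1)] is_level_bounds by blast
    let ?A = "{y. y < n \<and> \<phi> y = s \<and> l y = ?P}"
    have "x \<in> ?A" using x by simp
    then have "0 < cover_count n \<phi> l s ?P" unfolding cover_count_def by (subst card_gt_0_iff) auto
    then have "?P \<le> 2 * cover_count n \<phi> l s ?P" using stable[OF s P] by (auto simp: unstable_def)
    then have "real ?P \<le> 2 * real (card ?A)"
      unfolding cover_count_def by (metis of_nat_le_iff of_nat_mult of_nat_numeral)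
    then have "1 \<le> real (card ?A) * (2 / real ?P)" using P by (simp add: field_simps)
    also have "\<dots> = (\<Sum>y\<in>?A. g y)" by (simp add: g_def)
    also have "\<dots> \<le> (\<Sum>x | x \<in> {..<n} \<and> \<phi> x = s. g x)"
      by (rule sum_mono2) (auto simp: g0)
    finally show "1 \<le> (\<Sum>x | x \<in> {..<n} \<and> \<phi> x = s. g x)" .
  qed
  also have "\<dots> = (\<Sum>x<n. g x)" by (rule sum.image_gen[symmetric]) simp
  also have "\<dots> \<le> (\<Sum>x<n. \<Sum>u\<in>D. if x \<in> N u then g x else 0)"
  proof (rule sum_mono)
    fix x assume "x \<in> {..<n}"
    then obtain u where u: "u \<in> D" "x \<in> N u" using dom by auto
    show "g x \<le> (\<Sum>u\<in>D. if x \<in> N u then g x else 0)"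
      using member_le_sum[of u D "\<lambda>u. if x \<in> N u then g x else 0"] u finD g0 by simp
  qed
  also have "\<dots> = (\<Sum>u\<in>D. \<Sum>x<n. if x \<in> N u then g x else 0)" by (rule sum.swap)
  also have "\<dots> \<le> (\<Sum>u\<in>D. 8 * (real (floor_log n) + 1))"
  proof (rule sum_mono)
    fix u assume "u \<in> D"
    then have u: "u < n" using D by auto
    have finN: "finite (N u)" using N[OF u] finite_subset by blast
    have "(\<Sum>x<n. if x \<in> N u then g x else 0) = (\<Sum>x\<in>N u. g x)"
      using N[OF u] by (simp add: sum.If_cases Int_absorb1)
    also have "\<dots> = (\<Sum>P\<in>(\<lambda>i. 2 ^ i) ` {..floor_log n}. \<Sum>x | x \<in> N u \<and> l x = P. g x)"
    proof (rule sum.group[symmetric, OF finN])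
      show "l ` N u \<subseteq> (\<lambda>i. 2 ^ i) ` {..floor_log n}"
      proof
        fix P assume "P \<in> l ` N u"
        then obtain x where "x < n" "P = l x" using N[OF u] by auto
        then have "is_level n P" using lvl by simp
        then show "P \<in> (\<lambda>i. 2 ^ i) ` {..floor_log n}" by (rule is_levelE) auto
      qed
    qed simp
    also have "\<dots> = (\<Sum>i\<le>floor_log n. \<Sum>x | x \<in> N u \<and> l x = 2 ^ i. g x)"
      by (subst sum.reindex) (auto simp: inj_on_def)
    also have "\<dots> \<le> (\<Sum>i\<le>floor_log n. 8)"
    proof (rule sum_mono)
      fix i
      have "(\<Sum>x | x \<in> N u \<and> l x = 2 ^ i. g x) = real (level_count N l u (2 ^ i)) * (2 / 2 ^ i)"
        unfolding level_count_def by (simp add: g_def)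
      \<comment> \<open>Fewer than \<open>4 * 2 ^ i\<close> vertices carry a charge of
        \<open>2 / 2 ^ i\<close> each, which explains the 8 per level.\<close>
      moreover have "level_count N l u (2 ^ i) < 4 * 2 ^ i" using stable[OF u, of "2 ^ i"] by (auto simp: unstable_def)
      then have "real (level_count N l u (2 ^ i)) \<le> 4 * 2 ^ i"
        using of_nat_mono[OF less_imp_le, of "level_count N l u (2 ^ i)" "4 * 2 ^ i", where 'a = real] by simp
      then have "real (level_count N l u (2 ^ i)) * (2 / 2 ^ i) \<le> 4 * 2 ^ i * (2 / 2 ^ i)"
        by (rule mult_right_mono) simp
      ultimately show "(\<Sum>x | x \<in> N u \<and> l x = 2 ^ i. g x) \<le> 8"
        by simp
    qed
    finally show "(\<Sum>x<n. if x \<in> N u then g x else 0) \<le> 8 * (real (floor_log n) + 1)"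
      by (simp add: algebra_simps)
  qed
  finally show ?thesis by (simp add: algebra_simps)
qed

text \<open>A move lowers a cover count only at the pair that \<open>v\<close> leaves, and raises
  level counts only at level \<open>Q\<close> around \<open>v\<close>. The arrival pair
  \<open>(t, Q)\<close> belongs to the last case because \<open>t \<in> N v\<close>. Hence it is
  enough to push the abandoned pair and all \<open>(u, Q)\<close> with
  \<open>u \<in> N v\<close>.\<close>

lemma unstable_reassign:
  assumes "unstable n N (\<phi>(v := t)) (l(v := Q)) u P" "v < n" "t \<in> N v" "finite (N u)" "v \<in> N u \<longleftrightarrow> u \<in> N v"
  shows "unstable n N \<phi> l u P \<or> (u, P) = (\<phi> v, l v) \<or> P = Q \<and> u \<in> N v"
proof (rule ccontr)
  assume neg: "\<not> ?thesis"
  have "{x. x < n \<and> (\<phi>(v := t)) x = u \<and> (l(v := Q)) x = P} = {x. x < n \<and> \<phi> x = u \<and> l x = P}"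
    using neg assms by auto
  then have cov: "cover_count n (\<phi>(v := t)) (l(v := Q)) u P = cover_count n \<phi> l u P" by (simp add: cover_count_def)
  have "{x \<in> N u. (l(v := Q)) x = P} \<subseteq> {x \<in> N u. l x = P}" using neg assms by auto
  then have "level_count N (l(v := Q)) u P \<le> level_count N l u P"
    unfolding level_count_def using assms(4) by (intro card_mono) auto
  then show False using neg assms(1) cov by (auto simp: unstable_def)
qed

section \<open>Weakest preconditions with running time\<close>

text \<open>Total correctness: termination is part of the assertion, and the postcondition receives
  the exact running time along with the final state.\<close>

definition wp :: "nat \<Rightarrow> com \<Rightarrow> (nat \<Rightarrow> state \<Rightarrow> bool) \<Rightarrow> state \<Rightarrow> bool" where
  "wp w c Q s \<longleftrightarrow> (\<exists>t s'. exec w c s t s' \<and> Q t s')"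

lemma wp_Skip: "wp w Skip Q s = Q 1 s"
  unfolding wp_def by (metis exec.Skip exec_SkipE)

lemma wp_Assign: "wp w (Assign r e) Q s = Q (1 + cost e) \<lparr>regs = (regs s)(r := eval w s e), arrs = arrs s\<rparr>"
proof -
  have "s\<lparr>regs := (regs s)(r := eval w s e)\<rparr> = \<lparr>regs = (regs s)(r := eval w s e), arrs = arrs s\<rparr>" by simp
  then show ?thesis unfolding wp_def by (metis exec.Assign exec_AssignE)
qed

lemma wp_Store: "wp w (Store a i e) Q s = Q (1 + cost i + cost e)
    \<lparr>regs = regs s, arrs = (arrs s)(a := (arrs s a)(eval w s i := eval w s e))\<rparr>"
proof -
  have "s\<lparr>arrs := (arrs s)(a := (arrs s a)(eval w s i := eval w s e))\<rparr> =
      \<lparr>regs = regs s, arrs = (arrs s)(a := (arrs s a)(eval w s i := eval w s e))\<rparr>" by simp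
  then show ?thesis unfolding wp_def by (metis exec.Store exec_StoreE)
qed

lemma wp_Seq: "wp w (Seq c1 c2) Q s = wp w c1 (\<lambda>t. wp w c2 (\<lambda>t'. Q (t + t'))) s"
  unfolding wp_def by (blast intro: exec.Seq elim: exec_SeqE)

lemma wp_Cond: "wp w (Cond b c1 c2) Q s =
    (if eval w s b \<noteq> 0 then wp w c1 (\<lambda>t. Q (1 + cost b + t)) s else wp w c2 (\<lambda>t. Q (1 + cost b + t)) s)"
proof
  assume "wp w (Cond b c1 c2) Q s"
  then obtain t s' where "exec w (Cond b c1 c2) s t s'" "Q t s'" unfolding wp_def by blast
  then show "if eval w s b \<noteq> 0 then wp w c1 (\<lambda>t. Q (1 + cost b + t)) s else wp w c2 (\<lambda>t. Q (1 + cost b + t)) s"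
    unfolding wp_def by (cases rule: exec_CondE) auto
next
  assume "if eval w s b \<noteq> 0 then wp w c1 (\<lambda>t. Q (1 + cost b + t)) s else wp w c2 (\<lambda>t. Q (1 + cost b + t)) s"
  then show "wp w (Cond b c1 c2) Q s"
    unfolding wp_def by (metis exec.CondTrue exec.CondFalse)
qed

lemma wp_mono: "wp w c Q s \<Longrightarrow> (\<And>t s'. Q t s' \<Longrightarrow> Q' t s') \<Longrightarrow> wp w c Q' s"
  unfolding wp_def by blast

text \<open>The invariant carries the time elapsed so far. It may start at any offset
  \<open>t\<close>, so that the cost of preceding code can be included; the measure \<open>m\<close>
  gives termination.\<close>

lemma wp_While:
  assumes "I t s"
    and step: "\<And>t s. I t s \<Longrightarrow> eval w s b \<noteq> 0 \<Longrightarrow>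
      wp w c (\<lambda>t' s'. I (t + (1 + cost b + t')) s' \<and> m s' < (m s :: nat)) s"
    and exit: "\<And>t s. I t s \<Longrightarrow> eval w s b = 0 \<Longrightarrow> Q (t + (1 + cost b)) s"
  shows "wp w (While b c) (\<lambda>t'. Q (t + t')) s"
  using assms(1)
proof (induction "m s" arbitrary: t s rule: less_induct)
  case less
  show ?case
  proof (cases "eval w s b = 0")
    case True
    then show ?thesis unfolding wp_def using exec.WhileFalse exit[OF less.prems] by blast
  next
    case False
    from step[OF less.prems False] obtain t' s' where s':
      "exec w c s t' s'" "I (t + (1 + cost b + t')) s'" "m s' < m s" unfolding wp_def by blast
    from less.hyps[OF s'(3,2)] obtain t'' s'' where s'':
      "exec w (While b c) s' t'' s''" "Q (t + (1 + cost b + t') + t'') s''" unfolding wp_def by blast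
    have "exec w (While b c) s (1 + cost b + t' + t'') s''"
      using False s'(1) s''(1) by (rule exec.WhileTrue)
    then show ?thesis unfolding wp_def using s''(2) by (metis add.assoc)
  qed
qed

section \<open>Program abbreviations\<close>

primrec block :: "com list \<Rightarrow> com" where
  "block [] = Skip"
| "block (c # cs) = Seq c (block cs)"

definition inc :: "expr \<Rightarrow> expr" where "inc e = Bin Add e (Const 1)"
definition dec :: "expr \<Rightarrow> expr" where "dec e = Bin Sub e (Const 1)"
text \<open>Row-major addressing with rows of length \<open>n\<close>, the value that
  \<open>represents\<close> requires in register 0.\<close>

definition idx :: "expr \<Rightarrow> expr \<Rightarrow> expr" where "idx a b = Bin Add (Bin Mul a (Reg 0)) b"

definition incr :: "nat \<Rightarrow> expr \<Rightarrow> com" where "incr a i = Store a i (inc (Load a i))"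
definition decr :: "nat \<Rightarrow> expr \<Rightarrow> com" where "decr a i = Store a i (dec (Load a i))"

definition push :: "expr \<Rightarrow> expr \<Rightarrow> com" where
  "push a b = block [Store 9 (Reg 5) a, Store 10 (Reg 5) b, Assign 5 (inc (Reg 5))]"

section \<open>Reassigning a vertex\<close>

text \<open>
  Memory layout. Array 2: number of vertices assigned to a dominator, which is also the output flag;
  3: closed neighbourhoods, the \<open>i\<close>-th member of \<open>N u\<close> at \<open>u * n + i\<close>; 4: their sizes; 5: \<open>\<phi>\<close>;
  6: \<open>l\<close>; 7 and 8: cover counts and level counts of the pair \<open>(u, P)\<close> at \<open>P * n + u\<close>;
  9 and 10: a stack of pairs that still have to be examined. Register 5 is the stack pointer, and
  \<open>move\<close> reassigns the vertex in register 11 to the pair in registers 12 and 13.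
\<close>

definition move_body :: com where
  "move_body = block
    [Assign 17 (Load 3 (idx (Reg 11) (Reg 16))),
     decr 8 (idx (Reg 15) (Reg 17)),
     incr 8 (idx (Reg 13) (Reg 17)),
     push (Reg 17) (Reg 13),
     Assign 16 (inc (Reg 16))]"

text \<open>The exponent leaves room for the stack pointer, which the potential bounds by \<open>O(n ^ 4)\<close>.\<close>

definition ample_words :: "nat \<Rightarrow> nat \<Rightarrow> bool" where
  "ample_words w n \<longleftrightarrow> 0 < n \<and> (n + 1) ^ 10 \<le> 2 ^ w"

text \<open>Since \<open>n > 0\<close>, the factor \<open>32 = 2 ^ 5\<close> is at most
  \<open>(n + 1) ^ 5\<close>, so half of the exponent 10 absorbs it.\<close>

lemma ample_words_less:
  assumes "ample_words w n" "x < 32 * (n + 1) ^ 5"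
  shows "x < 2 ^ w"
proof -
  have "(2::nat) ^ 5 \<le> (n + 1) ^ 5" using assms(1) by (intro power_mono) (auto simp: ample_words_def)
  then have "32 * (n + 1) ^ 5 \<le> (n + 1) ^ 5 * (n + 1) ^ 5" by (intro mult_right_mono) auto
  also have "\<dots> = (n + 1) ^ 10" by (simp flip: power_add)
  also have "\<dots> \<le> 2 ^ w" using assms(1) by (simp add: ample_words_def)
  finally show ?thesis using assms(2) by linarith
qed

lemma ample_words_less_square:
  assumes "ample_words w n" "x < 32 * (n + 1) * (n + 1)"
  shows "x < 2 ^ w"
proof (rule ample_words_less[OF assms(1)])
  have "(n + 1) * (n + 1) \<le> (n + 1) ^ 5"
    using power_increasing[of 2 5 "n + 1"] by (simp add: power2_eq_square)
  then show "x < 32 * (n + 1) ^ 5" using assms(2) by linarith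
qed

lemma ample_words_idx: "ample_words w n \<Longrightarrow> P \<le> n \<Longrightarrow> u \<le> n \<Longrightarrow> P * n + u < 2 ^ w"
proof (rule ample_words_less_square)
  assume "P \<le> n" "u \<le> n"
  then have "P * n + u \<le> n * n + n" by (intro add_mono mult_le_mono) auto
  also have "\<dots> < 32 * (n + 1) * (n + 1)" by (simp add: algebra_simps)
  finally show "P * n + u < 32 * (n + 1) * (n + 1)" .
qed

lemma ample_words_word: "ample_words w n \<Longrightarrow> 0 < w"
  using ample_words_less_square[of w n 1] by (cases w) auto

lemma eval_inc: "eval w s e + 1 < 2 ^ w \<Longrightarrow> eval w s (inc e) = eval w s e + 1"
  by (cases w) (simp_all add: inc_def mod_simps)

lemma eval_dec: "0 < w \<Longrightarrow> eval w s (dec e) = eval w s e - 1"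
  by (simp add: dec_def)

lemma eval_idx: "eval w s a * regs s 0 + eval w s b < 2 ^ w \<Longrightarrow>
    eval w s (idx a b) = eval w s a * regs s 0 + eval w s b"
  by (simp add: idx_def mod_simps)

lemma of_bool_mod: "0 < w \<Longrightarrow> of_bool b mod 2 ^ w = (of_bool b :: nat)"
  by (cases w) (auto simp: of_bool_def)

lemma cost_simps: "cost (inc e) = cost e + 2" "cost (dec e) = cost e + 2" "cost (idx a b) = cost a + cost b + 3"
  by (simp_all add: inc_def dec_def idx_def)

lemmas wp_simps = wp_Skip wp_Assign wp_Store wp_Seq wp_Cond incr_def decr_def push_def eval_inc eval_dec eval_idx of_bool_mod cost_simps

text \<open>The two updates of array 8 are nested because \<open>P\<close> and \<open>j\<close> may
  be equal, in which case the increment reads the value that was just decremented.\<close>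

definition move_body_state :: "nat \<Rightarrow> nat \<Rightarrow> nat \<Rightarrow> nat \<Rightarrow> nat \<Rightarrow> state \<Rightarrow> state" where
  "move_body_state n u P j i s = \<lparr>
    regs = (regs s)(17 := u, 5 := regs s 5 + 1, 16 := i + 1),
    arrs = (arrs s)(8 := (arrs s 8)(P * n + u := arrs s 8 (P * n + u) - 1,
               j * n + u := ((arrs s 8)(P * n + u := arrs s 8 (P * n + u) - 1)) (j * n + u) + 1),
             9 := (arrs s 9)(regs s 5 := u), 10 := (arrs s 10)(regs s 5 := j))\<rparr>"

text \<open>The side conditions exclude wraparound in all addresses and counters, so symbolic
  execution yields the final state and the cost exactly.\<close>

lemma wp_move_body:
  assumes "0 < w" "regs s 0 = n" "regs s 11 = v" "regs s 16 = i" "regs s 15 = P" "regs s 13 = j"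
    "arrs s 3 (v * n + i) = u" "v * n + i < 2 ^ w" "P * n + u < 2 ^ w" "j * n + u < 2 ^ w"
    "((arrs s 8)(P * n + u := arrs s 8 (P * n + u) - 1)) (j * n + u) + 1 < 2 ^ w"
    "i + 1 < 2 ^ w" "regs s 5 + 1 < 2 ^ w"
  shows "wp w move_body Q s = Q 51 (move_body_state n u P j i s)"
  using assms by (simp add: move_body_def move_body_state_def wp_simps)

definition move_init :: com where
  "move_init = block
    [Assign 14 (Load 5 (Reg 11)),
     Assign 15 (Load 6 (Reg 11)),
     decr 2 (Reg 14),
     decr 7 (idx (Reg 15) (Reg 14)),
     push (Reg 14) (Reg 15),
     incr 2 (Reg 12),
     incr 7 (idx (Reg 13) (Reg 12)),
     Store 5 (Reg 11) (Reg 12),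
     Store 6 (Reg 11) (Reg 13),
     Assign 16 (Const 0)]"

definition move_init_state :: "nat \<Rightarrow> nat \<Rightarrow> nat \<Rightarrow> nat \<Rightarrow> nat \<Rightarrow> nat \<Rightarrow> state \<Rightarrow> state" where
  "move_init_state n v t j a P s = \<lparr>
    regs = (regs s)(14 := a, 15 := P, 5 := regs s 5 + 1, 16 := 0),
    arrs = (arrs s)(9 := (arrs s 9)(regs s 5 := a), 10 := (arrs s 10)(regs s 5 := P),
             2 := (arrs s 2)(a := arrs s 2 a - 1, t := ((arrs s 2)(a := arrs s 2 a - 1)) t + 1),
             7 := (arrs s 7)(P * n + a := arrs s 7 (P * n + a) - 1,
               j * n + t := ((arrs s 7)(P * n + a := arrs s 7 (P * n + a) - 1)) (j * n + t) + 1),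
             5 := (arrs s 5)(v := t), 6 := (arrs s 6)(v := j))\<rparr>"

lemma wp_move_init:
  assumes "0 < w" "regs s 0 = n" "regs s 11 = v" "regs s 12 = t" "regs s 13 = j" "arrs s 5 v = a" "arrs s 6 v = P"
    "P * n + a < 2 ^ w" "j * n + t < 2 ^ w"
    "((arrs s 2)(a := arrs s 2 a - 1)) t + 1 < 2 ^ w"
    "((arrs s 7)(P * n + a := arrs s 7 (P * n + a) - 1)) (j * n + t) + 1 < 2 ^ w"
    "regs s 5 + 1 < 2 ^ w"
  shows "wp w move_init Q s = Q 66 (move_init_state n v t j a P s)"
  using assms by (simp add: move_init_def move_init_state_def wp_simps)

definition move :: com where
  "move = Seq move_init (While (Bin Less (Reg 16) (Load 4 (Reg 11))) move_body)"

text \<open>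
  \<open>N\<close> need not be symmetric, since an edge is inserted or deleted one direction at a time. The last
  conjunct says that every unstable pair is on the stack.
\<close>

definition represents :: "nat \<Rightarrow> (nat \<Rightarrow> nat set) \<Rightarrow> state \<Rightarrow> bool" where
  "represents n N s \<longleftrightarrow> regs s 0 = n \<and>
    (\<forall>u<n. N u \<subseteq> {..<n} \<and> bij_betw (\<lambda>i. arrs s 3 (u * n + i)) {..<arrs s 4 u} (N u)) \<and>
    (\<forall>u<n. arrs s 5 u < n \<and> is_level n (arrs s 6 u)) \<and>
    (\<forall>u<n. arrs s 2 u = card {x. x < n \<and> arrs s 5 x = u}) \<and>
    (\<forall>u<n. \<forall>P. arrs s 7 (P * n + u) = cover_count n (arrs s 5) (arrs s 6) u P) \<and>
    (\<forall>u<n. \<forall>P. arrs s 8 (P * n + u) = level_count N (arrs s 6) u P) \<and>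
    (\<forall>k<regs s 5. arrs s 9 k < n \<and> is_level n (arrs s 10 k)) \<and>
    (\<forall>u<n. \<forall>P>0. unstable n N (arrs s 5) (arrs s 6) u P \<longrightarrow>
      (\<exists>k<regs s 5. arrs s 9 k = u \<and> arrs s 10 k = P))"

lemma idx_inj:
  assumes "u < n" "u' < (n::nat)"
  shows "Q * n + u = Q' * n + u' \<longleftrightarrow> Q = Q' \<and> u = u'"
proof
  assume eq: "Q * n + u = Q' * n + u'"
  have "(Q * n + u) div n = Q" "(Q' * n + u') div n = Q'" "(Q * n + u) mod n = u" "(Q' * n + u') mod n = u'"
    using assms by auto
  then show "Q = Q' \<and> u = u'" using eq by simp
qed simp

text \<open>The form of a decrement followed by an increment matches the two array writes. It is
  also correct for \<open>j = l v\<close>, since \<open>v\<close> itself is then counted and the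
  subtraction does not truncate.\<close>

lemma level_count_upd:
  assumes "finite (N u)" "v \<in> N u"
  shows "level_count N (l(v := j)) u Q = level_count N l u Q - (if Q = l v then 1 else 0) + (if Q = j then 1 else 0)"
proof -
  have "{x \<in> N u. (l(v := j)) x = Q} = ({x \<in> N u. l x = Q} - (if Q = l v then {v} else {})) \<union> (if Q = j then {v} else {})"
    using assms by (auto split: if_splits)
  moreover have "card (({x \<in> N u. l x = Q} - (if Q = l v then {v} else {})) \<union> (if Q = j then {v} else {})) =
     card ({x \<in> N u. l x = Q} - (if Q = l v then {v} else {})) + card (if Q = j then {v} else {})"
    using assms by (intro card_Un_disjoint) auto
  moreover have "card ({x \<in> N u. l x = Q} - (if Q = l v then {v} else {})) = card {x \<in> N u. l x = Q} - (if Q = l v then 1 else 0)"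
    using assms by (auto simp: card_Diff_singleton)
  ultimately show ?thesis unfolding level_count_def by simp
qed

lemma cover_count_upd:
  assumes "v < n"
  shows "cover_count n (\<phi>(v := t)) (l(v := j)) u Q =
    cover_count n \<phi> l u Q - (if (u, Q) = (\<phi> v, l v) then 1 else 0) + (if (u, Q) = (t, j) then 1 else 0)"
proof -
  have re: "\<phi>(v := t) = reassign \<phi> {v} t" "l(v := j) = reassign l {v} j" by (auto simp: reassign_def)
  have "{x \<in> {v}. \<phi> x = u \<and> l x = Q} = (if (u, Q) = (\<phi> v, l v) then {v} else {})" by auto
  then have "card {x \<in> {v}. \<phi> x = u \<and> l x = Q} = (if (u, Q) = (\<phi> v, l v) then 1 else 0)" by (simp only:) simp
  then show ?thesis unfolding re using assms by (subst cover_count_reassign) auto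
qed

text \<open>A fibre of \<open>\<phi>\<close> is a level count for the constant neighbourhood
  \<open>{..<n}\<close>, so \<open>level_count_upd\<close> applies.\<close>

lemma card_fibre_upd:
  fixes \<phi> :: "nat \<Rightarrow> nat"
  assumes "v < n"
  shows "card {x. x < n \<and> (\<phi>(v := t)) x = u} =
    card {x. x < n \<and> \<phi> x = u} - (if u = \<phi> v then 1 else 0) + (if u = t then 1 else 0)"
  using level_count_upd[of "\<lambda>_. {..<n::nat}" _ v \<phi> t u] assms by (simp add: level_count_def)

lemma level_count_le: "N u \<subseteq> {..<n} \<Longrightarrow> level_count N l u Q \<le> n"
  unfolding level_count_def by (rule order_trans[OF card_mono[of "{..<n}"]]) auto

text \<open>The state after \<open>i\<close> members of \<open>N v\<close> have been visited.
  Dominators, levels and cover counts are already final, while level counts reflect the new level of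
  \<open>v\<close> only at visited vertices. The new part of the stack is the abandoned pair
  followed by one pair per visited vertex.\<close>

definition move_inv where
  "move_inv n N v t j s i x \<longleftrightarrow>
    i \<le> arrs s 4 v \<and> regs x 16 = i \<and> regs x 5 = regs s 5 + 1 + i \<and> regs x 15 = arrs s 6 v \<and>
    (\<forall>r. r \<notin> {5, 14, 15, 16, 17} \<longrightarrow> regs x r = regs s r) \<and>
    arrs x 0 = arrs s 0 \<and> arrs x 1 = arrs s 1 \<and> arrs x 3 = arrs s 3 \<and> arrs x 4 = arrs s 4 \<and>
    arrs x 5 = (arrs s 5)(v := t) \<and> arrs x 6 = (arrs s 6)(v := j) \<and>
    (\<forall>u<n. arrs x 2 u = card {y. y < n \<and> arrs x 5 y = u}) \<and>
    (\<forall>u<n. \<forall>P. arrs x 7 (P * n + u) = cover_count n (arrs x 5) (arrs x 6) u P) \<and>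
    (\<forall>u<n. \<forall>P. arrs x 8 (P * n + u) =
      level_count N (if u \<in> (\<lambda>i. arrs s 3 (v * n + i)) ` {..<i} then arrs x 6 else arrs s 6) u P) \<and>
    (\<forall>k<regs s 5. arrs x 9 k = arrs s 9 k \<and> arrs x 10 k = arrs s 10 k) \<and>
    arrs x 9 (regs s 5) = arrs s 5 v \<and> arrs x 10 (regs s 5) = arrs s 6 v \<and>
    (\<forall>k<i. arrs x 9 (regs s 5 + 1 + k) = arrs s 3 (v * n + k) \<and> arrs x 10 (regs s 5 + 1 + k) = j)"

text \<open>By symmetry, the vertices whose level counts involve \<open>v\<close> are exactly those
  in the list of \<open>v\<close>, so one pass over this list repairs array 8. By
  \<open>unstable_reassign\<close>, the pairs pushed on the way include every newly unstable
  one.\<close>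

lemma wp_move:
  assumes ample_words: "ample_words w n" and represents: "represents n N s" and v: "regs s 11 = v" "v < n"
    and t: "regs s 12 = t" "t \<in> N v" and j: "regs s 13 = j" "is_level n j"
    and sym: "\<And>u. u < n \<Longrightarrow> v \<in> N u \<longleftrightarrow> u \<in> N v"
    and sp: "regs s 5 + card (N v) + 1 < 2 ^ w"
  shows "wp w move (\<lambda>\<tau> x. \<tau> \<le> 80 + 60 * card (N v) \<and> represents n N x \<and>
    arrs x 0 = arrs s 0 \<and> arrs x 1 = arrs s 1 \<and> arrs x 3 = arrs s 3 \<and> arrs x 4 = arrs s 4 \<and>
    arrs x 5 = (arrs s 5)(v := t) \<and> arrs x 6 = (arrs s 6)(v := j) \<and>
    regs x 5 = regs s 5 + card (N v) + 1 \<and> (\<forall>r. r \<notin> {5, 14, 15, 16, 17} \<longrightarrow> regs x r = regs s r)) s"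
proof -
  let ?a = "arrs s 5 v" and ?P = "arrs s 6 v" and ?d = "arrs s 4 v"
  let ?e = "\<lambda>i. arrs s 3 (v * n + i)"
  note repD = represents[unfolded represents_def]
  have n0: "regs s 0 = n" and w: "0 < w" using repD ample_words_word[OF ample_words] by auto
  have N: "\<And>u. u < n \<Longrightarrow> N u \<subseteq> {..<n}" using repD by auto
  have finN: "\<And>u. u < n \<Longrightarrow> finite (N u)" using N finite_subset by blast
  have bij: "bij_betw ?e {..<?d} (N v)" using repD v by auto
  have d: "?d = card (N v)" using bij_betw_same_card[OF bij] by simp
  have dn: "?d \<le> n" unfolding d using card_mono[OF _ N[OF v(2)]] by simp
  have tn: "t < n" using t N[OF v(2)] by auto
  have a: "?a < n" "?P \<le> n" "is_level n ?P" using repD v(2) by (auto simp: is_level_def)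
  have jn: "j \<le> n" "0 < j" using j by (auto dest: is_level_bounds)
  have c2: "\<And>u. u < n \<Longrightarrow> arrs s 2 u = card {y. y < n \<and> arrs s 5 y = u}" using repD by auto
  have c7: "\<And>u P. u < n \<Longrightarrow> arrs s 7 (P * n + u) = cover_count n (arrs s 5) (arrs s 6) u P" using repD by auto
  have c8: "\<And>u P. u < n \<Longrightarrow> arrs s 8 (P * n + u) = level_count N (arrs s 6) u P" using repD by auto
  have nw: "n + 1 < 2 ^ w" using ample_words by (rule ample_words_less_square) (simp add: algebra_simps)
  have l2: "arrs s 2 u \<le> n" if "u < n" for u
    unfolding c2[OF that] by (rule order_trans[OF card_mono[of "{..<n}"]]) auto
  have l7: "arrs s 7 (P * n + u) \<le> n" if "u < n" for u P
    unfolding c7[OF that] by (rule cover_count_le)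
  have init: "wp w move_init Q s = Q 66 (move_init_state n v t j ?a ?P s)" for Q
  proof (rule wp_move_init[OF w n0 v(1) t(1) j(1) refl refl])
    show "?P * n + ?a < 2 ^ w" "j * n + t < 2 ^ w" using ample_words_idx[OF ample_words] a jn tn by auto
    show "((arrs s 2)(?a := arrs s 2 ?a - 1)) t + 1 < 2 ^ w"
      using l2[OF tn] l2[OF a(1)] nw by auto
    show "((arrs s 7)(?P * n + ?a := arrs s 7 (?P * n + ?a) - 1)) (j * n + t) + 1 < 2 ^ w"
      using l7[OF tn, of j] l7[OF a(1), of ?P] nw by auto
    show "regs s 5 + 1 < 2 ^ w" using sp by simp
  qed
  define x0 where "x0 = move_init_state n v t j ?a ?P s"
  have inv0: "move_inv n N v t j s 0 x0"
  proof -
    have x5: "arrs x0 5 = (arrs s 5)(v := t)" and x6: "arrs x0 6 = (arrs s 6)(v := j)"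
      by (simp_all add: x0_def move_init_state_def)
    have "arrs x0 2 u = card {y. y < n \<and> arrs x0 5 y = u}" if "u < n" for u
      unfolding x5 card_fibre_upd[OF v(2)] using c2[OF that] c2[OF a(1)]
      by (auto simp: x0_def move_init_state_def)
    moreover have "arrs x0 7 (Q * n + u) = cover_count n (arrs x0 5) (arrs x0 6) u Q" if "u < n" for u Q
      unfolding x5 x6 cover_count_upd[OF v(2)] using c7[OF that] c7[OF a(1)] c7[OF tn]
        idx_inj[OF that a(1)] idx_inj[OF that tn] idx_inj[OF tn a(1)]
      by (auto simp: x0_def move_init_state_def)
    ultimately show ?thesis unfolding move_inv_def x5 x6
      by (auto simp: x0_def move_init_state_def c8)
  qed
  have step: "wp w move_body Q x = Q 51 (move_body_state n (?e i) ?P j i x)"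
    "move_inv n N v t j s (Suc i) (move_body_state n (?e i) ?P j i x)"
    if inv: "move_inv n N v t j s i x" and i: "i < ?d" for x i Q
  proof -
    let ?u = "?e i"
    have u: "?u \<in> N v" using bij i by (auto simp: bij_betw_def)
    have un: "?u < n" using u N[OF v(2)] by auto
    have vu: "v \<in> N ?u" using sym[OF un] u by simp
    \<comment> \<open>The list has no repetitions, so the counts of each neighbour are adjusted only
      once.\<close>
    have unew: "?u \<notin> ?e ` {..<i}"
    proof
      assume "?u \<in> ?e ` {..<i}"
      then obtain k where "k < i" "?e i = ?e k" by auto
      then show False using inj_onD[OF bij_betw_imp_inj_on[OF bij], of i k] i by simp
    qed
    note invD = inv[unfolded move_inv_def]
    have x6: "arrs x 6 = (arrs s 6)(v := j)" using invD by simp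
    have x8: "arrs x 8 (P * n + u) = level_count N (if u \<in> ?e ` {..<i} then arrs x 6 else arrs s 6) u P" if "u < n" for u P
      using invD that by blast
    have x8u: "arrs x 8 (P * n + ?u) = level_count N (arrs s 6) ?u P" for P using x8[OF un] unew by simp
    have le8: "arrs x 8 (P * n + ?u) \<le> n" for P unfolding x8u using level_count_le[of N ?u n] N[OF un] by simp
    show "wp w move_body Q x = Q 51 (move_body_state n ?u ?P j i x)"
    proof (rule wp_move_body[OF w, where v = v])
      show "regs x 0 = n" "regs x 11 = v" "regs x 16 = i" "regs x 15 = ?P" "regs x 13 = j" "arrs x 3 (v * n + i) = ?u"
        using invD n0 v j by auto
      show "v * n + i < 2 ^ w" "?P * n + ?u < 2 ^ w" "j * n + ?u < 2 ^ w"
        using ample_words_idx[OF ample_words] v(2) i dn a un jn by auto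
      show "((arrs x 8)(?P * n + ?u := arrs x 8 (?P * n + ?u) - 1)) (j * n + ?u) + 1 < 2 ^ w"
        using le8[of j] le8[of ?P] nw by auto
      show "i + 1 < 2 ^ w" using i dn nw by linarith
      show "regs x 5 + 1 < 2 ^ w" using invD sp i d by auto
    qed
    let ?x = "move_body_state n ?u ?P j i x"
    have new8: "arrs ?x 8 (Q * n + u) = level_count N (if u \<in> ?e ` {..<Suc i} then arrs x 6 else arrs s 6) u Q"
      if "u < n" for u Q
    proof (cases "u = ?u")
      case True
      have "level_count N (arrs x 6) ?u Q = level_count N (arrs s 6) ?u Q - (if Q = ?P then 1 else 0) + (if Q = j then 1 else 0)"
        unfolding x6 using finN[OF un] vu by (rule level_count_upd[where N = N])
      then show ?thesis using True x8u idx_inj[OF un un]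
        by (auto simp: move_body_state_def)
    next
      case False
      then have "arrs ?x 8 (Q * n + u) = arrs x 8 (Q * n + u)"
        using idx_inj[OF that un] by (auto simp: move_body_state_def)
      moreover have "u \<in> ?e ` {..<Suc i} \<longleftrightarrow> u \<in> ?e ` {..<i}"
        using False by (auto simp: lessThan_Suc)
      ultimately show ?thesis using x8[OF that] by (simp only:)
    qed
    have other: "arrs ?x y = arrs x y" if "y \<notin> {8, 9, 10}" for y
      using that by (simp add: move_body_state_def)
    have regs: "regs ?x = (regs x)(17 := ?u, 5 := regs x 5 + 1, 16 := i + 1)" by (simp add: move_body_state_def)
    have stack: "arrs ?x 9 = (arrs x 9)(regs x 5 := ?u)" "arrs ?x 10 = (arrs x 10)(regs x 5 := j)"
      by (simp_all add: move_body_state_def)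
    show "move_inv n N v t j s (Suc i) ?x"
      unfolding move_inv_def using invD i new8
      by (simp add: other regs stack less_Suc_eq)
  qed
  have final: "represents n N x" if inv: "move_inv n N v t j s ?d x" for x
  proof -
    note invD = inv[unfolded move_inv_def]
    have im: "?e ` {..<?d} = N v" using bij by (simp add: bij_betw_def)
    have x8: "arrs x 8 (P * n + u) = level_count N (arrs x 6) u P" if "u < n" for u P
    proof (cases "u \<in> N v")
      case True then show ?thesis using invD that im by auto
    next
      case False
      then have "v \<notin> N u" using sym[OF that] by simp
      then have "{y \<in> N u. ((arrs s 6)(v := j)) y = P} = {y \<in> N u. arrs s 6 y = P}" by auto
      then have "level_count N ((arrs s 6)(v := j)) u P = level_count N (arrs s 6) u P" by (simp add: level_count_def)
      moreover have "arrs x 6 = (arrs s 6)(v := j)" using invD by simp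
      moreover have "arrs x 8 (P * n + u) = level_count N (arrs s 6) u P" using invD that im False by auto
      ultimately show ?thesis by simp
    qed
    have sp: "regs x 5 = regs s 5 + 1 + ?d" using invD by simp
    have old: "arrs x 9 k = arrs s 9 k \<and> arrs x 10 k = arrs s 10 k" if "k < regs s 5" for k
      using invD that by simp
    have mid: "arrs x 9 (regs s 5) = ?a \<and> arrs x 10 (regs s 5) = ?P" using invD by simp
    have new: "arrs x 9 (regs s 5 + 1 + k) = ?e k \<and> arrs x 10 (regs s 5 + 1 + k) = j" if "k < ?d" for k
      using invD that by simp
    have stack: "arrs x 9 k < n \<and> is_level n (arrs x 10 k)" if k: "k < regs x 5" for k
    proof -
      consider "k < regs s 5" | "k = regs s 5" | "regs s 5 < k" by linarith
      then show ?thesis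
      proof cases
        case 1 then show ?thesis using old repD by simp
      next
        case 2 then show ?thesis using mid a by simp
      next
        case 3
        then have "k = regs s 5 + 1 + (k - regs s 5 - 1)" "k - regs s 5 - 1 < ?d" using k sp by auto
        then have "arrs x 9 k = ?e (k - regs s 5 - 1) \<and> arrs x 10 k = j" using new by metis
        moreover have "?e (k - regs s 5 - 1) \<in> N v" using im \<open>k - regs s 5 - 1 < ?d\<close> by auto
        ultimately show ?thesis using j N[OF v(2)] by auto
      qed
    qed
    \<comment> \<open>The three cases correspond to three segments of the stack: the old entries,
      the abandoned pair on top of them, and the pairs of the visited neighbours.\<close>
    have pend: "\<exists>k<regs x 5. arrs x 9 k = u \<and> arrs x 10 k = P"
      if u: "u < n" "0 < P" and unstable: "unstable n N (arrs x 5) (arrs x 6) u P" for u P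
    proof -
      have "unstable n N ((arrs s 5)(v := t)) ((arrs s 6)(v := j)) u P" using unstable invD by simp
      from unstable_reassign[OF this v(2) t(2) finN[OF u(1)] sym[OF u(1)]]
      consider "unstable n N (arrs s 5) (arrs s 6) u P" | "(u, P) = (?a, ?P)" | "P = j" "u \<in> N v" by auto
      then show ?thesis
      proof cases
        case 1
        then obtain k where "k < regs s 5" "arrs s 9 k = u" "arrs s 10 k = P" using repD u by blast
        then show ?thesis using old[of k] sp by (intro exI[of _ k]) auto
      next
        case 2 then show ?thesis using mid sp by (intro exI[of _ "regs s 5"]) auto
      next
        case 3
        then obtain k where "k < ?d" "u = ?e k" using im by auto
        then show ?thesis using new[of k] sp 3 by (intro exI[of _ "regs s 5 + 1 + k"]) auto
      qed
    qed
    have "\<forall>u<n. arrs x 5 u < n \<and> is_level n (arrs x 6 u)" using invD repD tn j by auto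
    then show ?thesis unfolding represents_def using invD x8 stack pend repD n0 by auto
  qed
  \<comment> \<open>The initialization takes 66 steps; an iteration takes 51 steps for the body and
    5 for the guard.\<close>
  have loop: "wp w (While (Bin Less (Reg 16) (Load 4 (Reg 11))) move_body)
     (\<lambda>t'. (\<lambda>\<tau> x. \<tau> \<le> 80 + 60 * ?d \<and> move_inv n N v t j s ?d x) (66 + t')) x0"
  proof (rule wp_While[where I = "\<lambda>\<tau> x. \<tau> \<le> 66 + 60 * regs x 16 \<and> move_inv n N v t j s (regs x 16) x"
        and m = "\<lambda>x. ?d - regs x 16"])
    show "66 \<le> 66 + 60 * regs x0 16 \<and> move_inv n N v t j s (regs x0 16) x0"
      using inv0 by (simp add: x0_def move_init_state_def)
  next
    fix \<tau> x
    assume I: "\<tau> \<le> 66 + 60 * regs x 16 \<and> move_inv n N v t j s (regs x 16) x"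
      and b: "eval w x (Bin Less (Reg 16) (Load 4 (Reg 11))) \<noteq> 0"
    have "arrs x 4 = arrs s 4" "regs x 11 = v" using I v by (simp_all add: move_inv_def)
    then have i: "regs x 16 < ?d" using b w by (simp add: of_bool_mod)
    note st = step[OF conjunct2[OF I] i]
    have r: "regs (move_body_state n (?e (regs x 16)) ?P j (regs x 16) x) 16 = Suc (regs x 16)"
      by (simp add: move_body_state_def)
    show "wp w move_body (\<lambda>t' s'. (\<tau> + (1 + cost (Bin Less (Reg 16) (Load 4 (Reg 11))) + t') \<le> 66 + 60 * regs s' 16 \<and>
         move_inv n N v t j s (regs s' 16) s') \<and> ?d - regs s' 16 < ?d - regs x 16) x"
      unfolding st(1) r using st(2) I i by simp
  next
    fix \<tau> x
    assume I: "\<tau> \<le> 66 + 60 * regs x 16 \<and> move_inv n N v t j s (regs x 16) x"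
      and b: "eval w x (Bin Less (Reg 16) (Load 4 (Reg 11))) = 0"
    have "arrs x 4 = arrs s 4" "regs x 11 = v" "regs x 16 \<le> ?d" using I v by (simp_all add: move_inv_def)
    then have "regs x 16 = ?d" using b w by (simp add: of_bool_mod)
    then show "\<tau> + (1 + cost (Bin Less (Reg 16) (Load 4 (Reg 11)))) \<le> 80 + 60 * ?d \<and> move_inv n N v t j s ?d x"
      using I by simp
  qed
  show ?thesis
    unfolding move_def wp_Seq init x0_def[symmetric]
  proof (rule wp_mono[OF loop], goal_cases)
    case (1 \<tau> x)
    then have inv: "move_inv n N v t j s ?d x" and time: "66 + \<tau> \<le> 80 + 60 * card (N v)" using d by auto
    show ?case using final[OF inv] inv time d by (simp add: move_inv_def)
  qed
qed

section \<open>Restoring stability\<close>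

text \<open>
  \<open>batch\<close> moves the vertices of \<open>N s\<close> at the level in register 7 to a new level, where \<open>s\<close> is in
  register 12; if register 10 is \<open>0\<close>, only those assigned to \<open>s\<close>. \<open>process\<close> pops a pair only when it
  is stable, so that the stack contains all unstable pairs at any time.
\<close>

definition batch_body :: com where
  "batch_body = block
    [Assign 11 (Load 3 (idx (Reg 12) (Reg 8))),
     Cond (Bin Eq (Load 6 (Reg 11)) (Reg 7))
       (Cond (Bin Add (Reg 10) (Bin Eq (Load 5 (Reg 11)) (Reg 12))) move Skip) Skip,
     Assign 8 (inc (Reg 8))]"

definition batch :: com where
  "batch = Seq (Assign 8 (Const 0)) (While (Bin Less (Reg 8) (Load 4 (Reg 12))) batch_body)"

definition pop :: com where "pop = Assign 5 (Reg 6)"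

definition process_body :: com where
  "process_body = block
    [Assign 6 (dec (Reg 5)),
     Assign 12 (Load 9 (Reg 6)),
     Assign 7 (Load 10 (Reg 6)),
     Cond (Bin Less (Load 8 (idx (Reg 7) (Reg 12))) (Bin Mul (Const 4) (Reg 7)))
       (Cond (Load 7 (idx (Reg 7) (Reg 12)))
         (Cond (Bin Less (Bin Mul (Const 2) (Load 7 (idx (Reg 7) (Reg 12)))) (Reg 7))
           (block [Assign 10 (Const 0), Assign 13 (Bin Div (Reg 7) (Const 2)), batch])
           pop)
         pop)
       (block [Assign 10 (Const 1), Assign 13 (Bin Mul (Const 4) (Reg 7)), batch])]"

definition process :: com where
  "process = While (Reg 5) process_body"

lemma represents_cong: "regs x 0 = regs y 0 \<Longrightarrow> regs x 5 = regs y 5 \<Longrightarrow> arrs x = arrs y \<Longrightarrow> represents n N x \<longleftrightarrow> represents n N y"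
  by (simp add: represents_def)

lemma reassign_insert: "reassign f (insert v Y) a = (reassign f Y a)(v := a)"
  by (auto simp: reassign_def)

lemma wp_batch_body_move:
  assumes "0 < w" "regs x 0 = n" "regs x 12 = c" "c * n + regs x 8 < 2 ^ w"
    "arrs x 3 (c * n + regs x 8) = v" "arrs x 6 v = regs x 7" "regs x 10 = g"
    "(g + of_bool (arrs x 5 v = c)) mod 2 ^ w \<noteq> 0"
    and move: "wp w move (\<lambda>t y. regs y 8 + 1 < 2 ^ w \<and> Q (24 + t) \<lparr>regs = (regs y)(8 := regs y 8 + 1), arrs = arrs y\<rparr>)
      \<lparr>regs = (regs x)(11 := v), arrs = arrs x\<rparr>"
  shows "wp w batch_body Q x"
proof -
  have "wp w move (\<lambda>t. wp w (block [Assign 8 (inc (Reg 8))]) (\<lambda>t'. Q (19 + t + t')))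
      \<lparr>regs = (regs x)(11 := v), arrs = arrs x\<rparr>"
    using move by (rule wp_mono) (auto simp: wp_simps add.commute)
  moreover have "eval w x (idx (Reg 12) (Reg 8)) = c * n + regs x 8" using assms by (simp add: eval_idx)
  ultimately show ?thesis
    using assms(1-8) by (cases "arrs x 5 v = c") (simp_all add: batch_body_def wp_Assign wp_Seq wp_Cond of_bool_mod cost_simps add.assoc)
qed

lemma wp_batch_body_skip:
  assumes "0 < w" "regs x 0 = n" "regs x 12 = c" "c * n + regs x 8 < 2 ^ w"
    "arrs x 3 (c * n + regs x 8) = v" "regs x 10 = g"
    "arrs x 6 v = regs x 7 \<Longrightarrow> g = 0 \<and> arrs x 5 v \<noteq> c"
    "regs x 8 + 1 < 2 ^ w"
    "\<And>t. t \<le> 25 \<Longrightarrow> Q t \<lparr>regs = (regs x)(11 := v, 8 := regs x 8 + 1), arrs = arrs x\<rparr>"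
  shows "wp w batch_body Q x"
  using assms by (cases "arrs x 6 v = regs x 7") (simp_all add: batch_body_def wp_simps)

text \<open>A move changes dominator and level of the moved vertex only and leaves the lists alone.
  Each vertex is therefore tested against its original values when the scan reaches it, so the moved
  vertices are those of \<open>Y\<close>, which is determined by the initial state.\<close>

lemma wp_batch:
  assumes ample_words: "ample_words w n" and represents: "represents n N s" and c: "regs s 12 = c" "c < n"
    and P: "regs s 7 = P" and j: "regs s 13 = j" "is_level n j" and g: "regs s 10 = g" "g \<le> 1"
    and sym: "\<And>u v. u < n \<Longrightarrow> v < n \<Longrightarrow> v \<in> N u \<longleftrightarrow> u \<in> N v"
    and W: "\<And>u. u < n \<Longrightarrow> card (N u) \<le> W"
    and Y: "Y = {v \<in> N c. arrs s 6 v = P \<and> (g = 1 \<or> arrs s 5 v = c)}"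
    and sp: "regs s 5 + card Y * (W + 1) < 2 ^ w"
  shows "wp w batch (\<lambda>\<tau> x. \<tau> \<le> 10 + 40 * W + card Y * (80 + 60 * W) \<and> represents n N x \<and>
    arrs x 0 = arrs s 0 \<and> arrs x 1 = arrs s 1 \<and>
    arrs x 5 = reassign (arrs s 5) Y c \<and> arrs x 6 = reassign (arrs s 6) Y j \<and>
    regs x 5 \<le> regs s 5 + card Y * (W + 1) \<and> (\<forall>r. r \<notin> {5..17} \<longrightarrow> regs x r = regs s r)) s"
    (is "wp w batch ?Q s")
proof -
  note repD = represents[unfolded represents_def]
  let ?d = "arrs s 4 c" and ?e = "\<lambda>i. arrs s 3 (c * n + i)"
  have n0: "regs s 0 = n" and w: "0 < w" using repD ample_words_word[OF ample_words] by auto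
  have N: "\<And>u. u < n \<Longrightarrow> N u \<subseteq> {..<n}" using repD by auto
  have bij: "bij_betw ?e {..<?d} (N c)" using repD c by auto
  have d: "?d = card (N c)" using bij_betw_same_card[OF bij] by simp
  have dn: "?d \<le> n" unfolding d using card_mono[OF _ N[OF c(2)]] by simp
  have nw: "n + 2 < 2 ^ w" using ample_words by (rule ample_words_less_square) (simp add: algebra_simps)
  have finY: "finite Y" unfolding Y using N[OF c(2)] finite_subset by (metis (no_types, lifting) finite_lessThan mem_Collect_eq subsetI subset_trans)
  \<comment> \<open>The vertices moved during the first \<open>i\<close> iterations.\<close>
  define Yi where "Yi i = Y \<inter> ?e ` {..<i}" for i
  define I where "I \<tau> x \<longleftrightarrow> regs x 8 \<le> ?d \<and> \<tau> \<le> 2 + 40 * regs x 8 + card (Yi (regs x 8)) * (80 + 60 * W) \<and> represents n N x \<and>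
    arrs x 0 = arrs s 0 \<and> arrs x 1 = arrs s 1 \<and> arrs x 3 = arrs s 3 \<and> arrs x 4 = arrs s 4 \<and>
    arrs x 5 = reassign (arrs s 5) (Yi (regs x 8)) c \<and> arrs x 6 = reassign (arrs s 6) (Yi (regs x 8)) j \<and>
    regs x 5 \<le> regs s 5 + card (Yi (regs x 8)) * (W + 1) \<and>
    (\<forall>r. r \<notin> {5, 8, 11, 14, 15, 16, 17} \<longrightarrow> regs x r = regs s r)" for \<tau> x
  have finYi: "finite (Yi i)" for i using finY by (simp add: Yi_def)
  define s0 where "s0 = \<lparr>regs = (regs s)(8 := 0), arrs = arrs s\<rparr>"
  have I0: "I 2 s0"
    using represents represents_cong[of s0 s n N] by (simp add: I_def s0_def Yi_def reassign_def)
  have step: "wp w batch_body (\<lambda>t' x'. I (\<tau> + (5 + t')) x' \<and> ?d - regs x' 8 < ?d - regs x 8) x"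
    if I: "I \<tau> x" and i: "regs x 8 < ?d" for \<tau> x
  proof -
    let ?i = "regs x 8"
    let ?v = "?e ?i"
    have v: "?v \<in> N c" using bij i by (auto simp: bij_betw_def)
    have vn: "?v < n" using v N[OF c(2)] by auto
    have vnew: "?v \<notin> ?e ` {..<?i}"
    proof
      assume "?v \<in> ?e ` {..<?i}"
      then obtain k where "k < ?i" "?e ?i = ?e k" by auto
      then show False using inj_onD[OF bij_betw_imp_inj_on[OF bij], of ?i k] i by simp
    qed
    then have vYi: "?v \<notin> Yi ?i" by (simp add: Yi_def)
    define x1 where "x1 = \<lparr>regs = (regs x)(11 := ?v), arrs = arrs x\<rparr>"
    have rx: "regs x 0 = n" "regs x 12 = c" "regs x 7 = P" "regs x 13 = j" "regs x 10 = g"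
      using I n0 c P j g by (auto simp: I_def)
    have ax: "arrs x 3 = arrs s 3" "arrs x 5 ?v = arrs s 5 ?v" "arrs x 6 ?v = arrs s 6 ?v"
      using I vYi by (auto simp: I_def reassign_def)
    have repx1: "represents n N x1" using I represents_cong[of x1 x n N] by (simp add: I_def x1_def)
    have ix: "c * n + ?i < 2 ^ w" using ample_words_idx[OF ample_words, of c ?i] c i dn by simp
    have inci: "?i + 1 < 2 ^ w" using i dn nw by linarith
    have YS: "Yi (Suc ?i) = (if ?v \<in> Y then insert ?v (Yi ?i) else Yi ?i)"
      by (auto simp: Yi_def lessThan_Suc)
    show ?thesis
    proof (cases "?v \<in> Y")
      case True
      have card: "card (Yi (Suc ?i)) = Suc (card (Yi ?i))" using True YS vYi finYi by simp
      have "Yi (Suc ?i) \<subseteq> Y" by (auto simp: Yi_def)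
      then have "card (Yi (Suc ?i)) \<le> card Y" using finY by (rule card_mono[rotated])
      then have cY: "Suc (card (Yi ?i)) * (W + 1) \<le> card Y * (W + 1)" unfolding card by (rule mult_le_mono1)
      have lv: "arrs s 6 ?v = P" and gv: "g = 1 \<or> arrs s 5 ?v = c" using True Y by auto
      \<comment> \<open>The sum of the flag and the equality test acts as a disjunction; it is at
        most 2 and hence does not wrap around to 0.\<close>
      have cond: "(g + of_bool (arrs s 5 ?v = c)) mod 2 ^ w \<noteq> 0"
        using gv g(2) nw by (subst mod_less) auto
      have mv: "wp w move (\<lambda>\<tau> y. \<tau> \<le> 80 + 60 * card (N ?v) \<and> represents n N y \<and>
        arrs y 0 = arrs x1 0 \<and> arrs y 1 = arrs x1 1 \<and> arrs y 3 = arrs x1 3 \<and> arrs y 4 = arrs x1 4 \<and>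
        arrs y 5 = (arrs x1 5)(?v := c) \<and> arrs y 6 = (arrs x1 6)(?v := j) \<and>
        regs y 5 = regs x1 5 + card (N ?v) + 1 \<and> (\<forall>r. r \<notin> {5, 14, 15, 16, 17} \<longrightarrow> regs y r = regs x1 r)) x1"
      proof (rule wp_move[OF ample_words repx1 _ vn _ _ _ j(2)])
        show "regs x1 11 = ?v" "regs x1 12 = c" "regs x1 13 = j" using rx by (simp_all add: x1_def)
        show "c \<in> N ?v" using sym[OF vn c(2)] v by simp
        show "\<And>u. u < n \<Longrightarrow> ?v \<in> N u \<longleftrightarrow> u \<in> N ?v" using sym vn by blast
        have "regs x1 5 \<le> regs s 5 + card (Yi ?i) * (W + 1)" using I by (simp add: I_def x1_def)
        then show "regs x1 5 + card (N ?v) + 1 < 2 ^ w" using sp cY W[OF vn] by simp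
      qed
      have *: "wp w move (\<lambda>t y. regs y 8 + 1 < 2 ^ w \<and> I (\<tau> + (5 + (24 + t))) \<lparr>regs = (regs y)(8 := regs y 8 + 1), arrs = arrs y\<rparr> \<and>
        ?d - (regs y 8 + 1) < ?d - ?i) x1"
      proof (rule wp_mono[OF mv], elim conjE)
        fix t y
        assume y: "t \<le> 80 + 60 * card (N ?v)" "represents n N y"
        "arrs y 0 = arrs x1 0" "arrs y 1 = arrs x1 1" "arrs y 3 = arrs x1 3" "arrs y 4 = arrs x1 4"
        "arrs y 5 = (arrs x1 5)(?v := c)" "arrs y 6 = (arrs x1 6)(?v := j)"
        "regs y 5 = regs x1 5 + card (N ?v) + 1" "\<forall>r. r \<notin> {5, 14, 15, 16, 17} \<longrightarrow> regs y r = regs x1 r"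
        have y8: "regs y 8 = ?i" using y(10) by (simp add: x1_def)
        let ?y = "\<lparr>regs = (regs y)(8 := Suc ?i), arrs = arrs y\<rparr>"
        have "represents n N ?y" using y(2) represents_cong[of ?y y n N] by simp
        moreover have "t \<le> 80 + 60 * W" using y(1) W[OF vn] by simp
        moreover have "regs y 5 \<le> regs s 5 + Suc (card (Yi ?i)) * (W + 1)"
          using y(9) I W[OF vn] by (simp add: I_def x1_def)
        moreover have "arrs ?y 5 = reassign (arrs s 5) (Yi (Suc ?i)) c" "arrs ?y 6 = reassign (arrs s 6) (Yi (Suc ?i)) j"
          using y(7,8) I True YS by (simp_all add: I_def x1_def reassign_insert)
        ultimately have "I (\<tau> + (5 + (24 + t))) ?y"
          using I i y(3-6,10) unfolding I_def by (simp add: card x1_def)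
        then show "regs y 8 + 1 < 2 ^ w \<and> I (\<tau> + (5 + (24 + t))) \<lparr>regs = (regs y)(8 := regs y 8 + 1), arrs = arrs y\<rparr> \<and>
          ?d - (regs y 8 + 1) < ?d - ?i" using y8 i inci by simp
      qed
      show ?thesis
        by (rule wp_batch_body_move[OF w rx(1,2) ix _ _ rx(5)])
          (use ax rx lv cond * in \<open>simp_all add: x1_def\<close>)
    next
      case False
      have cond: "arrs s 6 ?v = P \<Longrightarrow> g = 0 \<and> arrs s 5 ?v \<noteq> c" using False v Y g(2) by auto
      show ?thesis
      proof (rule wp_batch_body_skip[OF w rx(1,2) ix _ rx(5) _ inci])
        show "arrs x 3 (c * n + ?i) = ?v" using ax by simp
        show "arrs x 6 ?v = regs x 7 \<Longrightarrow> g = 0 \<and> arrs x 5 ?v \<noteq> c" using cond ax rx by simp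
        fix t :: nat assume t: "t \<le> 25"
        let ?y = "\<lparr>regs = (regs x)(11 := ?v, 8 := ?i + 1), arrs = arrs x\<rparr>"
        have "represents n N ?y" using I represents_cong[of ?y x n N] by (simp add: I_def)
        then show "I (\<tau> + (5 + t)) ?y \<and> ?d - regs ?y 8 < ?d - ?i"
          using I i t YS False unfolding I_def by simp
      qed
    qed
  qed
  have YD: "Yi ?d = Y" using bij Y by (auto simp: Yi_def bij_betw_def)
  \<comment> \<open>The last, failing test of the guard costs 5 steps, which the invariant does not
    count.\<close>
  have "wp w (While (Bin Less (Reg 8) (Load 4 (Reg 12))) batch_body) (\<lambda>t'. (\<lambda>\<tau> x. I (\<tau> - 5) x \<and> 5 \<le> \<tau> \<and> regs x 8 = ?d) (2 + t')) s0"
  proof (rule wp_While[where I = I and m = "\<lambda>x. ?d - regs x 8", OF I0])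
    fix \<tau> x
    assume I: "I \<tau> x" and b: "eval w x (Bin Less (Reg 8) (Load 4 (Reg 12))) \<noteq> 0"
    have "arrs x 4 = arrs s 4" "regs x 12 = c" using I c by (simp_all add: I_def)
    then have i: "regs x 8 < ?d" using b w by (simp add: of_bool_mod)
    have "1 + cost (Bin Less (Reg 8) (Load 4 (Reg 12))) = 5" by simp
    then show "wp w batch_body (\<lambda>t' s'. I (\<tau> + (1 + cost (Bin Less (Reg 8) (Load 4 (Reg 12))) + t')) s' \<and>
       ?d - regs s' 8 < ?d - regs x 8) x"
      using step[OF I i] by (simp only:)
  next
    fix \<tau> x
    assume I: "I \<tau> x" and b: "eval w x (Bin Less (Reg 8) (Load 4 (Reg 12))) = 0"
    have "arrs x 4 = arrs s 4" "regs x 12 = c" "regs x 8 \<le> ?d" using I c by (simp_all add: I_def)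
    then have "regs x 8 = ?d" using b w by (simp add: of_bool_mod)
    then show "I (\<tau> + (1 + cost (Bin Less (Reg 8) (Load 4 (Reg 12)))) - 5) x \<and>
      5 \<le> \<tau> + (1 + cost (Bin Less (Reg 8) (Load 4 (Reg 12)))) \<and> regs x 8 = ?d" using I by simp
  qed
  then have loop: "wp w (While (Bin Less (Reg 8) (Load 4 (Reg 12))) batch_body)
     (\<lambda>t' x. I (2 + t' - 5) x \<and> regs x 8 = ?d) s0" by (rule wp_mono) simp
  have dW: "?d \<le> W" using d W[OF c(2)] by simp
  have "wp w (While (Bin Less (Reg 8) (Load 4 (Reg 12))) batch_body) (\<lambda>t'. ?Q (2 + t')) s0"
  proof (rule wp_mono[OF loop], elim conjE)
    fix t x assume I: "I (2 + t - 5) x" and x8: "regs x 8 = ?d"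
    have "2 + t - 5 \<le> 2 + 40 * ?d + card Y * (80 + 60 * W)" using I unfolding I_def x8 YD by blast
    then have "2 + t \<le> 10 + 40 * W + card Y * (80 + 60 * W)" using dW by linarith
    then show "?Q (2 + t) x" using I unfolding I_def x8 YD by auto
  qed
  then show ?thesis unfolding batch_def wp_Seq wp_Assign by (simp add: s0_def)
qed

text \<open>A batch of \<open>card Y\<close> moves releases at least \<open>card Y\<close> units of
  potential and pushes at most \<open>W + 1 \<le> 2 * W\<close> pairs per move, hence the weight
  \<open>2 * W\<close> in the stack bound. In the time bound, \<open>500 * W\<close> per unit pays
  for a move, for its share of the scan, and for 100 steps of later inspection of each pushed pair.
  A pop is paid for by the pair it removes. The summand 2 is the loop test of
  \<open>process\<close>.\<close>

lemma wp_process_body: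
  fixes n N W s
  defines "\<Phi> \<equiv> \<lambda>x. pot n (arrs x 5) (arrs x 6)"
  assumes ample_words: "ample_words w n" and represents: "represents n N s"
    and dom: "\<And>v. v < n \<Longrightarrow> arrs s 5 v \<in> N v"
    and sym: "\<And>u v. u < n \<Longrightarrow> v < n \<Longrightarrow> v \<in> N u \<longleftrightarrow> u \<in> N v"
    and W: "\<And>u. u < n \<Longrightarrow> card (N u) \<le> W" "0 < W"
    and ne: "0 < regs s 5" and sp: "regs s 5 + 2 * W * \<Phi> s < 2 ^ w"
  shows "wp w process_body (\<lambda>\<tau> x. represents n N x \<and> (\<forall>v<n. arrs x 5 v \<in> N v) \<and>
    arrs x 0 = arrs s 0 \<and> arrs x 1 = arrs s 1 \<and> (\<forall>r. r \<notin> {5..17} \<longrightarrow> regs x r = regs s r) \<and>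
    regs x 5 + 2 * W * \<Phi> x \<le> regs s 5 + 2 * W * \<Phi> s \<and>
    2 + \<tau> + 500 * W * \<Phi> x + 100 * regs x 5 \<le> 500 * W * \<Phi> s + 100 * regs s 5) s"
    (is "wp w process_body ?Q s")
proof -
  note repD = represents[unfolded represents_def]
  let ?k = "regs s 5 - 1"
  define c where "c = arrs s 9 ?k"
  define P where "P = arrs s 10 ?k"
  have cP: "arrs s 9 (regs s 5 - Suc 0) = c" "arrs s 10 (regs s 5 - Suc 0) = P" by (simp_all add: c_def P_def)
  have n0: "regs s 0 = n" and w: "0 < w" using repD ample_words_word[OF ample_words] by auto
  have n: "0 < n" using ample_words by (simp add: ample_words_def)
  have N: "\<And>u. u < n \<Longrightarrow> N u \<subseteq> {..<n}" using repD by auto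
  have c: "c < n" and P: "is_level n P" using repD ne unfolding c_def P_def by auto
  have Pn: "0 < P" "P \<le> n" using is_level_bounds[OF P] by auto
  have nw: "4 * n + 4 < 2 ^ w" using ample_words by (rule ample_words_less_square) (simp add: algebra_simps)
  have a7: "arrs s 7 (P * n + c) = cover_count n (arrs s 5) (arrs s 6) c P" and
    a8: "arrs s 8 (P * n + c) = level_count N (arrs s 6) c P" using repD c by auto
  have ix: "P * n + c < 2 ^ w" using ample_words_idx[OF ample_words] Pn c by simp
  have c4: "4 mod 2 ^ w = (4::nat)" "2 mod 2 ^ w = (2::nat)" "4 * P mod 2 ^ w = 4 * P" using nw Pn by auto
  have l7: "2 * arrs s 7 (P * n + c) < 2 ^ w" unfolding a7 using cover_count_le[of n "arrs s 5" "arrs s 6" c P] nw by linarith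
  then have l7': "2 * arrs s 7 (P * n + c) mod 2 ^ w = 2 * arrs s 7 (P * n + c)" by simp
  have batch: "wp w batch (\<lambda>\<tau>. ?Q (60 + \<tau>)) y"
    if y: "arrs y = arrs s" "\<And>r. r \<notin> {6..17} \<Longrightarrow> regs y r = regs s r"
      "regs y 12 = c" "regs y 7 = P" "regs y 13 = j" "is_level n j" "regs y 10 = g" "g \<le> 1"
     and Y: "Y = {v \<in> N c. arrs s 6 v = P \<and> (g = 1 \<or> arrs s 5 v = c)}" "0 < card Y"
     and pot: "pot n (reassign (arrs s 5) Y c) (reassign (arrs s 6) Y j) + card Y \<le> \<Phi> s"
    for y j g Y
  proof -
    have y05: "regs y 0 = regs s 0" "regs y 5 = regs s 5" using y(2) by auto
    have repy: "represents n N y" using represents represents_cong[of y s n N] y(1) y05 by simp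
    have cW: "card Y * (W + 1) \<le> 2 * W * card Y" using W(2) by (cases W) auto
    have "2 * W * card Y \<le> 2 * W * \<Phi> s" using pot by (intro mult_le_mono) auto
    then have "regs y 5 + card Y * (W + 1) < 2 ^ w" using cW sp y05 by linarith
    moreover have "Y = {v \<in> N c. arrs y 6 v = P \<and> (g = 1 \<or> arrs y 5 v = c)}" using Y y(1) by simp
    ultimately have "wp w batch (\<lambda>\<tau> x. \<tau> \<le> 10 + 40 * W + card Y * (80 + 60 * W) \<and> represents n N x \<and>
      arrs x 0 = arrs y 0 \<and> arrs x 1 = arrs y 1 \<and>
      arrs x 5 = reassign (arrs y 5) Y c \<and> arrs x 6 = reassign (arrs y 6) Y j \<and>
      regs x 5 \<le> regs y 5 + card Y * (W + 1) \<and> (\<forall>r. r \<notin> {5..17} \<longrightarrow> regs x r = regs y r)) y"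
      using wp_batch[OF ample_words repy y(3) c y(4-8) sym W(1)] by blast
    then show ?thesis
    proof (rule wp_mono, elim conjE)
      fix \<tau> x assume x: "\<tau> \<le> 10 + 40 * W + card Y * (80 + 60 * W)" "represents n N x"
        "arrs x 0 = arrs y 0" "arrs x 1 = arrs y 1"
        "arrs x 5 = reassign (arrs y 5) Y c" "arrs x 6 = reassign (arrs y 6) Y j"
        "regs x 5 \<le> regs y 5 + card Y * (W + 1)" "\<forall>r. r \<notin> {5..17} \<longrightarrow> regs x r = regs y r"
      have "arrs x 5 v \<in> N v" if "v < n" for v
        using dom[OF that] sym[OF that c] Y(1) x(5) y(1) by (auto simp: reassign_def)
      moreover have regs: "regs x r = regs s r" if "r \<notin> {5..17}" for r
        using that x(8) y(2)[of r] by auto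
      moreover have pot': "\<Phi> x + card Y \<le> \<Phi> s" using pot x(5,6) y(1) by (simp add: \<Phi>_def)
      have "W * (\<Phi> x + card Y) \<le> W * \<Phi> s" using pot' by (rule mult_le_mono2)
      then have pW: "W * \<Phi> x + W * card Y \<le> W * \<Phi> s" by (simp add: algebra_simps)
      \<comment> \<open>As the batch is nonempty, constant costs and the scan of the neighbourhood
        are absorbed by multiples of \<open>card Y * W\<close>.\<close>
      have one: "1 \<le> card Y * W" "W \<le> card Y * W" "card Y \<le> card Y * W" using Y(2) W(2) by (auto simp: Suc_le_eq)
      have spx: "regs x 5 \<le> regs s 5 + 2 * (W * card Y)" using x(7) cW y05 by linarith
      have tx: "\<tau> \<le> 10 + 180 * (W * card Y)"
      proof -
        have "card Y * (80 + 60 * W) = 80 * card Y + 60 * (W * card Y)" by (simp add: algebra_simps)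
        then show ?thesis using x(1) one mult.commute[of W "card Y"] by linarith
      qed
      have "2 + (60 + \<tau>) + 500 * (W * \<Phi> x) + 100 * regs x 5 \<le> 500 * (W * \<Phi> s) + 100 * regs s 5"
        using pW one(1) spx tx mult.commute[of W "card Y"] by linarith
      moreover have "regs x 5 + 2 * (W * \<Phi> x) \<le> regs s 5 + 2 * (W * \<Phi> s)"
        using spx pW by linarith
      ultimately show "?Q (60 + \<tau>) x" using x(2-4) y(1) by (simp add: mult.assoc)
    qed
  qed
  define y where "y g j = \<lparr>regs = (regs s)(6 := ?k, 12 := c, 7 := P, 10 := g, 13 := j), arrs = arrs s\<rparr>" for g j
  \<comment> \<open>Only the top entry disappears, and its pair is stable, so every unstable pair
    keeps an entry on the stack.\<close>
  have represents_pop: "represents n N \<lparr>regs = (regs s)(6 := ?k, 12 := c, 7 := P, 5 := ?k), arrs = arrs s\<rparr>"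
    if "\<not> unstable n N (arrs s 5) (arrs s 6) c P"
  proof -
    have pend: "\<exists>k<?k. arrs s 9 k = u \<and> arrs s 10 k = Q"
      if u: "u < n" "0 < Q" "unstable n N (arrs s 5) (arrs s 6) u Q" for u Q
    proof -
      obtain k where k: "k < regs s 5" "arrs s 9 k = u" "arrs s 10 k = Q" using repD u by blast
      moreover have "k \<noteq> ?k" using k u(3) \<open>\<not> unstable n N _ _ c P\<close> unfolding c_def P_def by auto
      ultimately show ?thesis by (intro exI[of _ k]) auto
    qed
    show ?thesis unfolding represents_def using repD pend by simp
  qed
  show ?thesis
  proof (cases "4 * P \<le> level_count N (arrs s 6) c P")
    case True
    define Y where "Y = {v \<in> N c. arrs s 6 v = P \<and> ((1::nat) = 1 \<or> arrs s 5 v = c)}"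
    have "card Y = level_count N (arrs s 6) c P" by (simp add: Y_def level_count_def)
    then have big: "4 * P \<le> card Y" using True by simp
    have Yn: "Y \<subseteq> {..<n}" using N[OF c] by (auto simp: Y_def)
    have Yl: "arrs s 6 x = P" "arrs s 5 x < n" if "x \<in> Y" for x
      using that Yn repD by (auto simp: Y_def)
    note pot1 = pot_raise[OF n Yn Yl P big, folded \<Phi>_def]
    have "wp w batch (\<lambda>\<tau>. ?Q (60 + \<tau>)) (y 1 (4 * P))"
      by (rule batch[OF _ _ _ _ _ pot1(1) _ _ Y_def]) (use big Pn pot1(2) in \<open>auto simp: y_def \<Phi>_def\<close>)
    then show ?thesis
      using True w n0 ix c4 l7 a8
      by (simp add: process_body_def wp_simps y_def cP, elim wp_mono) (simp add: wp_simps)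
  next
    case False
    let ?c = "cover_count n (arrs s 5) (arrs s 6) c P"
    show ?thesis
    proof (cases "0 < ?c \<and> 2 * ?c < P")
      case True
      define Y where "Y = {v \<in> N c. arrs s 6 v = P \<and> ((0::nat) = 1 \<or> arrs s 5 v = c)}"
      \<comment> \<open>Every vertex assigned to \<open>c\<close> lies in \<open>N c\<close> by
        domination and symmetry, so scanning \<open>N c\<close> finds everything that the pair
        covers.\<close>
      have Y: "Y = {x. x < n \<and> arrs s 5 x = c \<and> arrs s 6 x = P}"
        unfolding Y_def using N[OF c] dom sym[OF c] by auto
      then have cY: "card Y = ?c" by (simp add: cover_count_def)
      note pot1 = pot_lower[OF n Y c P, unfolded cY, OF conjunct1[OF True] conjunct2[OF True]]
      have "wp w batch (\<lambda>\<tau>. ?Q (60 + \<tau>)) (y 0 (P div 2))"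
        by (rule batch[OF _ _ _ _ _ pot1(1) _ _ Y_def]) (use True pot1(2) cY in \<open>auto simp: y_def \<Phi>_def\<close>)
      then show ?thesis
        using True False w n0 ix c4 l7' a8 a7
        by (simp add: process_body_def wp_simps y_def cP, elim wp_mono) (simp add: wp_simps)
    next
      case notlow: False
      then have closed_nbhd: "\<not> unstable n N (arrs s 5) (arrs s 6) c P" using False by (simp add: unstable_def)
      show ?thesis
        using False notlow w n0 ix c4 l7' a8 a7 represents_pop[OF closed_nbhd] dom ne
        by (cases "0 < ?c") (auto simp: process_body_def pop_def wp_simps cP \<Phi>_def)
    qed
  qed
qed

text \<open>The sum of \<open>500 * W * \<Phi>\<close> and 100 times the stack height pays for the
  running time and is also the termination measure. That \<open>2 * W * \<Phi>\<close> plus the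
  stack height never increases keeps the stack pointer within a word.\<close>

lemma wp_process:
  fixes n N W s
  defines "\<Phi> \<equiv> \<lambda>x. pot n (arrs x 5) (arrs x 6)"
  assumes ample_words: "ample_words w n" and represents: "represents n N s"
    and dom: "\<And>v. v < n \<Longrightarrow> arrs s 5 v \<in> N v"
    and sym: "\<And>u v. u < n \<Longrightarrow> v < n \<Longrightarrow> v \<in> N u \<longleftrightarrow> u \<in> N v"
    and W: "\<And>u. u < n \<Longrightarrow> card (N u) \<le> W" "0 < W"
    and sp: "regs s 5 + 2 * W * \<Phi> s < 2 ^ w"
  shows "wp w process (\<lambda>\<tau> x. represents n N x \<and> (\<forall>v<n. arrs x 5 v \<in> N v) \<and> regs x 5 = 0 \<and>
    arrs x 0 = arrs s 0 \<and> arrs x 1 = arrs s 1 \<and> (\<forall>r. r \<notin> {5..17} \<longrightarrow> regs x r = regs s r) \<and>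
    \<tau> + 500 * W * \<Phi> x \<le> 500 * W * \<Phi> s + 100 * regs s 5 + 2) s"
proof -
  define I where "I \<tau> x \<longleftrightarrow> represents n N x \<and> (\<forall>v<n. arrs x 5 v \<in> N v) \<and>
    arrs x 0 = arrs s 0 \<and> arrs x 1 = arrs s 1 \<and> (\<forall>r. r \<notin> {5..17} \<longrightarrow> regs x r = regs s r) \<and>
    regs x 5 + 2 * W * \<Phi> x \<le> regs s 5 + 2 * W * \<Phi> s \<and>
    \<tau> + 500 * W * \<Phi> x + 100 * regs x 5 \<le> 500 * W * \<Phi> s + 100 * regs s 5" for \<tau> x
  have "wp w process (\<lambda>t'. (\<lambda>\<tau> x. I (\<tau> - 2) x \<and> regs x 5 = 0) (0 + t')) s"
    unfolding process_def
  proof (rule wp_While[where I = I and m = "\<lambda>x. 500 * W * \<Phi> x + 100 * regs x 5"])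
    show "I 0 s" using represents dom by (simp add: I_def)
  next
    fix \<tau> x assume I: "I \<tau> x" and "eval w x (Reg 5) \<noteq> 0"
    then have ne: "0 < regs x 5" by simp
    have repx: "represents n N x" and domx: "\<And>v. v < n \<Longrightarrow> arrs x 5 v \<in> N v" and spx: "regs x 5 + 2 * W * \<Phi> x < 2 ^ w"
      using I sp by (auto simp: I_def)
    show "wp w process_body (\<lambda>t' s'. I (\<tau> + (1 + cost (Reg 5) + t')) s' \<and>
      500 * W * \<Phi> s' + 100 * regs s' 5 < 500 * W * \<Phi> x + 100 * regs x 5) x"
      by (rule wp_mono[OF wp_process_body[OF ample_words repx domx sym W ne spx[unfolded \<Phi>_def], folded \<Phi>_def]])
        (use I in \<open>simp_all add: I_def \<Phi>_def\<close>)
  next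
    fix \<tau> x assume "I \<tau> x" "eval w x (Reg 5) = 0"
    then show "I (\<tau> + (1 + cost (Reg 5)) - 2) x \<and> regs x 5 = 0" by simp
  qed
  then show ?thesis by (rule wp_mono) (auto simp: I_def)
qed

section \<open>Edge updates\<close>

definition link :: "nat \<Rightarrow> nat \<Rightarrow> com" where
  "link a b = block
    [Store 3 (idx (Reg a) (Load 4 (Reg a))) (Reg b),
     incr 4 (Reg a),
     incr 8 (idx (Load 6 (Reg b)) (Reg a)),
     push (Reg a) (Load 6 (Reg b))]"

text \<open>The comparison with 0 negates the inner test. The scan has no bounds check and relies on
  the entry being present.\<close>

definition find_loop :: "nat \<Rightarrow> nat \<Rightarrow> com" where
  "find_loop a b = While (Bin Eq (Bin Eq (Load 3 (idx (Reg a) (Reg 6))) (Reg b)) (Const 0)) (Assign 6 (inc (Reg 6)))"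

text \<open>The size is decremented first, so that it becomes the index of the last entry, which
  then replaces the removed one. Nothing is pushed: level counts only decrease and cover counts stay
  the same.\<close>

definition remove_found :: "nat \<Rightarrow> nat \<Rightarrow> com" where
  "remove_found a b = block
    [decr 4 (Reg a),
     Store 3 (idx (Reg a) (Reg 6)) (Load 3 (idx (Reg a) (Load 4 (Reg a)))),
     decr 8 (idx (Load 6 (Reg b)) (Reg a))]"

definition unlink :: "nat \<Rightarrow> nat \<Rightarrow> com" where
  "unlink a b = Seq (Assign 6 (Const 0)) (Seq (find_loop a b) (remove_found a b))"

text \<open>Intended for the time after the edge has been removed, when an endpoint dominated by the
  other endpoint has to become its own dominator.\<close>

definition reset :: "nat \<Rightarrow> nat \<Rightarrow> com" where
  "reset a b = Cond (Bin Eq (Load 5 (Reg a)) (Reg b))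
    (block [Assign 11 (Reg a), Assign 12 (Reg a), Assign 13 (Const 1), move]) Skip"

lemma level_count_insert:
  assumes "finite (N u)" "v \<notin> N u"
  shows "level_count (N(u := insert v (N u))) l x Q = level_count N l x Q + (if x = u \<and> Q = l v then 1 else 0)"
proof (cases "x = u \<and> Q = l v")
  case True
  then have "{y \<in> insert v (N u). l y = Q} = insert v {y \<in> N u. l y = Q}" by auto
  then show ?thesis using assms True by (simp add: level_count_def)
next
  case False
  then have "{y \<in> (N(u := insert v (N u))) x. l y = Q} = {y \<in> N x. l y = Q}" by auto
  then show ?thesis using False by (auto simp: level_count_def)
qed

lemma level_count_remove:
  assumes "finite (N u)" "v \<in> N u"
  shows "level_count (N(u := N u - {v})) l x Q = level_count N l x Q - (if x = u \<and> Q = l v then 1 else 0)"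
proof (cases "x = u \<and> Q = l v")
  case True
  then have "{y \<in> N u - {v}. l y = Q} = {y \<in> N u. l y = Q} - {v}" by auto
  then show ?thesis using assms True by (simp add: level_count_def card_Diff_singleton)
next
  case False
  then have "{y \<in> (N(u := N u - {v})) x. l y = Q} = {y \<in> N x. l y = Q}" by auto
  then show ?thesis using False by (auto simp: level_count_def)
qed

text \<open>The last entry fills the gap at \<open>k\<close>. If \<open>k\<close> is itself the last
  position, the overwritten entry simply falls outside the shortened range.\<close>

lemma bij_betw_swap_remove:
  fixes f :: "nat \<Rightarrow> 'a"
  assumes "bij_betw f {..<d} A" "k < d"
  shows "bij_betw (f(k := f (d - 1))) {..<d - 1} (A - {f k})"
proof -
  obtain m where d: "d = Suc m" using assms(2) by (cases d) auto
  have inj: "inj_on f {..<Suc m}" and im: "f ` {..<Suc m} = A" using assms(1) d by (auto simp: bij_betw_def)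
  have inj': "f i = f j \<longleftrightarrow> i = j" if "i < Suc m" "j < Suc m" for i j
    using inj_on_eq_iff[OF inj] that by simp
  have k: "k < Suc m" using assms(2) d by simp
  have "inj_on (f(k := f m)) {..<m}"
    using inj' by (auto simp: inj_on_def)
  moreover have "(f(k := f m)) ` {..<m} = A - {f k}"
  proof
    show "(f(k := f m)) ` {..<m} \<subseteq> A - {f k}" using inj' k unfolding im[symmetric] by auto
    show "A - {f k} \<subseteq> (f(k := f m)) ` {..<m}"
    proof
      fix a assume "a \<in> A - {f k}"
      then obtain i where i: "i < Suc m" "a = f i" "i \<noteq> k" using im by auto
      show "a \<in> (f(k := f m)) ` {..<m}"
      proof (cases "i = m")
        case True
        then have "k < m" using i k by simp
        then show ?thesis using i True by (intro image_eqI[of _ _ k]) auto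
      next
        case False
        then show ?thesis using i by (intro image_eqI[of _ _ i]) auto
      qed
    qed
  qed
  ultimately show ?thesis by (simp add: bij_betw_def d)
qed

lemma represents_degree:
  assumes "represents n N s" "u < n"
  shows "arrs s 4 u = card (N u)" "arrs s 4 u \<le> n" "finite (N u)"
proof -
  have N: "N u \<subseteq> {..<n}" and bij: "bij_betw (\<lambda>i. arrs s 3 (u * n + i)) {..<arrs s 4 u} (N u)"
    using assms by (auto simp: represents_def)
  show d: "arrs s 4 u = card (N u)" using bij_betw_same_card[OF bij] by simp
  show "arrs s 4 u \<le> n" unfolding d using card_mono[OF _ N] by simp
  show "finite (N u)" using N finite_subset by blast
qed

text \<open>The only count that grows is that of \<open>u\<close> at the level of \<open>v\<close>,
  and this is the pair that gets pushed.\<close>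

lemma wp_link:
  assumes ample_words: "ample_words w n" and represents: "represents n N s" and uv: "regs s a = u" "regs s b = v" "u < n" "v < n" "v \<notin> N u"
    and sp: "regs s 5 + 1 < 2 ^ w"
  shows "wp w (link a b) (\<lambda>\<tau> x. \<tau> \<le> 60 \<and> represents n (N(u := insert v (N u))) x \<and>
    arrs x 0 = arrs s 0 \<and> arrs x 1 = arrs s 1 \<and> arrs x 5 = arrs s 5 \<and> arrs x 6 = arrs s 6 \<and>
    regs x 5 = regs s 5 + 1 \<and> (\<forall>r. r \<noteq> 5 \<longrightarrow> regs x r = regs s r)) s"
proof -
  note repD = represents[unfolded represents_def]
  have n0: "regs s 0 = n" and w: "0 < w" using repD ample_words_word[OF ample_words] by auto
  have nw: "n + 2 < 2 ^ w" using ample_words by (rule ample_words_less_square) (simp add: algebra_simps)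
  have N: "\<And>u. u < n \<Longrightarrow> N u \<subseteq> {..<n}" using repD by auto
  let ?d = "arrs s 4 u" and ?l = "arrs s 6 v"
  note deg = represents_degree[OF represents]
  \<comment> \<open>Since \<open>v\<close> is missing from \<open>N u\<close>, the row of
    \<open>u\<close> has a free cell and appending does not run into the next row.\<close>
  have "card (N u) < card {..<n}" using N[OF uv(3)] uv by (intro psubset_card_mono) auto
  then have dn: "?d < n" using deg(1)[OF uv(3)] by simp
  have l: "is_level n ?l" "?l \<le> n" using repD uv by (auto simp: is_level_def)
  have ix: "u * n + ?d < 2 ^ w" "?l * n + u < 2 ^ w" using ample_words_idx[OF ample_words] uv dn l by auto
  have a8: "arrs s 8 (Q * n + x) = level_count N (arrs s 6) x Q" if "x < n" for x Q using repD that by auto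
  have "arrs s 8 (?l * n + u) \<le> n" unfolding a8[OF uv(3)] using level_count_le N[OF uv(3)] by blast
  then have b8: "arrs s 8 (?l * n + u) + 1 < 2 ^ w" using nw by linarith
  let ?x = "\<lparr>regs = (regs s)(5 := regs s 5 + 1),
     arrs = (arrs s)(3 := (arrs s 3)(u * n + ?d := v), 4 := (arrs s 4)(u := ?d + 1),
       8 := (arrs s 8)(?l * n + u := arrs s 8 (?l * n + u) + 1),
       9 := (arrs s 9)(regs s 5 := u), 10 := (arrs s 10)(regs s 5 := ?l))\<rparr>"
  let ?N = "N(u := insert v (N u))"
  have "represents n ?N ?x"
  proof -
    have bij: "bij_betw (\<lambda>i. arrs ?x 3 (y * n + i)) {..<arrs ?x 4 y} (?N y)" if y: "y < n" for y
    proof (cases "y = u")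
      case True
      have b: "bij_betw (\<lambda>i. arrs s 3 (u * n + i)) {..<?d} (N u)" using repD uv by auto
      let ?f = "\<lambda>i. arrs ?x 3 (u * n + i)"
      have "bij_betw ?f {..<?d} (N u) = bij_betw (\<lambda>i. arrs s 3 (u * n + i)) {..<?d} (N u)"
        by (rule bij_betw_cong) auto
      then have "bij_betw ?f ({..<?d} \<union> {?d}) (N u \<union> {?f ?d})"
        using b uv by (intro notIn_Un_bij_betw) auto
      then show ?thesis using True by (simp add: lessThan_Suc Un_commute)
    next
      case False
      have b: "bij_betw (\<lambda>i. arrs s 3 (y * n + i)) {..<arrs s 4 y} (N y)" using repD y by auto
      have "bij_betw (\<lambda>i. arrs ?x 3 (y * n + i)) {..<arrs s 4 y} (N y) = bij_betw (\<lambda>i. arrs s 3 (y * n + i)) {..<arrs s 4 y} (N y)"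
      proof (rule bij_betw_cong)
        fix i assume "i \<in> {..<arrs s 4 y}"
        then have "i < n" using deg(2)[OF y] by auto
        then show "arrs ?x 3 (y * n + i) = arrs s 3 (y * n + i)" using idx_inj[of i n ?d y u] dn False by auto
      qed
      then show ?thesis using b False by simp
    qed
    have c8: "arrs ?x 8 (Q * n + y) = level_count ?N (arrs s 6) y Q" if "y < n" for y Q
      using a8[OF that] a8[OF uv(3)] idx_inj[OF that uv(3), of Q ?l] level_count_insert[where N = N and u = u and v = v, OF deg(3)[OF uv(3)] uv(5)]
      by auto
    have pend: "\<exists>k<regs ?x 5. arrs ?x 9 k = y \<and> arrs ?x 10 k = Q"
      if y: "y < n" "0 < Q" "unstable n ?N (arrs s 5) (arrs s 6) y Q" for y Q
    proof (cases "(y, Q) = (u, ?l)")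
      case True then show ?thesis by (intro exI[of _ "regs s 5"]) auto
    next
      case False
      then have "unstable n N (arrs s 5) (arrs s 6) y Q"
        using y(3) level_count_insert[where N = N and u = u and v = v, OF deg(3)[OF uv(3)] uv(5)] by (auto simp: unstable_def)
      then obtain k where "k < regs s 5" "arrs s 9 k = y" "arrs s 10 k = Q" using repD y by blast
      then show ?thesis by (intro exI[of _ k]) auto
    qed
    show ?thesis unfolding represents_def using repD bij c8 pend uv(3,4) l(1) by (auto simp: less_Suc_eq)
  qed
  then show ?thesis
    using uv n0 w ix b8 sp dn nw by (simp add: link_def wp_simps)
qed

lemma wp_remove_found:
  assumes ample_words: "ample_words w n" and represents: "represents n N s" and uv: "regs s a = u" "regs s b = v" "u < n" "v < n"
    and k: "regs s 6 < arrs s 4 u" "arrs s 3 (u * n + regs s 6) = v"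
  shows "wp w (remove_found a b) (\<lambda>\<tau> x. \<tau> \<le> 60 \<and> represents n (N(u := N u - {v})) x \<and>
    arrs x 0 = arrs s 0 \<and> arrs x 1 = arrs s 1 \<and> arrs x 5 = arrs s 5 \<and> arrs x 6 = arrs s 6 \<and>
    regs x = regs s) s"
proof -
  note repD = represents[unfolded represents_def]
  have n0: "regs s 0 = n" and w: "0 < w" using repD ample_words_word[OF ample_words] by auto
  have N: "\<And>u. u < n \<Longrightarrow> N u \<subseteq> {..<n}" using repD by auto
  let ?d = "arrs s 4 u" and ?l = "arrs s 6 v" and ?k = "regs s 6"
  note deg = represents_degree[OF represents]
  have dn: "?d \<le> n" using deg(2)[OF uv(3)] .
  have b: "bij_betw (\<lambda>i. arrs s 3 (u * n + i)) {..<?d} (N u)" using repD uv by auto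
  have v: "v \<in> N u" using b k by (auto simp: bij_betw_def)
  have l: "is_level n ?l" "?l \<le> n" using repD uv by (auto simp: is_level_def)
  have ix: "u * n + ?k < 2 ^ w" "u * n + (?d - 1) < 2 ^ w" "?l * n + u < 2 ^ w"
    using ample_words_idx[OF ample_words, of u ?k] ample_words_idx[OF ample_words, of u "?d - 1"] ample_words_idx[OF ample_words, of ?l u] uv(3) dn l k by simp_all
  have a8: "arrs s 8 (Q * n + x) = level_count N (arrs s 6) x Q" if "x < n" for x Q using repD that by auto
  let ?x = "\<lparr>regs = regs s,
     arrs = (arrs s)(4 := (arrs s 4)(u := ?d - 1), 3 := (arrs s 3)(u * n + ?k := arrs s 3 (u * n + (?d - 1))),
       8 := (arrs s 8)(?l * n + u := arrs s 8 (?l * n + u) - 1))\<rparr>"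
  let ?N = "N(u := N u - {v})"
  have "represents n ?N ?x"
  proof -
    have bij: "bij_betw (\<lambda>i. arrs ?x 3 (y * n + i)) {..<arrs ?x 4 y} (?N y)" if y: "y < n" for y
    proof (cases "y = u")
      case True
      have "(\<lambda>i. arrs ?x 3 (u * n + i)) = (\<lambda>i. arrs s 3 (u * n + i))(?k := arrs s 3 (u * n + (?d - 1)))"
        by (rule ext) simp
      then show ?thesis using bij_betw_swap_remove[OF b k(1)] True k(2) by simp
    next
      case False
      have b: "bij_betw (\<lambda>i. arrs s 3 (y * n + i)) {..<arrs s 4 y} (N y)" using repD y by auto
      have "bij_betw (\<lambda>i. arrs ?x 3 (y * n + i)) {..<arrs s 4 y} (N y) = bij_betw (\<lambda>i. arrs s 3 (y * n + i)) {..<arrs s 4 y} (N y)"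
      proof (rule bij_betw_cong)
        fix i assume "i \<in> {..<arrs s 4 y}"
        then have "i < n" using deg(2)[OF y] by auto
        then show "arrs ?x 3 (y * n + i) = arrs s 3 (y * n + i)" using idx_inj[of i n ?k y u] k dn False by auto
      qed
      then show ?thesis using b False by simp
    qed
    have c8: "arrs ?x 8 (Q * n + y) = level_count ?N (arrs s 6) y Q" if "y < n" for y Q
      using a8[OF that] a8[OF uv(3)] idx_inj[OF that uv(3), of Q ?l] level_count_remove[where N = N and u = u and v = v, OF deg(3)[OF uv(3)] v]
      by auto
    have pend: "\<exists>k<regs ?x 5. arrs ?x 9 k = y \<and> arrs ?x 10 k = Q"
      if y: "y < n" "0 < Q" "unstable n ?N (arrs s 5) (arrs s 6) y Q" for y Q
    proof -
      have "unstable n N (arrs s 5) (arrs s 6) y Q"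
        using y(3) level_count_remove[where N = N and u = u and v = v, OF deg(3)[OF uv(3)] v] by (auto simp: unstable_def)
      then show ?thesis using repD y by auto
    qed
    show ?thesis unfolding represents_def using repD bij c8 pend by auto
  qed
  then show ?thesis
    using uv n0 w ix by (simp add: remove_found_def wp_simps)
qed

lemma wp_unlink:
  assumes ample_words: "ample_words w n" and represents: "represents n N s" and uv: "regs s a = u" "regs s b = v" "u < n" "v < n" "v \<in> N u"
    and ab: "a \<noteq> 6" "b \<noteq> 6"
  shows "wp w (unlink a b) (\<lambda>\<tau> x. \<tau> \<le> 80 + 20 * card (N u) \<and> represents n (N(u := N u - {v})) x \<and>
    arrs x 0 = arrs s 0 \<and> arrs x 1 = arrs s 1 \<and> arrs x 5 = arrs s 5 \<and> arrs x 6 = arrs s 6 \<and>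
    (\<forall>r. r \<noteq> 6 \<longrightarrow> regs x r = regs s r)) s"
proof -
  note repD = represents[unfolded represents_def]
  have n0: "regs s 0 = n" and w: "0 < w" using repD ample_words_word[OF ample_words] by auto
  have nw: "n + 2 < 2 ^ w" using ample_words by (rule ample_words_less_square) (simp add: algebra_simps)
  let ?d = "arrs s 4 u" and ?e = "\<lambda>i. arrs s 3 (u * n + i)"
  have d: "?d = card (N u)" "?d \<le> n" using represents_degree[OF represents uv(3)] by auto
  have "bij_betw ?e {..<?d} (N u)" using repD uv by auto
  then have "v \<in> ?e ` {..<?d}" using uv(5) by (simp add: bij_betw_def)
  \<comment> \<open>The scan stops at this position at the latest, which gives both termination and
    the time bound.\<close>
  then obtain k where k: "k < ?d" "?e k = v" by auto
  define s0 where "s0 = \<lparr>regs = (regs s)(6 := 0), arrs = arrs s\<rparr>"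
  define I where "I \<tau> x \<longleftrightarrow> arrs x = arrs s \<and> (\<forall>r. r \<noteq> 6 \<longrightarrow> regs x r = regs s r) \<and> regs x 6 \<le> k \<and> \<tau> \<le> 2 + 20 * regs x 6" for \<tau> and x :: state
  let ?b = "Bin Eq (Bin Eq (Load 3 (idx (Reg a) (Reg 6))) (Reg b)) (Const 0)"
  have ev: "eval w x ?b = of_bool (?e (regs x 6) \<noteq> v)" if "I \<tau> x" for \<tau> x
  proof -
    have "u * n + regs x 6 < 2 ^ w" using ample_words_idx[OF ample_words, of u "regs x 6"] that k d uv by (simp add: I_def)
    then show ?thesis using that uv ab n0 w by (simp add: I_def eval_idx of_bool_mod)
  qed
  have loop: "wp w (find_loop a b) (\<lambda>t'. (\<lambda>\<tau> x. \<tau> \<le> 14 + 20 * k \<and> arrs x = arrs s \<and> (\<forall>r. r \<noteq> 6 \<longrightarrow> regs x r = regs s r) \<and>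
      regs x 6 < ?d \<and> ?e (regs x 6) = v) (2 + t')) s0"
    unfolding find_loop_def
  proof (rule wp_While[where I = I and m = "\<lambda>x. k - regs x 6"])
    show "I 2 s0" by (simp add: I_def s0_def)
  next
    fix \<tau> x assume I: "I \<tau> x" and b: "eval w x ?b \<noteq> 0"
    then have "regs x 6 \<noteq> k" using ev[OF I] k by auto
    then have lt: "regs x 6 < k" using I by (simp add: I_def)
    then have "regs x 6 + 1 < 2 ^ w" using k d nw by linarith
    then show "wp w (Assign 6 (inc (Reg 6))) (\<lambda>t' s'. I (\<tau> + (1 + cost ?b + t')) s' \<and> k - regs s' 6 < k - regs x 6) x"
      using I lt by (simp add: I_def wp_simps)
  next
    fix \<tau> x assume I: "I \<tau> x" and b: "eval w x ?b = 0"
    then have "?e (regs x 6) = v" using ev[OF I] by auto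
    then show "\<tau> + (1 + cost ?b) \<le> 14 + 20 * k \<and> arrs x = arrs s \<and> (\<forall>r. r \<noteq> 6 \<longrightarrow> regs x r = regs s r) \<and>
      regs x 6 < ?d \<and> ?e (regs x 6) = v" using I k by (simp add: I_def cost_simps)
  qed
  have "wp w (find_loop a b) (\<lambda>t. wp w (remove_found a b) (\<lambda>t' x. 2 + (t + t') \<le> 80 + 20 * card (N u) \<and> represents n (N(u := N u - {v})) x \<and>
    arrs x 0 = arrs s 0 \<and> arrs x 1 = arrs s 1 \<and> arrs x 5 = arrs s 5 \<and> arrs x 6 = arrs s 6 \<and>
    (\<forall>r. r \<noteq> 6 \<longrightarrow> regs x r = regs s r))) s0"
  proof (rule wp_mono[OF loop], elim conjE)
    fix t and x :: state assume x: "2 + t \<le> 14 + 20 * k" "arrs x = arrs s" "\<forall>r. r \<noteq> 6 \<longrightarrow> regs x r = regs s r"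
      "regs x 6 < ?d" "?e (regs x 6) = v"
    have "represents n N x" using represents represents_cong[of x s n N] x by simp
    from wp_remove_found[OF ample_words this, of a u b v]
    have "wp w (remove_found a b) (\<lambda>\<tau> y. \<tau> \<le> 60 \<and> represents n (N(u := N u - {v})) y \<and>
      arrs y 0 = arrs x 0 \<and> arrs y 1 = arrs x 1 \<and> arrs y 5 = arrs x 5 \<and> arrs y 6 = arrs x 6 \<and> regs y = regs x) x"
      using uv ab x by simp
    then show "wp w (remove_found a b) (\<lambda>t' x. 2 + (t + t') \<le> 80 + 20 * card (N u) \<and> represents n (N(u := N u - {v})) x \<and>
      arrs x 0 = arrs s 0 \<and> arrs x 1 = arrs s 1 \<and> arrs x 5 = arrs s 5 \<and> arrs x 6 = arrs s 6 \<and>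
      (\<forall>r. r \<noteq> 6 \<longrightarrow> regs x r = regs s r)) x"
      by (rule wp_mono) (use x k d in auto)
  qed
  then show ?thesis unfolding unlink_def wp_Seq wp_Assign by (simp add: s0_def)
qed

lemma wp_reset:
  assumes ample_words: "ample_words w n" and represents: "represents n N s" and a: "regs s a = v" "v < n" "v \<in> N v" and b: "regs s b = u" and ab: "a \<notin> {11, 12}"
    and sym: "\<And>u. u < n \<Longrightarrow> v \<in> N u \<longleftrightarrow> u \<in> N v"
    and W: "card (N v) \<le> W"
    and sp: "regs s 5 + W + 1 < 2 ^ w"
  shows "wp w (reset a b) (\<lambda>\<tau> x. \<tau> \<le> 100 + 60 * W \<and> represents n N x \<and>
    arrs x 0 = arrs s 0 \<and> arrs x 1 = arrs s 1 \<and>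
    arrs x 5 = (if arrs s 5 v = u then (arrs s 5)(v := v) else arrs s 5) \<and>
    pot n (arrs x 5) (arrs x 6) \<le> pot n (arrs s 5) (arrs s 6) + 2 * floor_log n + 3 \<and>
    regs x 5 \<le> regs s 5 + W + 1 \<and> (\<forall>r. r \<notin> {5..17} \<longrightarrow> regs x r = regs s r)) s" (is "wp w _ ?Q s")
proof (cases "arrs s 5 v = u")
  case True
  note repD = represents[unfolded represents_def]
  have n: "0 < n" using ample_words by (simp add: ample_words_def)
  have w: "0 < w" using ample_words_word[OF ample_words] .
  have l1: "is_level n 1" unfolding is_level_def using n by (auto intro: exI[of _ 0])
  define x1 where "x1 = \<lparr>regs = (regs s)(11 := v, 12 := v, 13 := 1), arrs = arrs s\<rparr>"
  have rep1: "represents n N x1" using represents represents_cong[of x1 s n N] by (simp add: x1_def)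
  have "wp w move (\<lambda>\<tau> x. \<tau> \<le> 80 + 60 * card (N v) \<and> represents n N x \<and>
    arrs x 0 = arrs x1 0 \<and> arrs x 1 = arrs x1 1 \<and> arrs x 3 = arrs x1 3 \<and> arrs x 4 = arrs x1 4 \<and>
    arrs x 5 = (arrs x1 5)(v := v) \<and> arrs x 6 = (arrs x1 6)(v := 1) \<and>
    regs x 5 = regs x1 5 + card (N v) + 1 \<and> (\<forall>r. r \<notin> {5, 14, 15, 16, 17} \<longrightarrow> regs x r = regs x1 r)) x1"
    by (rule wp_move[OF ample_words rep1 _ a(2) _ a(3) _ l1 sym]) (use sp W in \<open>auto simp: x1_def\<close>)
  then have "wp w move (\<lambda>\<tau>. ?Q (20 + \<tau>)) x1"
  proof (rule wp_mono, elim conjE)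
    fix \<tau> x assume x: "\<tau> \<le> 80 + 60 * card (N v)" "represents n N x"
      "arrs x 0 = arrs x1 0" "arrs x 1 = arrs x1 1" "arrs x 3 = arrs x1 3" "arrs x 4 = arrs x1 4"
      "arrs x 5 = (arrs x1 5)(v := v)" "arrs x 6 = (arrs x1 6)(v := 1)"
      "regs x 5 = regs x1 5 + card (N v) + 1" "\<forall>r. r \<notin> {5, 14, 15, 16, 17} \<longrightarrow> regs x r = regs x1 r"
    have "arrs s 5 v < n" "is_level n (arrs s 6 v)" using repD a by auto
    from pot_reset[where \<phi> = "arrs s 5" and l = "arrs s 6", OF n a(2) this]
    show "?Q (20 + \<tau>) x" using x W True by (auto simp: x1_def)
  qed
  then show ?thesis using True a b ab w
    by (simp add: reset_def wp_simps x1_def, elim wp_mono) (auto simp: wp_simps)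
next
  case False
  then show ?thesis using a b ample_words_word[OF ample_words] represents by (simp add: reset_def wp_simps)
qed

section \<open>Closed neighbourhoods and updates of undirected edges\<close>

definition closed_nbhd :: "nat set set \<Rightarrow> nat \<Rightarrow> nat set" where
  "closed_nbhd E u = insert u {v. {u, v} \<in> E}"

lemma closed_nbhd_sym: "v \<in> closed_nbhd E u \<longleftrightarrow> u \<in> closed_nbhd E v"
  by (auto simp: closed_nbhd_def insert_commute)

lemma closed_nbhd_insert:
  assumes "u \<noteq> v"
  shows "closed_nbhd (insert {u, v} E) = (closed_nbhd E)(u := insert v (closed_nbhd E u), v := insert u (closed_nbhd E v))"
  using assms by (auto simp: closed_nbhd_def fun_eq_iff doubleton_eq_iff)

lemma closed_nbhd_delete:
  assumes "u \<noteq> v"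
  shows "closed_nbhd (E - {{u, v}}) = (closed_nbhd E)(u := closed_nbhd E u - {v}, v := closed_nbhd E v - {u})"
  using assms by (auto simp: closed_nbhd_def fun_eq_iff doubleton_eq_iff)

text \<open>With an empty stack, the last conjunct of \<open>represents\<close> says that no pair is
  unstable.\<close>

definition settled :: "nat \<Rightarrow> nat set set \<Rightarrow> state \<Rightarrow> bool" where
  "settled n E s \<longleftrightarrow> represents n (closed_nbhd E) s \<and> regs s 5 = 0 \<and> (\<forall>v<n. arrs s 5 v \<in> closed_nbhd E v)"

definition insert_edge :: com where
  "insert_edge = Seq (link 3 4) (link 4 3)"

definition delete_edge :: com where
  "delete_edge = block [unlink 3 4, unlink 4 3, reset 3 4, reset 4 3]"

definition upd :: com where
  "upd = Seq (Cond (Reg 2) insert_edge delete_edge) process"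

text \<open>By \<open>pot_le\<close> and \<open>W \<le> n\<close>, the product is at most
  \<open>16 * (n + 1) ^ 4\<close>. The summand \<open>a\<close> leaves room for the pairs that an
  update pushes before stability is restored.\<close>

lemma ample_words_pot:
  assumes ample_words: "ample_words w n" and "W \<le> n" "a \<le> 4 * (n + 1)"
  shows "a + 2 * W * pot n \<phi> l < 2 ^ w"
proof (rule ample_words_less[OF ample_words])
  have n: "0 < n" using ample_words by (simp add: ample_words_def)
  have "2 * W * pot n \<phi> l \<le> 2 * (n + 1) * (8 * (n + 1) ^ 3)"
    using assms(2) by (intro mult_le_mono pot_le[OF n]) auto
  also have "\<dots> = 16 * (n + 1) ^ 4" by (simp only: power3_eq_cube power4_eq_xxxx mult_ac)
  also have "\<dots> \<le> 16 * (n + 1) ^ 5" by (intro mult_le_mono power_increasing) auto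
  finally have "2 * W * pot n \<phi> l \<le> 16 * (n + 1) ^ 5" .
  moreover have "(n + 1) ^ 1 \<le> (n + 1) ^ 5" by (rule power_increasing) auto
  moreover have "0 < (n + 1) ^ 5" by simp
  moreover have "a + p < 32 * b" if "p \<le> 16 * b" "(n + 1) ^ 1 \<le> b" "0 < b" for p b
    using that assms(3) by simp
  ultimately show "a + 2 * W * pot n \<phi> l < 32 * (n + 1) ^ 5" by blast
qed

text \<open>Dominators and levels are untouched, so the potential stays the same, and each direction
  pushes one pair. Between the two calls of \<open>link\<close> the neighbourhoods are not
  symmetric.\<close>

lemma wp_insert_edge:
  assumes ample_words: "ample_words w n" and settled: "settled n E s" and uv: "regs s 3 = u" "regs s 4 = v" "u < n" "v < n" "u \<noteq> v" "{u, v} \<notin> E"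
  shows "wp w insert_edge (\<lambda>\<tau> x. \<tau> \<le> 120 \<and> represents n (closed_nbhd (insert {u, v} E)) x \<and>
    (\<forall>y<n. arrs x 5 y \<in> closed_nbhd (insert {u, v} E) y) \<and> regs x 5 = 2 \<and>
    arrs x 0 = arrs s 0 \<and> arrs x 1 = arrs s 1 \<and> arrs x 5 = arrs s 5 \<and> arrs x 6 = arrs s 6 \<and>
    (\<forall>r. r \<noteq> 5 \<longrightarrow> regs x r = regs s r)) s"
proof -
  have represents: "represents n (closed_nbhd E) s" and sp: "regs s 5 = 0" and dom: "\<And>y. y < n \<Longrightarrow> arrs s 5 y \<in> closed_nbhd E y" using settled by (auto simp: settled_def)
  have w: "2 < (2::nat) ^ w" using ample_words by (rule ample_words_less_square) simp
  have closed_nbhd: "v \<notin> closed_nbhd E u" "u \<notin> ((closed_nbhd E)(u := insert v (closed_nbhd E u))) v" using uv by (auto simp: closed_nbhd_def insert_commute)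
  have N2: "closed_nbhd (insert {u, v} E) = (closed_nbhd E)(u := insert v (closed_nbhd E u), v := insert u (((closed_nbhd E)(u := insert v (closed_nbhd E u))) v))"
    using uv(5) by (simp add: closed_nbhd_insert)
  have "wp w (link 3 4) (\<lambda>t. wp w (link 4 3) (\<lambda>t' x. t + t' \<le> 120 \<and> represents n (closed_nbhd (insert {u, v} E)) x \<and>
     regs x 5 = 2 \<and> arrs x 0 = arrs s 0 \<and> arrs x 1 = arrs s 1 \<and> arrs x 5 = arrs s 5 \<and> arrs x 6 = arrs s 6 \<and>
    (\<forall>r. r \<noteq> 5 \<longrightarrow> regs x r = regs s r))) s"
  proof (rule wp_mono[OF wp_link[OF ample_words represents uv(1-4) closed_nbhd(1)]], goal_cases)
    case 1 then show ?case using sp w by simp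
  next
    case (2 t x)
    then have x: "represents n ((closed_nbhd E)(u := insert v (closed_nbhd E u))) x" "regs x 4 = v" "regs x 3 = u" "regs x 5 = 1" using uv sp by auto
    show ?case
      by (rule wp_mono[OF wp_link[OF ample_words x(1-3) uv(4,3) closed_nbhd(2)]]) (use 2 x(4) w uv N2 in \<open>auto simp del: fun_upd_apply\<close>)
  qed
  then show ?thesis unfolding insert_edge_def wp_Seq
    by (elim wp_mono) (use dom in \<open>auto simp: closed_nbhd_def\<close>)
qed

text \<open>The constant 330 covers 120 steps of linking, 100 for each of the two pushed pairs, and
  the last loop test.\<close>

lemma wp_insert_process:
  fixes n W s
  defines "\<Phi> \<equiv> \<lambda>x. pot n (arrs x 5) (arrs x 6)"
  assumes ample_words: "ample_words w n" and settled: "settled n E s" and uv: "regs s 3 = u" "regs s 4 = v" "u < n" "v < n" "u \<noteq> v" "{u, v} \<notin> E"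
    and W: "\<And>x. x < n \<Longrightarrow> card (closed_nbhd (insert {u, v} E) x) \<le> W" "0 < W" "W \<le> n"
  shows "wp w (Seq insert_edge process) (\<lambda>\<tau> x. settled n (insert {u, v} E) x \<and>
    arrs x 0 = arrs s 0 \<and> arrs x 1 = arrs s 1 \<and> (\<forall>r. r \<notin> {5..17} \<longrightarrow> regs x r = regs s r) \<and>
    \<tau> + 500 * W * \<Phi> x \<le> 500 * W * \<Phi> s + 330) s"
  unfolding wp_Seq
proof (rule wp_mono[OF wp_insert_edge[OF ample_words settled uv]], elim conjE)
  fix t :: nat and x assume x: "t \<le> 120" "represents n (closed_nbhd (insert {u, v} E)) x" "\<forall>y<n. arrs x 5 y \<in> closed_nbhd (insert {u, v} E) y"
    "regs x 5 = 2" "arrs x 0 = arrs s 0" "arrs x 1 = arrs s 1" "arrs x 5 = arrs s 5" "arrs x 6 = arrs s 6"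
    "\<forall>r. r \<noteq> 5 \<longrightarrow> regs x r = regs s r"
  have sp: "regs x 5 + 2 * W * pot n (arrs x 5) (arrs x 6) < 2 ^ w"
    by (rule ample_words_pot[OF ample_words W(3)]) (simp add: x(4))
  have dom: "arrs x 5 y \<in> closed_nbhd (insert {u, v} E) y" if "y < n" for y using x(3) that by blast
  show "wp w process (\<lambda>t' x. settled n (insert {u, v} E) x \<and> arrs x 0 = arrs s 0 \<and> arrs x 1 = arrs s 1 \<and>
     (\<forall>r. r \<notin> {5..17} \<longrightarrow> regs x r = regs s r) \<and> t + t' + 500 * W * \<Phi> x \<le> 500 * W * \<Phi> s + 330) x"
    by (rule wp_mono[OF wp_process[OF ample_words x(2) dom closed_nbhd_sym W(1,2) sp]])
      (use x in \<open>auto simp: settled_def \<Phi>_def\<close>)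
qed

text \<open>Only an endpoint assigned to the other endpoint loses its dominator. The two resets
  repair this; together they raise the potential by at most twice the bound of
  \<open>pot_reset\<close> and push at most \<open>W + 1\<close> pairs each.\<close>

lemma wp_delete_edge:
  fixes n W s
  defines "\<Phi> \<equiv> \<lambda>x. pot n (arrs x 5) (arrs x 6)"
  assumes ample_words: "ample_words w n" and settled: "settled n E s" and uv: "regs s 3 = u" "regs s 4 = v" "u < n" "v < n" "u \<noteq> v" "{u, v} \<in> E"
    and W: "\<And>x. x < n \<Longrightarrow> card (closed_nbhd E x) \<le> W" "W \<le> n"
  shows "wp w delete_edge (\<lambda>\<tau> x. \<tau> \<le> 400 + 160 * W \<and> represents n (closed_nbhd (E - {{u, v}})) x \<and>
    (\<forall>y<n. arrs x 5 y \<in> closed_nbhd (E - {{u, v}}) y) \<and> regs x 5 \<le> 2 * W + 2 \<and>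
    arrs x 0 = arrs s 0 \<and> arrs x 1 = arrs s 1 \<and> \<Phi> x \<le> \<Phi> s + 4 * floor_log n + 6 \<and>
    (\<forall>r. r \<notin> {5..17} \<longrightarrow> regs x r = regs s r)) s"
proof -
  have represents: "represents n (closed_nbhd E) s" and sp: "regs s 5 = 0" and dom: "\<And>y. y < n \<Longrightarrow> arrs s 5 y \<in> closed_nbhd E y" using settled by (auto simp: settled_def)
  have w: "2 * W + 3 < (2::nat) ^ w" using ample_words by (rule ample_words_less_square) (use W(2) in \<open>simp add: algebra_simps\<close>)
  let ?E = "E - {{u, v}}" and ?N1 = "(closed_nbhd E)(u := closed_nbhd E u - {v})"
  have N2: "closed_nbhd ?E = ?N1(v := ?N1 v - {u})" using uv(5) by (simp add: closed_nbhd_delete)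
  have nb1: "v \<in> closed_nbhd E u" "u \<in> ?N1 v" using uv by (auto simp: closed_nbhd_def insert_commute)
  have W1: "card (?N1 v) \<le> W" using W(1)[OF uv(4)] uv by simp
  have sub: "closed_nbhd ?E x \<subseteq> closed_nbhd E x" for x by (auto simp: closed_nbhd_def)
  have W2: "card (closed_nbhd ?E x) \<le> W" if "x < n" for x
    using card_mono[OF represents_degree(3)[OF represents that] sub] W(1)[OF that] by simp
  have self: "x \<in> closed_nbhd F x" for x F by (simp add: closed_nbhd_def)
  define Q1 where "Q1 \<tau> x \<longleftrightarrow> \<tau> \<le> 160 + 40 * W \<and> represents n (closed_nbhd ?E) x \<and> arrs x 0 = arrs s 0 \<and> arrs x 1 = arrs s 1 \<and>
    arrs x 5 = arrs s 5 \<and> arrs x 6 = arrs s 6 \<and> (\<forall>r. r \<noteq> 6 \<longrightarrow> regs x r = regs s r)" for \<tau> x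
  have 1: "wp w (unlink 3 4) (\<lambda>t. wp w (unlink 4 3) (\<lambda>t'. Q1 (t + t'))) s"
  proof (rule wp_mono[OF wp_unlink[OF ample_words represents uv(1-4) nb1(1)]], goal_cases)
    case (3 t x)
    then have x: "represents n ?N1 x" "regs x 4 = v" "regs x 3 = u" using uv by auto
    show ?case
      by (rule wp_mono[OF wp_unlink[OF ample_words x(1-3) uv(4,3) nb1(2)]]) (use 3 W1 W(1)[OF uv(3)] uv in \<open>auto simp: Q1_def N2 simp del: fun_upd_apply\<close>)
  qed auto
  define Q2 where "Q2 \<tau> x \<longleftrightarrow> \<tau> \<le> 260 + 100 * W \<and> represents n (closed_nbhd ?E) x \<and> arrs x 0 = arrs s 0 \<and> arrs x 1 = arrs s 1 \<and>
    arrs x 5 = (if arrs s 5 u = v then (arrs s 5)(u := u) else arrs s 5) \<and> \<Phi> x \<le> \<Phi> s + 2 * floor_log n + 3 \<and>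
    regs x 5 \<le> W + 1 \<and> (\<forall>r. r \<notin> {5..17} \<longrightarrow> regs x r = regs s r)" for \<tau> x
  have 2: "wp w (reset 3 4) (\<lambda>t. Q2 (\<tau> + t)) x" if "Q1 \<tau> x" for \<tau> x
  proof (rule wp_mono[OF wp_reset[OF ample_words _ _ uv(3) self _ _ closed_nbhd_sym W2[OF uv(3)]]])
    show "represents n (closed_nbhd ?E) x" "regs x 3 = u" "regs x 4 = v" "3 \<notin> {11, 12::nat}" "regs x 5 + W + 1 < 2 ^ w"
      using that uv sp w by (auto simp: Q1_def)
  qed (use that sp in \<open>auto simp: Q1_def Q2_def \<Phi>_def\<close>)
  define Q3 where "Q3 \<tau> x \<longleftrightarrow> \<tau> \<le> 360 + 160 * W \<and> represents n (closed_nbhd ?E) x \<and> arrs x 0 = arrs s 0 \<and> arrs x 1 = arrs s 1 \<and>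
    (\<forall>y<n. arrs x 5 y \<in> closed_nbhd ?E y) \<and> \<Phi> x \<le> \<Phi> s + 4 * floor_log n + 6 \<and>
    regs x 5 \<le> 2 * W + 2 \<and> (\<forall>r. r \<notin> {5..17} \<longrightarrow> regs x r = regs s r)" for \<tau> x
  have 3: "wp w (reset 4 3) (\<lambda>t. Q3 (\<tau> + t)) x" if Q2: "Q2 \<tau> x" for \<tau> x
  proof (rule wp_mono[OF wp_reset[OF ample_words _ _ uv(4) self _ _ closed_nbhd_sym W2[OF uv(4)]]])
    show "represents n (closed_nbhd ?E) x" "regs x 4 = v" "regs x 3 = u" "4 \<notin> {11, 12::nat}" "regs x 5 + W + 1 < 2 ^ w"
      using Q2 uv w by (auto simp: Q2_def)
  next
    fix t :: nat and y
    assume y: "t \<le> 100 + 60 * W \<and> represents n (closed_nbhd ?E) y \<and>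
      arrs y 0 = arrs x 0 \<and> arrs y 1 = arrs x 1 \<and>
      arrs y 5 = (if arrs x 5 v = u then (arrs x 5)(v := v) else arrs x 5) \<and>
      pot n (arrs y 5) (arrs y 6) \<le> pot n (arrs x 5) (arrs x 6) + 2 * floor_log n + 3 \<and>
      regs y 5 \<le> regs x 5 + W + 1 \<and> (\<forall>r. r \<notin> {5..17} \<longrightarrow> regs y r = regs x r)"
    \<comment> \<open>As \<open>u \<noteq> v\<close>, the first reset leaves the dominator of
      \<open>v\<close> alone, so the second test still sees the original one.\<close>
    have "arrs y 5 z \<in> closed_nbhd ?E z" if "z < n" for z
      using dom[OF that] y Q2 uv(5) by (auto simp: Q2_def closed_nbhd_def doubleton_eq_iff split: if_splits)
    then show "Q3 (\<tau> + t) y" using y Q2 by (auto simp: Q2_def Q3_def \<Phi>_def)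
  qed
  \<comment> \<open>The subtracted 1 is the \<open>Skip\<close> at the end of the block.\<close>
  have 4: "wp w (block [reset 3 4, reset 4 3]) (\<lambda>t'. Q3 (\<tau> + t' - 1)) x" if "Q1 \<tau> x" for \<tau> x
    unfolding block.simps wp_Seq
  proof (rule wp_mono[OF 2[OF that]])
    fix t y assume "Q2 (\<tau> + t) y"
    from 3[OF this] show "wp w (reset 4 3) (\<lambda>ta. wp w Skip (\<lambda>t'. Q3 (\<tau> + (t + (ta + t')) - 1))) y"
      by (rule wp_mono) (simp add: wp_Skip add.assoc)
  qed
  have "wp w delete_edge (\<lambda>\<tau>. Q3 (\<tau> - 1)) s"
    unfolding delete_edge_def block.simps(2)[of "unlink 3 4"] block.simps(2)[of "unlink 4 3"] wp_Seq
  proof (rule wp_mono[OF 1])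
    fix t x assume "wp w (unlink 4 3) (\<lambda>t'. Q1 (t + t')) x"
    then show "wp w (unlink 4 3) (\<lambda>ta. wp w (block [reset 3 4, reset 4 3]) (\<lambda>t'. Q3 (t + (ta + t') - 1))) x"
    proof (rule wp_mono)
      fix t' y assume "Q1 (t + t') y"
      from 4[OF this] show "wp w (block [reset 3 4, reset 4 3]) (\<lambda>t'a. Q3 (t + (t' + t'a) - 1)) y"
        by (simp only: add.assoc)
    qed
  qed
  then show ?thesis by (rule wp_mono) (auto simp: Q3_def)
qed

text \<open>The increase of the potential accounts for
  \<open>500 * W * (4 * floor_log n + 6)\<close>; unlinking, resetting and inspecting the pushed
  pairs add \<open>O(W)\<close> steps.\<close>

lemma wp_delete_process:
  fixes n W s
  defines "\<Phi> \<equiv> \<lambda>x. pot n (arrs x 5) (arrs x 6)"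
  assumes ample_words: "ample_words w n" and settled: "settled n E s" and uv: "regs s 3 = u" "regs s 4 = v" "u < n" "v < n" "u \<noteq> v" "{u, v} \<in> E"
    and W: "\<And>x. x < n \<Longrightarrow> card (closed_nbhd E x) \<le> W" "0 < W" "W \<le> n"
  shows "wp w (Seq delete_edge process) (\<lambda>\<tau> x. settled n (E - {{u, v}}) x \<and>
    \<tau> + 500 * W * \<Phi> x \<le> 500 * W * \<Phi> s + 3990 * W * (floor_log n + 1)) s"
  unfolding wp_Seq
proof (rule wp_mono[OF wp_delete_edge[OF ample_words settled uv W(1,3)]], assumption, elim conjE)
  let ?E = "E - {{u, v}}"
  fix t :: nat and x assume x: "t \<le> 400 + 160 * W" "represents n (closed_nbhd ?E) x" "\<forall>y<n. arrs x 5 y \<in> closed_nbhd ?E y"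
    "regs x 5 \<le> 2 * W + 2" "pot n (arrs x 5) (arrs x 6) \<le> pot n (arrs s 5) (arrs s 6) + 4 * floor_log n + 6"
  have represents: "represents n (closed_nbhd E) s" using settled by (simp add: settled_def)
  have sub: "closed_nbhd ?E x \<subseteq> closed_nbhd E x" for x by (auto simp: closed_nbhd_def)
  have W2: "card (closed_nbhd ?E x) \<le> W" if "x < n" for x
    using card_mono[OF represents_degree(3)[OF represents that] sub] W(1)[OF that] by simp
  have sp: "regs x 5 + 2 * W * pot n (arrs x 5) (arrs x 6) < 2 ^ w"
    by (rule ample_words_pot[OF ample_words W(3)]) (use x(4) W(3) in simp)
  have dom: "arrs x 5 y \<in> closed_nbhd ?E y" if "y < n" for y using x(3) that by blast
  have "W * \<Phi> x \<le> W * (\<Phi> s + 4 * floor_log n + 6)" using x(5) unfolding \<Phi>_def by (rule mult_le_mono2)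
  then have pot: "W * \<Phi> x \<le> W * \<Phi> s + 4 * (W * floor_log n) + 6 * W" by (simp add: algebra_simps)
  show "wp w process (\<lambda>t' x. settled n ?E x \<and> t + t' + 500 * W * \<Phi> x \<le> 500 * W * \<Phi> s + 3990 * W * (floor_log n + 1)) x"
  proof (rule wp_mono[OF wp_process[OF ample_words x(2) dom closed_nbhd_sym W2 W(2) sp]], assumption, assumption, elim conjE)
    fix t' :: nat and y
    assume y: "represents n (closed_nbhd ?E) y" "\<forall>v<n. arrs y 5 v \<in> closed_nbhd ?E v" "regs y 5 = 0"
      "t' + 500 * W * pot n (arrs y 5) (arrs y 6) \<le> 500 * W * pot n (arrs x 5) (arrs x 6) + 100 * regs x 5 + 2"
    have "t' + 500 * (W * \<Phi> y) \<le> 500 * (W * \<Phi> x) + 100 * regs x 5 + 2" using y(4) by (simp add: \<Phi>_def mult.assoc)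
    then have "t + t' + 500 * (W * \<Phi> y) \<le> 500 * (W * \<Phi> s) + 3990 * (W * floor_log n) + 3990 * W"
      using x(1,4) pot W(2) by linarith
    then show "settled n ?E y \<and> t + t' + 500 * W * \<Phi> y \<le> 500 * W * \<Phi> s + 3990 * W * (floor_log n + 1)"
      using y(1-3) by (simp add: settled_def algebra_simps)
  qed
qed

text \<open>\<open>W\<close> bounds the neighbourhoods on both sides of the update: after an
  insertion the moves take place in the larger new graph, whereas a deletion still searches the
  lists of the old one.\<close>

lemma wp_upd:
  fixes n W s
  defines "\<Phi> \<equiv> \<lambda>x. pot n (arrs x 5) (arrs x 6)"
  assumes ample_words: "ample_words w n" and settled: "settled n E s" and E: "simple_graph {..<n} E" and valid: "valid_update {..<n} E u"
    and W: "\<And>x. x < n \<Longrightarrow> card (closed_nbhd E x) \<le> W" "\<And>x. x < n \<Longrightarrow> card (closed_nbhd (apply_update u E) x) \<le> W" "0 < W" "W \<le> n"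
  shows "wp w upd (\<lambda>\<tau> x. settled n (apply_update u E) x \<and>
    \<tau> + 500 * W * \<Phi> x \<le> 500 * W * \<Phi> s + 4000 * W * (floor_log n + 1)) (pass_update u s)"
proof -
  have eq: "wp w upd Q s = wp w (Seq (if regs s 2 \<noteq> 0 then insert_edge else delete_edge) process) (\<lambda>t. Q (2 + t)) s" for Q s
    unfolding upd_def wp_Seq wp_Cond by (simp add: add.assoc)
  have p: "arrs (pass_update u s) = arrs s" "\<And>r. r \<notin> {2, 3, 4} \<Longrightarrow> regs (pass_update u s) r = regs s r" for s
    by (cases u; simp)+
  have settled': "settled n E (pass_update u s)"
    using settled p represents_cong[of "pass_update u s" s] by (simp add: settled_def)
  have one: "1 \<le> W * (floor_log n + 1)" using W(3) by (cases W) auto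
  show ?thesis
  proof (cases u)
    case (Insert a b)
    then have ab: "a < n" "b < n" "a \<noteq> b" "{a, b} \<notin> E" using valid by auto
    have "wp w (Seq insert_edge process) (\<lambda>\<tau> x. settled n (insert {a, b} E) x \<and>
      arrs x 0 = arrs (pass_update u s) 0 \<and> arrs x 1 = arrs (pass_update u s) 1 \<and> (\<forall>r. r \<notin> {5..17} \<longrightarrow> regs x r = regs (pass_update u s) r) \<and>
      \<tau> + 500 * W * \<Phi> x \<le> 500 * W * \<Phi> (pass_update u s) + 330) (pass_update u s)"
      unfolding \<Phi>_def by (rule wp_insert_process[OF ample_words settled' _ _ ab _ W(3,4)]) (use Insert W(2) in auto)
    then show ?thesis unfolding eq using Insert one p(1)[of s]
      by (simp add: mult.assoc \<Phi>_def, elim wp_mono) (use one in \<open>auto simp: algebra_simps\<close>)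
  next
    case (Delete a b)
    then have e: "{a, b} \<in> E" using valid by auto
    then obtain c d where "{a, b} = {c, d}" "c < n" "d < n" "c \<noteq> d" using E by (auto simp: simple_graph_def)
    then have ab: "a < n" "b < n" "a \<noteq> b" by (auto simp: doubleton_eq_iff)
    have "wp w (Seq delete_edge process) (\<lambda>\<tau> x. settled n (E - {{a, b}}) x \<and>
      \<tau> + 500 * W * \<Phi> x \<le> 500 * W * \<Phi> (pass_update u s) + 3990 * W * (floor_log n + 1)) (pass_update u s)"
      unfolding \<Phi>_def by (rule wp_delete_process[OF ample_words settled' _ _ ab e W(1,3,4)]) (use Delete in auto)
    then show ?thesis unfolding eq using Delete one p(1)[of s]
      by (simp add: mult.assoc \<Phi>_def, elim wp_mono) (use one in \<open>auto simp: algebra_simps\<close>)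
  qed
qed

section \<open>Preprocessing\<close>

definition init_body :: com where
  "init_body = block
    [Store 3 (idx (Reg 6) (Const 0)) (Reg 6),
     Store 4 (Reg 6) (Const 1),
     Store 5 (Reg 6) (Reg 6),
     Store 6 (Reg 6) (Const 1),
     Store 2 (Reg 6) (Const 1),
     Store 7 (idx (Const 1) (Reg 6)) (Const 1),
     Store 8 (idx (Const 1) (Reg 6)) (Const 1),
     Assign 6 (inc (Reg 6))]"

text \<open>The edge counter is kept in register 18 because restoring stability may overwrite
  registers 5 to 17.\<close>

definition edge_body :: com where
  "edge_body = block
    [Assign 3 (Load 0 (Reg 18)),
     Assign 4 (Load 1 (Reg 18)),
     Seq insert_edge process,
     Assign 18 (inc (Reg 18))]"

definition pre :: com where
  "pre = Seq (While (Bin Less (Reg 6) (Reg 0)) init_body) (While (Bin Less (Reg 18) (Reg 1)) edge_body)"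

text \<open>Cells \<open>n\<close> to \<open>n + i - 1\<close> of arrays 7 and 8 belong to the row
  of level 1. Describing these arrays as whole functions records that all other counts are
  zero.\<close>

definition init_inv :: "nat \<Rightarrow> state \<Rightarrow> nat \<Rightarrow> state \<Rightarrow> bool" where
  "init_inv n s i x \<longleftrightarrow> i \<le> n \<and> regs x 6 = i \<and> (\<forall>r. r \<noteq> 6 \<longrightarrow> regs x r = regs s r) \<and> arrs x 0 = arrs s 0 \<and> arrs x 1 = arrs s 1 \<and>
    (\<forall>u<i. arrs x 3 (u * n) = u) \<and> arrs x 4 = (\<lambda>u. if u < i then 1 else 0) \<and>
    arrs x 5 = (\<lambda>u. if u < i then u else 0) \<and> arrs x 6 = (\<lambda>u. if u < i then 1 else 0) \<and>
    arrs x 2 = (\<lambda>u. if u < i then 1 else 0) \<and>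
    arrs x 7 = (\<lambda>k. if n \<le> k \<and> k < n + i then 1 else 0) \<and>
    arrs x 8 = (\<lambda>k. if n \<le> k \<and> k < n + i then 1 else 0)"

lemma wp_init_body:
  assumes "0 < w" "regs x 0 = n" "regs x 6 = i" "i * n < 2 ^ w" "n + i < 2 ^ w" "i + 1 < 2 ^ w"
  shows "wp w init_body Q x = Q 38 \<lparr>regs = (regs x)(6 := i + 1),
    arrs = (arrs x)(3 := (arrs x 3)(i * n := i), 4 := (arrs x 4)(i := 1), 5 := (arrs x 5)(i := i),
     6 := (arrs x 6)(i := 1), 2 := (arrs x 2)(i := 1), 7 := (arrs x 7)(n + i := 1), 8 := (arrs x 8)(n + i := 1))\<rparr>"
  using assms by (simp add: init_body_def wp_simps)

text \<open>Each pair \<open>(u, 1)\<close> has cover count and level count 1, and all other counts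
  are 0. Neither rule applies, so the empty stack is correct.\<close>

lemma settled_init:
  assumes n: "0 < n" and inv: "init_inv n s n x" and s: "regs s 0 = n" "regs s 5 = 0"
  shows "settled n {} x"
proof -
  note invD = inv[unfolded init_inv_def]
  have closed_nbhd: "closed_nbhd {} = (\<lambda>u. {u})" by (auto simp: closed_nbhd_def)
  have bij: "bij_betw (\<lambda>i. arrs x 3 (u * n + i)) {..<arrs x 4 u} {u}" if "u < n" for u
    using invD that by (auto simp: bij_betw_def lessThan_Suc)
  have range: "n \<le> P * n + u \<and> P * n + u < n + n \<longleftrightarrow> P = 1" if "u < n" for u P
  proof (cases P)
    case (Suc m)
    show ?thesis
    proof (cases m)
      case (Suc k) then show ?thesis using \<open>P = Suc m\<close> by simp
    qed (use \<open>P = Suc m\<close> that in simp)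
  qed (use that in simp)
  have cov: "cover_count n (arrs x 5) (arrs x 6) u P = (if P = 1 then 1 else 0)" if "u < n" for u P
  proof -
    have "{y. y < n \<and> arrs x 5 y = u \<and> arrs x 6 y = P} = (if P = 1 then {u} else {})" using invD that by auto
    then show ?thesis by (simp add: cover_count_def)
  qed
  have c: "level_count (\<lambda>u. {u}) (arrs x 6) u P = (if P = 1 then 1 else 0)" if "u < n" for u P
  proof -
    have "{y \<in> {u}. arrs x 6 y = P} = (if P = 1 then {u} else {})" using invD that by auto
    then show ?thesis by (simp add: level_count_def)
  qed
  have out: "{y. y < n \<and> arrs x 5 y = u} = {u}" if "u < n" for u using invD that by auto
  have l1: "is_level n 1" unfolding is_level_def using n by (auto intro: exI[of _ 0])
  have "represents n (\<lambda>u. {u}) x"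
    unfolding represents_def unstable_def using invD s n bij cov c out range l1 by auto
  then show ?thesis using invD s by (auto simp: settled_def closed_nbhd)
qed

lemma wp_init:
  assumes ample_words: "ample_words w n" and s: "regs s 0 = n" "regs s 5 = 0" "regs s 6 = 0" "arrs s = (\<lambda>_ _. 0)(0 := a0, 1 := a1)"
  shows "wp w (While (Bin Less (Reg 6) (Reg 0)) init_body)
    (\<lambda>\<tau> x. \<tau> \<le> 10 + 60 * n \<and> settled n {} x \<and> arrs x 0 = a0 \<and> arrs x 1 = a1 \<and>
      pot n (arrs x 5) (arrs x 6) \<le> 2 * n * floor_log n \<and> (\<forall>r. r \<noteq> 6 \<longrightarrow> regs x r = regs s r)) s"
proof -
  have n: "0 < n" and w: "0 < w" using ample_words ample_words_word by (auto simp: ample_words_def)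
  have nw: "2 * n + 1 < 2 ^ w" using ample_words by (rule ample_words_less_square) (simp add: algebra_simps)
  let ?b = "Bin Less (Reg 6) (Reg 0)"
  have "wp w (While ?b init_body) (\<lambda>t'. (\<lambda>\<tau> x. \<tau> \<le> 10 + 60 * n \<and> init_inv n s n x) (0 + t')) s"
  proof (rule wp_While[where I = "\<lambda>\<tau> x. \<tau> \<le> 60 * regs x 6 \<and> init_inv n s (regs x 6) x" and m = "\<lambda>x. n - regs x 6"])
    show "0 \<le> 60 * regs s 6 \<and> init_inv n s (regs s 6) s" using s by (auto simp: init_inv_def fun_eq_iff)
  next
    fix \<tau> x assume I: "\<tau> \<le> 60 * regs x 6 \<and> init_inv n s (regs x 6) x" and b: "eval w x ?b \<noteq> 0"
    let ?i = "regs x 6"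
    have x0: "regs x 0 = n" using I s by (auto simp: init_inv_def)
    have i: "?i < n" using b w x0 by (simp add: of_bool_mod)
    have ix: "?i * n < 2 ^ w" using ample_words_idx[OF ample_words, of ?i 0] i by simp
    let ?x = "\<lparr>regs = (regs x)(6 := ?i + 1),
      arrs = (arrs x)(3 := (arrs x 3)(?i * n := ?i), 4 := (arrs x 4)(?i := 1), 5 := (arrs x 5)(?i := ?i),
       6 := (arrs x 6)(?i := 1), 2 := (arrs x 2)(?i := 1), 7 := (arrs x 7)(n + ?i := 1), 8 := (arrs x 8)(n + ?i := 1))\<rparr>"
    have "init_inv n s (Suc ?i) ?x"
      unfolding init_inv_def using conjunct2[OF I, unfolded init_inv_def] i n
      by (auto simp: fun_eq_iff less_Suc_eq)
    moreover have "wp w init_body Q x = Q 38 ?x" for Q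
      by (rule wp_init_body[OF w x0 refl ix]) (use i nw in auto)
    ultimately show "wp w init_body (\<lambda>t' s'. (\<tau> + (1 + cost ?b + t') \<le> 60 * regs s' 6 \<and> init_inv n s (regs s' 6) s') \<and> n - regs s' 6 < n - regs x 6) x"
      using I i by simp
  next
    fix \<tau> x assume I: "\<tau> \<le> 60 * regs x 6 \<and> init_inv n s (regs x 6) x" and b: "eval w x ?b = 0"
    have "regs x 0 = n" "regs x 6 \<le> n" using I s by (auto simp: init_inv_def)
    then have "regs x 6 = n" using b w by (simp add: of_bool_mod)
    then show "\<tau> + (1 + cost ?b) \<le> 10 + 60 * n \<and> init_inv n s n x" using I by simp
  qed
  then show ?thesis
  proof (rule wp_mono, elim conjE)
    fix t x assume t: "0 + t \<le> 10 + 60 * n" and inv: "init_inv n s n x"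
    have "pot n (arrs x 5) (arrs x 6) \<le> 2 * n * floor_log n"
      by (rule pot_init) (use inv in \<open>auto simp: init_inv_def\<close>)
    then show "t \<le> 10 + 60 * n \<and> settled n {} x \<and> arrs x 0 = a0 \<and> arrs x 1 = a1 \<and>
      pot n (arrs x 5) (arrs x 6) \<le> 2 * n * floor_log n \<and> (\<forall>r. r \<noteq> 6 \<longrightarrow> regs x r = regs s r)"
      using t settled_init[OF n inv s(1,2)] inv s(4) by (simp add: init_inv_def)
  qed
qed

definition edges_of :: "(nat \<times> nat) list \<Rightarrow> nat set set" where
  "edges_of es = set (map (\<lambda>(u, v). {u, v}) es)"

text \<open>Every prefix of the edge list gives a subgraph of the initial graph, so \<open>W\<close>
  bounds all intermediate neighbourhoods. Beyond the released potential an edge costs at most 330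
  steps for its insertion plus loop control, which 400 covers.\<close>

lemma wp_edges:
  fixes n W s
  defines "\<Phi> \<equiv> \<lambda>x. pot n (arrs x 5) (arrs x 6)"
  assumes ample_words: "ample_words w n" and settled: "settled n {} s" and s: "regs s 1 = length es" "regs s 18 = 0"
    and es: "\<And>i. i < length es \<Longrightarrow> arrs s 0 i = fst (es ! i) \<and> arrs s 1 i = snd (es ! i)"
    and dist: "distinct (map (\<lambda>(u, v). {u, v}) es)"
    and E: "simple_graph {..<n} (edges_of es)" and len: "length es \<le> n * n"
    and W: "\<And>x. x < n \<Longrightarrow> card (closed_nbhd (edges_of es) x) \<le> W" "0 < W" "W \<le> n"
  shows "wp w (While (Bin Less (Reg 18) (Reg 1)) edge_body)
    (\<lambda>\<tau> x. settled n (edges_of es) x \<and> \<tau> + 500 * W * \<Phi> x \<le> 500 * W * \<Phi> s + 400 * length es + 10) s"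
proof -
  let ?m = "length es"
  let ?b = "Bin Less (Reg 18) (Reg 1)"
  have w: "0 < w" using ample_words_word[OF ample_words] .
  have mw: "?m + 1 < 2 ^ w" using ample_words by (rule ample_words_less_square) (use len in \<open>simp add: algebra_simps\<close>)
  define I where "I \<tau> x \<longleftrightarrow> regs x 18 \<le> ?m \<and> regs x 1 = ?m \<and> arrs x 0 = arrs s 0 \<and> arrs x 1 = arrs s 1 \<and>
    settled n (edges_of (take (regs x 18) es)) x \<and> \<tau> + 500 * W * \<Phi> x \<le> 500 * W * \<Phi> s + 400 * regs x 18" for \<tau> x
  have fin: "finite (closed_nbhd (edges_of es) x)" if "x < n" for x
  proof -
    have "closed_nbhd (edges_of es) x \<subseteq> {..<n}" using E that by (auto simp: closed_nbhd_def simple_graph_def doubleton_eq_iff)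
    then show ?thesis using finite_subset by blast
  qed
  have "wp w (While ?b edge_body) (\<lambda>t'. (\<lambda>\<tau> x. settled n (edges_of es) x \<and> \<tau> + 500 * W * \<Phi> x \<le> 500 * W * \<Phi> s + 400 * length es + 10) (0 + t')) s"
  proof (rule wp_While[where I = I and m = "\<lambda>x. ?m - regs x 18"])
    show "I 0 s" using s settled by (simp add: I_def edges_of_def)
  next
    fix \<tau> x assume I: "I \<tau> x" and b: "eval w x ?b \<noteq> 0"
    let ?i = "regs x 18"
    have i: "?i < ?m" using b w I by (simp add: I_def of_bool_mod)
    obtain u v where uv: "es ! ?i = (u, v)" by (cases "es ! ?i")
    let ?E = "edges_of (take ?i es)" and ?E' = "edges_of (take (Suc ?i) es)"
    have tk: "take (Suc ?i) es = take ?i es @ [(u, v)]" using i uv by (simp add: take_Suc_conv_app_nth)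
    have E': "?E' = insert {u, v} ?E" by (simp add: tk edges_of_def)
    have mem: "{u, v} \<in> edges_of es" using i uv nth_mem[OF i] by (force simp: edges_of_def)
    then obtain c d where "{u, v} = {c, d}" "c < n" "d < n" "c \<noteq> d" using E by (auto simp: simple_graph_def)
    then have uvn: "u < n" "v < n" "u \<noteq> v" by (auto simp: doubleton_eq_iff)
    have "distinct (map (\<lambda>(u, v). {u, v}) (take (Suc ?i) es))" using dist by (simp add: take_map[symmetric])
    then have new: "{u, v} \<notin> ?E" unfolding tk edges_of_def by auto
    have "?E' \<subseteq> edges_of es" unfolding edges_of_def set_map by (intro image_mono set_take_subset)
    then have sub: "closed_nbhd ?E' y \<subseteq> closed_nbhd (edges_of es) y" for y by (auto simp: closed_nbhd_def)
    have W': "card (closed_nbhd (insert {u, v} ?E) y) \<le> W" if "y < n" for y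
      using card_mono[OF fin[OF that] sub] W(1)[OF that] unfolding E' by simp
    define x1 where "x1 = \<lparr>regs = (regs x)(3 := u, 4 := v), arrs = arrs x\<rparr>"
    have good1: "settled n ?E x1" using I represents_cong[of x1 x n "closed_nbhd ?E"] by (simp add: I_def settled_def x1_def)
    have "wp w (Seq insert_edge process) (\<lambda>\<tau> y. settled n (insert {u, v} ?E) y \<and>
      arrs y 0 = arrs x1 0 \<and> arrs y 1 = arrs x1 1 \<and> (\<forall>r. r \<notin> {5..17} \<longrightarrow> regs y r = regs x1 r) \<and>
      \<tau> + 500 * W * \<Phi> y \<le> 500 * W * \<Phi> x1 + 330) x1"
      unfolding \<Phi>_def by (rule wp_insert_process[OF ample_words good1 _ _ uvn new W' W(2,3)]) (auto simp: x1_def)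
    then have *: "wp w (Seq insert_edge process) (\<lambda>t y. regs y 18 + 1 < 2 ^ w \<and>
        I (\<tau> + (20 + t)) \<lparr>regs = (regs y)(18 := regs y 18 + 1), arrs = arrs y\<rparr> \<and> ?m - (regs y 18 + 1) < ?m - ?i) x1"
    proof (rule wp_mono, elim conjE)
      fix t y assume y: "settled n (insert {u, v} ?E) y" "arrs y 0 = arrs x1 0" "arrs y 1 = arrs x1 1"
        "\<forall>r. r \<notin> {5..17} \<longrightarrow> regs y r = regs x1 r" "t + 500 * W * \<Phi> y \<le> 500 * W * \<Phi> x1 + 330"
      have r: "regs y 18 = ?i" "regs y 1 = ?m" using y(4) I by (auto simp: x1_def I_def)
      let ?y = "\<lparr>regs = (regs y)(18 := Suc ?i), arrs = arrs y\<rparr>"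
      have "settled n ?E' ?y" using y(1) E' represents_cong[of ?y y n "closed_nbhd ?E'"] by (simp add: settled_def)
      moreover have "\<tau> + (20 + t) + 500 * W * \<Phi> ?y \<le> 500 * W * \<Phi> s + 400 * Suc ?i"
        using y(5) I by (simp add: I_def \<Phi>_def x1_def)
      ultimately have "I (\<tau> + (20 + t)) ?y" using I i r y(2,3) by (simp add: I_def x1_def)
      then show "regs y 18 + 1 < 2 ^ w \<and>
        I (\<tau> + (20 + t)) \<lparr>regs = (regs y)(18 := regs y 18 + 1), arrs = arrs y\<rparr> \<and> ?m - (regs y 18 + 1) < ?m - ?i"
        using r i mw by simp
    qed
    have "wp w (Seq insert_edge process) (\<lambda>t. wp w (block [Assign 18 (inc (Reg 18))]) (\<lambda>t' s'. I (\<tau> + (1 + cost ?b + (1 + cost (Load 0 (Reg 18)) + (1 + cost (Load 1 (Reg 18)) + (t + t'))))) s' \<and> ?m - regs s' 18 < ?m - regs x 18)) x1"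
      by (rule wp_mono[OF *]) (auto simp: wp_simps I_def)
    moreover have "arrs x 0 ?i = u" "arrs x 1 ?i = v" using es[OF i] uv I by (auto simp: I_def)
    ultimately show "wp w edge_body (\<lambda>t' s'. I (\<tau> + (1 + cost ?b + t')) s' \<and> ?m - regs s' 18 < ?m - regs x 18) x"
      unfolding edge_body_def block.simps(2)[of "Assign 3 _"] block.simps(2)[of "Assign 4 _"] block.simps(2)[of "Seq insert_edge process"]
        wp_Seq[of w "Assign 3 _"] wp_Seq[of w "Assign 4 _"] wp_Seq[of w "Seq insert_edge process"] wp_Assign
      by (simp add: x1_def)
  next
    fix \<tau> x assume I: "I \<tau> x" and b: "eval w x ?b = 0"
    have "regs x 18 = ?m" using b w I by (simp add: I_def of_bool_mod)
    then show "settled n (edges_of es) x \<and> \<tau> + (1 + cost ?b) + 500 * W * \<Phi> x \<le> 500 * W * \<Phi> s + 400 * length es + 10"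
      using I by (simp add: I_def)
  qed
  then show ?thesis by simp
qed

text \<open>The leading term is \<open>500 * W\<close> times the potential
  \<open>2 * n * floor_log n\<close> of the edgeless graph. Potential that is left over stays on the
  left-hand side and is carried over to the updates.\<close>

lemma wp_pre:
  fixes n W
  assumes ample_words: "ample_words w n" and dist: "distinct (map (\<lambda>(u, v). {u, v}) es)"
    and E: "simple_graph {..<n} (edges_of es)" and len: "length es \<le> n * n"
    and W: "\<And>x. x < n \<Longrightarrow> card (closed_nbhd (edges_of es) x) \<le> W" "0 < W" "W \<le> n"
  shows "wp w pre (\<lambda>\<tau> x. settled n (edges_of es) x \<and>
    \<tau> + 500 * W * pot n (arrs x 5) (arrs x 6) \<le> 1000 * W * n * floor_log n + 60 * n + 400 * length es + 20) (initial_state n es)"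
  unfolding pre_def wp_Seq
proof (rule wp_mono[OF wp_init[OF ample_words]])
  let ?s = "initial_state n es"
  show "regs ?s 0 = n" "regs ?s 5 = 0" "regs ?s 6 = 0" by (simp_all add: initial_state_def)
  show "arrs ?s = (\<lambda>_ _. 0)(0 := (\<lambda>i. if i < length es then fst (es ! i) else 0),
                      1 := (\<lambda>i. if i < length es then snd (es ! i) else 0))"
    by (simp add: initial_state_def)
next
  let ?s = "initial_state n es"
  fix t x assume x: "t \<le> 10 + 60 * n \<and> settled n {} x \<and> arrs x 0 = (\<lambda>i. if i < length es then fst (es ! i) else 0) \<and>
    arrs x 1 = (\<lambda>i. if i < length es then snd (es ! i) else 0) \<and>
    pot n (arrs x 5) (arrs x 6) \<le> 2 * n * floor_log n \<and> (\<forall>r. r \<noteq> 6 \<longrightarrow> regs x r = regs ?s r)"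
  have "500 * W * pot n (arrs x 5) (arrs x 6) \<le> 500 * W * (2 * n * floor_log n)" using x by (intro mult_le_mono2) auto
  also have "\<dots> = 1000 * W * n * floor_log n" by simp
  finally have pot: "500 * W * pot n (arrs x 5) (arrs x 6) \<le> 1000 * W * n * floor_log n" .
  have "wp w (While (Bin Less (Reg 18) (Reg 1)) edge_body)
    (\<lambda>\<tau> y. settled n (edges_of es) y \<and> \<tau> + 500 * W * pot n (arrs y 5) (arrs y 6) \<le> 500 * W * pot n (arrs x 5) (arrs x 6) + 400 * length es + 10) x"
    by (rule wp_edges[OF ample_words _ _ _ _ dist E len W]) (use x in \<open>auto simp: initial_state_def\<close>)
  then show "wp w (While (Bin Less (Reg 18) (Reg 1)) edge_body) (\<lambda>t' y. settled n (edges_of es) y \<and>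
    t + t' + 500 * W * pot n (arrs y 5) (arrs y 6) \<le> 1000 * W * n * floor_log n + 60 * n + 400 * length es + 20) x"
  proof (rule wp_mono, elim conjE)
    fix t' y assume "settled n (edges_of es) y"
      "t' + 500 * W * pot n (arrs y 5) (arrs y 6) \<le> 500 * W * pot n (arrs x 5) (arrs x 6) + 400 * length es + 10"
    moreover have "t \<le> 10 + 60 * n" using x by blast
    ultimately show "settled n (edges_of es) y \<and>
      t + t' + 500 * W * pot n (arrs y 5) (arrs y 6) \<le> 1000 * W * n * floor_log n + 60 * n + 400 * length es + 20"
      using pot by linarith
  qed
qed

section \<open>Approximation ratio and amortized time\<close>

lemma graph_after_Suc:
  "i < length us \<Longrightarrow> graph_after E us (Suc i) = apply_update (us ! i) (graph_after E us i)"
  by (simp add: graph_after_def take_Suc_conv_app_nth)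

lemma simple_graph_edge:
  assumes "simple_graph {..<n} E" "{u, v} \<in> E"
  shows "u < n" "v < n" "u \<noteq> v"
proof -
  obtain a b where "{u, v} = {a, b}" "a < n" "b < n" "a \<noteq> b" using assms by (auto simp: simple_graph_def)
  then show "u < n" "v < n" "u \<noteq> v" by (auto simp: doubleton_eq_iff)
qed

lemma simple_graph_after:
  assumes "simple_graph {..<n::nat} E" "valid_updates {..<n} E us" "i \<le> length us"
  shows "simple_graph {..<n} (graph_after E us i)"
  using assms(3)
proof (induction i)
  case 0
  then show ?case using assms(1) by (simp add: graph_after_def)
next
  case (Suc i)
  then have IH: "simple_graph {..<n} (graph_after E us i)" and v: "valid_update {..<n} (graph_after E us i) (us ! i)"
    using assms(2) by (auto simp: valid_updates_def)
  have eq: "graph_after E us (Suc i) = apply_update (us ! i) (graph_after E us i)"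
    using Suc.prems by (simp add: graph_after_Suc)
  show ?case unfolding eq using IH v by (cases "us ! i") (auto simp: simple_graph_def)
qed

section \<open>Degrees, neighbourhood sizes and the number of edges\<close>

lemma card_nb:
  assumes E: "simple_graph {..<n} E"
  shows "card (closed_nbhd E x) = degree E x + 1"
proof -
  have sub: "{v. {x, v} \<in> E} \<subseteq> {..<n} - {x}" using simple_graph_edge[OF E, of x] by auto
  then have fin: "finite {v. {x, v} \<in> E}" by (rule finite_subset) simp
  have "bij_betw (\<lambda>v. {x, v}) {v. {x, v} \<in> E} {e \<in> E. x \<in> e}"
    unfolding bij_betw_def
  proof
    show "inj_on (\<lambda>v. {x, v}) {v. {x, v} \<in> E}" by (auto simp: inj_on_def doubleton_eq_iff)
    show "(\<lambda>v. {x, v}) ` {v. {x, v} \<in> E} = {e \<in> E. x \<in> e}"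
    proof
      show "{e \<in> E. x \<in> e} \<subseteq> (\<lambda>v. {x, v}) ` {v. {x, v} \<in> E}"
      proof
        fix e assume e: "e \<in> {e \<in> E. x \<in> e}"
        then obtain a b where "e = {a, b}" using E by (auto simp: simple_graph_def)
        then have "e = {x, a} \<or> e = {x, b}" using e by auto
        then show "e \<in> (\<lambda>v. {x, v}) ` {v. {x, v} \<in> E}" using e by auto
      qed
    qed auto
  qed
  then have "card {v. {x, v} \<in> E} = degree E x" unfolding degree_def by (rule bij_betw_same_card)
  moreover have "x \<notin> {v. {x, v} \<in> E}" using sub by blast
  then have "card (closed_nbhd E x) = card {v. {x, v} \<in> E} + 1"
    unfolding closed_nbhd_def Suc_eq_plus1[symmetric] by (rule card_insert_disjoint[OF fin])
  ultimately show ?thesis by simp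
qed

lemma closed_nbhd_bounded: "simple_graph {..<n} E \<Longrightarrow> x < n \<Longrightarrow> closed_nbhd E x \<subseteq> {..<n}"
  using simple_graph_edge by (auto simp: closed_nbhd_def)

lemma degree_le_max:
  fixes n :: nat
  assumes "x < n" "i \<le> length us"
  shows "degree (graph_after E us i) x \<le> max_degree_over {..<n} E us"
proof -
  have "degree (graph_after E us i) x \<le> max_degree {..<n} (graph_after E us i)"
    unfolding max_degree_def using assms(1) by (intro Max_ge) auto
  also have "\<dots> \<le> max_degree_over {..<n} E us"
    unfolding max_degree_over_def using assms(2) by (intro Max_ge) auto
  finally show ?thesis .
qed

text \<open>A closed neighbourhood lies in \<open>{..<n}\<close> and has one element more than the
  degree. For \<open>W = \<Delta> + 1\<close> this yields the bound \<open>W \<le> n\<close> behind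
  the word-size estimates.\<close>

lemma max_degree_less:
  assumes n: "0 < n" and E: "simple_graph {..<n} E" "valid_updates {..<n} E us"
  shows "max_degree_over {..<n} E us < n"
proof -
  have "max_degree_over {..<n} E us \<in> (\<lambda>i. max_degree {..<n} (graph_after E us i)) ` {..length us}"
    unfolding max_degree_over_def by (rule Max_in) auto
  then obtain i where i: "i \<le> length us" "max_degree_over {..<n} E us = max_degree {..<n} (graph_after E us i)" by auto
  have "max_degree {..<n} (graph_after E us i) \<in> degree (graph_after E us i) ` {..<n}"
    unfolding max_degree_def using n by (intro Max_in) auto
  then obtain x where x: "x < n" "max_degree {..<n} (graph_after E us i) = degree (graph_after E us i) x" by auto
  note sg = simple_graph_after[OF E i(1)]
  have "card (closed_nbhd (graph_after E us i) x) \<le> card {..<n}" using closed_nbhd_bounded[OF sg x(1)] by (intro card_mono) auto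
  then show ?thesis using card_nb[OF sg, of x] i x by simp
qed

lemma card_edges_le:
  assumes E: "simple_graph {..<n} E" and d: "\<And>x. x < n \<Longrightarrow> degree E x \<le> d"
  shows "card E \<le> n * d"
proof -
  have fin: "finite E" using E unfolding simple_graph_def
    by (auto intro: finite_subset[of E "Pow {..<n}"])
  have "E \<subseteq> (\<Union>x<n. {e \<in> E. x \<in> e})" using E by (auto simp: simple_graph_def)
  then have "card E \<le> card (\<Union>x<n. {e \<in> E. x \<in> e})" using fin by (intro card_mono) auto
  also have "\<dots> \<le> (\<Sum>x<n. degree E x)" unfolding degree_def by (rule card_UN_le) simp
  also have "\<dots> \<le> (\<Sum>x<n. d)" using d by (intro sum_mono) auto
  finally show ?thesis by simp
qed

text \<open>Rounding up gives \<open>n + 1 \<le> 2 ^ ?l\<close>, and the factor 10 in the word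
  length becomes the exponent in \<open>ample_words\<close>.\<close>

lemma ample_words_word_length:
  assumes "0 < n"
  shows "ample_words (word_length 10 n) n"
proof -
  let ?l = "nat \<lceil>log 2 (real n + 1)\<rceil>"
  have "real (n + 1) \<le> real (2 ^ l)" if "log 2 (real n + 1) \<le> real l" for l
    using that by (simp add: log_le_iff powr_realpow)
  from this[of ?l] have "real (n + 1) \<le> real (2 ^ ?l)" by linarith
  then have "n + 1 \<le> 2 ^ ?l" by (rule of_nat_le_iff[THEN iffD1])
  then have "(n + 1) ^ 10 \<le> (2 ^ ?l) ^ 10" by (rule power_mono) simp
  also have "\<dots> = 2 ^ word_length 10 n" by (simp add: word_length_def mult.commute flip: power_mult)
  finally show ?thesis using assms by (simp add: ample_words_def)
qed

lemma floor_log_real: "0 < n \<Longrightarrow> real (floor_log n) \<le> log 2 (real n)"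
proof -
  assume n: "0 < n"
  have "2 ^ floor_log n \<le> n" using n by (simp add: floor_log_exp2_le)
  then have "real (2 ^ floor_log n) \<le> real n" by (rule of_nat_mono)
  then have "2 powr real (floor_log n) \<le> real n" by (simp add: powr_realpow)
  then show ?thesis using n by (subst le_log_iff) auto
qed

text \<open>The factor comes from \<open>stable_approx\<close>. Since \<open>n \<ge> 2\<close>, the
  logarithm is at least 1, which turns \<open>8 * (floor_log n + 1)\<close> into at most
  \<open>16 * log 2 n\<close>.\<close>

lemma settled_output:
  assumes n: "2 \<le> n" and settled: "settled n E s" and E: "simple_graph {..<n} E"
  shows "dominating_set {..<n} E (output_set n s)"
    "real (card (output_set n s)) \<le> 16 * log 2 (real n) * real (min_dominating_size {..<n} E)"
proof -
  have represents: "represents n (closed_nbhd E) s" and sp: "regs s 5 = 0" and dom: "\<And>v. v < n \<Longrightarrow> arrs s 5 v \<in> closed_nbhd E v"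
    using settled by (auto simp: settled_def)
  note repD = represents[unfolded represents_def]
  have phi: "arrs s 5 v < n" "is_level n (arrs s 6 v)" if "v < n" for v using repD that by auto
  \<comment> \<open>The flag of a vertex is the number of vertices assigned to it, so it is nonzero
    exactly on the range of the dominator function.\<close>
  have out: "output_set n s = arrs s 5 ` {..<n}"
  proof -
    have "arrs s 2 v \<noteq> 0 \<longleftrightarrow> v \<in> arrs s 5 ` {..<n}" if "v < n" for v
    proof -
      have "arrs s 2 v = card {x. x < n \<and> arrs s 5 x = v}" using repD that by auto
      then show ?thesis by (auto simp: image_iff)
    qed
    then show ?thesis unfolding output_set_def using phi by auto
  qed
  show "dominating_set {..<n} E (output_set n s)"
    unfolding dominating_set_def out
  proof (intro conjI ballI)
    show "arrs s 5 ` {..<n} \<subseteq> {..<n}" using phi by auto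
    fix v assume v: "v \<in> {..<n}"
    then have "arrs s 5 v \<in> closed_nbhd E v" using dom by simp
    then show "v \<in> arrs s 5 ` {..<n} \<or> (\<exists>u\<in>arrs s 5 ` {..<n}. {u, v} \<in> E)"
    proof (cases "arrs s 5 v = v")
      case True
      then show ?thesis using v by (intro disjI1) (rule image_eqI[of _ _ v], auto)
    next
      case False
      then have "{arrs s 5 v, v} \<in> E" using \<open>arrs s 5 v \<in> closed_nbhd E v\<close> by (simp add: closed_nbhd_def insert_commute)
      then show ?thesis using v by blast
    qed
  qed
  let ?S = "{card D | D. dominating_set {..<n} E D}"
  have "?S \<subseteq> {..n}"
    using card_mono[of "{..<n}"] by (auto simp: dominating_set_def)
  then have fin: "finite ?S" using finite_subset by blast
  have "dominating_set {..<n} E {..<n}" by (simp add: dominating_set_def)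
  then have "?S \<noteq> {}" by blast
  then have "min_dominating_size {..<n} E \<in> ?S" unfolding min_dominating_size_def using fin by (rule Min_in[rotated])
  then obtain D where D: "dominating_set {..<n} E D" "min_dominating_size {..<n} E = card D" by auto
  have "real (card (arrs s 5 ` {..<n})) \<le> 8 * (real (floor_log n) + 1) * real (card D)"
  proof (rule stable_approx[where N = "closed_nbhd E" and l = "arrs s 6"])
    show "\<And>u P. u < n \<Longrightarrow> 0 < P \<Longrightarrow> \<not> unstable n (closed_nbhd E) (arrs s 5) (arrs s 6) u P" using repD sp by auto
    show "D \<subseteq> {..<n}" using D(1) by (simp add: dominating_set_def)
    show "\<exists>u\<in>D. v \<in> closed_nbhd E u" if "v < n" for v using D(1) that by (auto simp: dominating_set_def closed_nbhd_def)
  qed (use n phi closed_nbhd_bounded[OF E] in auto)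
  also have "\<dots> \<le> 16 * log 2 (real n) * real (card D)"
  proof (rule mult_right_mono)
    have "1 \<le> log 2 (real n)" using n by (subst le_log_iff) auto
    moreover have "real (floor_log n) \<le> log 2 (real n)" using n by (intro floor_log_real) simp
    moreover have "8 * (a + 1) \<le> 16 * b" if "1 \<le> b" "a \<le> b" for a b :: real using that by simp
    ultimately show "8 * (real (floor_log n) + 1) \<le> 16 * log 2 (real n)" by blast
  qed simp
  finally show "real (card (output_set n s)) \<le> 16 * log 2 (real n) * real (min_dominating_size {..<n} E)"
    unfolding out D(2) .
qed

text \<open>The potential telescopes: the time of each step plus the new potential is at most the
  old potential plus a fixed budget, so the total time is bounded by the preprocessing bound plus
  one budget per update.\<close>

lemma dynamic_run_exists:
  assumes ample_words: "ample_words w n" and E: "simple_graph {..<n} E" and es: "edge_list_of E es" and us: "valid_updates {..<n} E us"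
    and W: "W = max_degree_over {..<n} E us + 1"
  shows "\<exists>S T. dynamic_run w pre upd n es us S T \<and> (\<forall>i\<le>length us. settled n (graph_after E us i) (S i)) \<and>
    (\<Sum>i\<le>length us. T i) \<le> 1000 * W * n * floor_log n + 60 * n + 400 * card E + 20 +
       length us * (4000 * W * (floor_log n + 1))"
proof -
  let ?M = "length us" and ?G = "graph_after E us" and ?s0 = "initial_state n es"
  let ?\<Phi> = "\<lambda>s. 500 * W * pot n (arrs s 5) (arrs s 6)"
  let ?B = "1000 * W * n * floor_log n + 60 * n + 400 * card E + 20" and ?U = "4000 * W * (floor_log n + 1)"
  have n: "0 < n" using ample_words by (simp add: ample_words_def)
  have Wn: "W \<le> n" "0 < W" using max_degree_less[OF n E us] W by auto
  have W1: "card (closed_nbhd (?G i) x) \<le> W" if "x < n" "i \<le> ?M" for i x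
    using card_nb[OF simple_graph_after[OF E us that(2)]] degree_le_max[OF that, of E] W by simp
  have eE: "edges_of es = E" and dist: "distinct (map (\<lambda>(u, v). {u, v}) es)"
    using es by (auto simp: edge_list_of_def edges_of_def)
  have len: "length es = card E" using distinct_card[OF dist] eE by (simp add: edges_of_def)
  have "card E \<le> n * (W - 1)"
    using degree_le_max[of _ n 0 us E] W by (intro card_edges_le[OF E]) (simp add: graph_after_def)
  then have len2: "length es \<le> n * n" using len Wn le_trans[OF _ mult_le_mono2[of "W - 1" n n]] by simp
  \<comment> \<open>The triple consists of the state, the time of the latest step and the
    accumulated time. Beyond the last update both predicates hold vacuously, so dependent choice can
    produce an infinite sequence.\<close>
  define P where "P i x \<longleftrightarrow> (case x of (s, t, \<tau>) \<Rightarrow> i \<le> ?M \<longrightarrow> settled n (?G i) s \<and> \<tau> + ?\<Phi> s \<le> ?B + i * ?U \<and>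
     (i = 0 \<longrightarrow> exec w pre ?s0 t s \<and> \<tau> = t))" for i and x :: "state \<times> nat \<times> nat"
  define R where "R i x y \<longleftrightarrow> i < ?M \<longrightarrow> exec w upd (pass_update (us ! i) (fst x)) (fst (snd y)) (fst y) \<and>
     snd (snd y) = snd (snd x) + fst (snd y)" for i and x y :: "state \<times> nat \<times> nat"
  have "\<exists>f. \<forall>i. P i (f i) \<and> R i (f i) (f (Suc i))"
  proof (rule dependent_nat_choice)
    have "wp w pre (\<lambda>\<tau> x. settled n (edges_of es) x \<and> \<tau> + ?\<Phi> x \<le> 1000 * W * n * floor_log n + 60 * n + 400 * length es + 20) ?s0"
      by (rule wp_pre[OF ample_words dist _ len2 _ Wn(2,1)]) (use E W1[of _ 0] eE in \<open>auto simp: graph_after_def\<close>)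
    then obtain t s where "exec w pre ?s0 t s" "settled n E s" "t + ?\<Phi> s \<le> ?B" unfolding wp_def eE len by blast
    then show "\<exists>x. P 0 x" by (intro exI[of _ "(s, t, t)"]) (simp add: P_def graph_after_def)
  next
    fix x i assume Px: "P i x"
    obtain s t \<tau> where x: "x = (s, t, \<tau>)" by (cases x)
    show "\<exists>y. P (Suc i) y \<and> R i x y"
    proof (cases "i < ?M")
      case True
      then have g: "settled n (?G i) s" and \<tau>: "\<tau> + ?\<Phi> s \<le> ?B + i * ?U" using Px x by (auto simp: P_def)
      have Gs: "?G (Suc i) = apply_update (us ! i) (?G i)" using True by (rule graph_after_Suc)
      have "valid_update {..<n} (?G i) (us ! i)" using us True by (simp add: valid_updates_def)
      from wp_upd[OF ample_words g simple_graph_after[OF E us] this W1 _ Wn(2,1)]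
      have "wp w upd (\<lambda>t y. settled n (?G (Suc i)) y \<and> t + ?\<Phi> y \<le> ?\<Phi> s + ?U) (pass_update (us ! i) s)"
        using True W1[of _ "Suc i"] unfolding Gs by simp
      then obtain t' s' where "exec w upd (pass_update (us ! i) s) t' s'" "settled n (?G (Suc i)) s'" "t' + ?\<Phi> s' \<le> ?\<Phi> s + ?U"
        unfolding wp_def by blast
      then show ?thesis using \<tau> by (intro exI[of _ "(s', t', \<tau> + t')"]) (simp add: P_def R_def x)
    next
      case False
      then show ?thesis by (auto simp: P_def R_def)
    qed
  qed
  then obtain f where f: "\<And>i. P i (f i)" "\<And>i. R i (f i) (f (Suc i))" by blast
  define S where "S i = fst (f i)" for i
  define T where "T i = fst (snd (f i))" for i
  have "(\<Sum>j\<le>i. T j) = snd (snd (f i))" if "i \<le> ?M" for i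
    using that
  proof (induction i)
    case 0 then show ?case using f(1)[of 0] by (simp add: P_def T_def split_def)
  next
    case (Suc i) then show ?case using f(2)[of i] by (simp add: R_def T_def)
  qed
  then have "(\<Sum>j\<le>?M. T j) \<le> ?B + ?M * ?U" using f(1)[of ?M] by (simp add: P_def split_def)
  moreover have "dynamic_run w pre upd n es us S T"
    using f(1)[of 0] f(2) by (auto simp: dynamic_run_def P_def R_def S_def T_def split_def)
  moreover have "\<forall>i\<le>?M. settled n (?G i) (S i)" using f(1) by (auto simp: P_def S_def split_def)
  ultimately show ?thesis by blast
qed

text \<open>The first update involves an edge, present after it if inserted and before it if
  deleted, so some graph of the sequence has an edge.\<close>

lemma max_degree_over_pos:
  fixes n :: nat
  assumes E: "simple_graph {..<n} E" "valid_updates {..<n} E us" and us: "us \<noteq> []"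
  shows "2 \<le> n" "1 \<le> max_degree_over {..<n} E us"
proof -
  have "valid_update {..<n} E (us ! 0)" using E(2) us by (auto simp: valid_updates_def graph_after_def)
  then have "\<exists>u v i. i \<le> length us \<and> {u, v} \<in> graph_after E us i"
  proof (cases "us ! 0")
    case (Insert u v)
    then have "{u, v} \<in> graph_after E us (Suc 0)" using us graph_after_Suc[of 0 us E] by simp
    then show ?thesis using us by (intro exI[of _ u] exI[of _ v] exI[of _ "Suc 0"]) (cases us; simp)
  next
    case (Delete u v)
    then have "{u, v} \<in> graph_after E us 0" using \<open>valid_update _ _ _\<close> by (simp add: graph_after_def)
    then show ?thesis by blast
  qed
  then obtain u v i where i: "i \<le> length us" "{u, v} \<in> graph_after E us i" by blast
  note sg = simple_graph_after[OF E i(1)]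
  note uv = simple_graph_edge[OF sg i(2)]
  show "2 \<le> n" using uv by linarith
  have "{u, v} \<subseteq> closed_nbhd (graph_after E us i) u" using i by (auto simp: closed_nbhd_def)
  moreover have "finite (closed_nbhd (graph_after E us i) u)" using closed_nbhd_bounded[OF sg uv(1)] finite_subset by blast
  ultimately have "card {u, v} \<le> card (closed_nbhd (graph_after E us i) u)" by (rule card_mono[rotated])
  then have "1 \<le> degree (graph_after E us i) u" using uv card_nb[OF sg, of u] by simp
  then show "1 \<le> max_degree_over {..<n} E us" using degree_le_max[OF uv(1) i(1), of E] by linarith
qed

theorem theorem1:
  shows "\<exists>(pre :: com) (upd :: com) (k :: nat) (A :: real). 2 \<le> k \<and>
    (\<forall>c > 0 :: real. \<exists>C :: real.
      \<forall>(n :: nat) (E :: nat set set) (es :: (nat \<times> nat) list) (us :: nat update list).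
        0 < n \<longrightarrow> simple_graph {..<n} E \<longrightarrow> edge_list_of E es \<longrightarrow>
        valid_updates {..<n} E us \<longrightarrow> real (length us) \<ge> c * real n \<longrightarrow>
        (\<exists>(S :: nat \<Rightarrow> state) (T :: nat \<Rightarrow> nat).
          dynamic_run (word_length k n) pre upd n es us S T \<and>
          (\<forall>i \<in> {1..length us}.
            dominating_set {..<n} (graph_after E us i) (output_set n (S i)) \<and>
            real (card (output_set n (S i)))
              \<le> A * log 2 (real n) * real (min_dominating_size {..<n} (graph_after E us i))) \<and>
          real (\<Sum>i\<le>length us. T i)
            \<le> C * (real (max_degree_over {..<n} E us) * log 2 (real n)) * real (length us)))"
\<comment> \<open>The witness 10 comes from \<open>ample_words_word_length\<close>, and 16 is the
  ratio of \<open>settled_output\<close>.\<close>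
proof (rule exI[of _ pre], rule exI[of _ upd], rule exI[of _ 10], rule exI[of _ 16], intro conjI allI impI)
  fix c :: real assume c: "0 < c"
  show "\<exists>C :: real.
      \<forall>(n :: nat) (E :: nat set set) (es :: (nat \<times> nat) list) (us :: nat update list).
        0 < n \<longrightarrow> simple_graph {..<n} E \<longrightarrow> edge_list_of E es \<longrightarrow>
        valid_updates {..<n} E us \<longrightarrow> real (length us) \<ge> c * real n \<longrightarrow>
        (\<exists>(S :: nat \<Rightarrow> state) (T :: nat \<Rightarrow> nat).
          dynamic_run (word_length 10 n) pre upd n es us S T \<and>
          (\<forall>i \<in> {1..length us}.
            dominating_set {..<n} (graph_after E us i) (output_set n (S i)) \<and>
            real (card (output_set n (S i)))
              \<le> 16 * log 2 (real n) * real (min_dominating_size {..<n} (graph_after E us i))) \<and>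
          real (\<Sum>i\<le>length us. T i)
            \<le> C * (real (max_degree_over {..<n} E us) * log 2 (real n)) * real (length us))"
  \<comment> \<open>The coefficients of \<open>n\<close> sum to
    \<open>2000 + 60 + 400 = 2460\<close>, those of the number of updates to
    \<open>16000 + 20\<close>; the length assumption turns \<open>n\<close> into at most
    \<open>1 / c\<close> times that number.\<close>
  proof (rule exI[of _ "2460 / c + 16020"], intro allI impI)
    fix n E es us
    assume n: "0 < n" and E: "simple_graph {..<n} E" and es: "edge_list_of E es"
      and us: "valid_updates {..<n} E us" and long: "c * real n \<le> real (length us)"
    define \<Delta> where "\<Delta> = max_degree_over {..<n} E us"
    define M where "M = length us"
    have "0 < real (length us)" using long c n by (meson less_le_trans mult_pos_pos of_nat_0_less_iff)
    then have M: "1 \<le> M" and ne: "us \<noteq> []" by (auto simp: M_def Suc_le_eq)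
    note pos = max_degree_over_pos[OF E us ne]
    obtain S T where run: "dynamic_run (word_length 10 n) pre upd n es us S T"
      and S: "\<And>i. i \<le> M \<Longrightarrow> settled n (graph_after E us i) (S i)"
      and T: "(\<Sum>i\<le>M. T i) \<le> 1000 * (\<Delta> + 1) * n * floor_log n + 60 * n + 400 * card E + 20 +
          M * (4000 * (\<Delta> + 1) * (floor_log n + 1))"
      using dynamic_run_exists[OF ample_words_word_length[OF n] E es us refl] unfolding \<Delta>_def M_def by blast
    have "card E \<le> n * \<Delta>"
      using degree_le_max[of _ n 0 us E] unfolding \<Delta>_def by (intro card_edges_le[OF E]) (simp add: graph_after_def)
    define d where "d = real \<Delta>"
    define lg where "lg = log 2 (real n)"
    have d: "1 \<le> d" using pos by (simp add: d_def \<Delta>_def)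
    have l: "1 \<le> lg" using pos(1) unfolding lg_def by (subst le_log_iff) auto
    have L: "real (floor_log n) \<le> lg" unfolding lg_def using floor_log_real[OF n] .
    have mE: "real (card E) \<le> real n * d" using \<open>card E \<le> n * \<Delta>\<close> unfolding d_def by (metis of_nat_le_iff of_nat_mult)
    have dl: "1 \<le> d * lg" "d \<le> d * lg" using d l mult_mono[of 1 d 1 lg] by auto
    have "real (\<Sum>i\<le>M. T i) \<le> real (1000 * (\<Delta> + 1) * n * floor_log n + 60 * n + 400 * card E + 20 +
          M * (4000 * (\<Delta> + 1) * (floor_log n + 1)))" using T by (rule of_nat_mono)
    also have "\<dots> = 1000 * ((d + 1) * real (floor_log n)) * real n + 60 * real n + 400 * real (card E) + 20 +
        real M * (4000 * ((d + 1) * (real (floor_log n) + 1)))" by (simp add: d_def algebra_simps)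
    \<comment> \<open>Uses \<open>d + 1 \<le> 2 * d\<close> and
      \<open>floor_log n + 1 \<le> 2 * lg\<close>; the lower-order terms are absorbed through
      \<open>1 \<le> d * lg\<close> and \<open>d \<le> d * lg\<close>.\<close>
    also have "\<dots> \<le> 1000 * ((2 * d) * lg) * real n + 60 * ((d * lg) * real n) + 400 * ((d * lg) * real n) + 20 * ((d * lg) * real M) +
        real M * (4000 * ((2 * d) * (2 * lg)))"
    proof (intro add_mono mult_left_mono mult_right_mono mult_mono)
      show "real n \<le> d * lg * real n" using mult_right_mono[OF dl(1), of "real n"] by simp
      have "real n * d \<le> d * lg * real n" using mult_right_mono[OF dl(2), of "real n"] by (simp add: mult.commute)
      then show "real (card E) \<le> d * lg * real n" using mE by linarith
      have "1 \<le> (d * lg) * real M" using mult_mono[of 1 "d * lg" 1 "real M"] dl(1) M by simp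
      then show "20 \<le> 20 * (d * lg * real M)" by simp
    qed (use d l L in auto)
    also have "\<dots> = (d * lg) * (2460 * real n + 16020 * real M)" by (simp add: algebra_simps)
    also have "\<dots> \<le> (d * lg) * (2460 / c * real M + 16020 * real M)"
    proof (rule mult_left_mono)
      have "real n \<le> real M / c" using long c by (simp add: M_def field_simps)
      then show "2460 * real n + 16020 * real M \<le> 2460 / c * real M + 16020 * real M" by simp
    qed (use d l in simp)
    also have "\<dots> = (2460 / c + 16020) * (d * lg) * real M" by (simp add: algebra_simps)
    finally have time: "real (\<Sum>i\<le>M. T i) \<le> (2460 / c + 16020) * (d * lg) * real M" .
    show "\<exists>S T. dynamic_run (word_length 10 n) pre upd n es us S T \<and>
          (\<forall>i \<in> {1..length us}.
            dominating_set {..<n} (graph_after E us i) (output_set n (S i)) \<and>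
            real (card (output_set n (S i)))
              \<le> 16 * log 2 (real n) * real (min_dominating_size {..<n} (graph_after E us i))) \<and>
          real (\<Sum>i\<le>length us. T i)
            \<le> (2460 / c + 16020) * (real (max_degree_over {..<n} E us) * log 2 (real n)) * real (length us)"
      using run time settled_output[OF pos(1) S simple_graph_after[OF E us]]
      unfolding M_def d_def \<Delta>_def lg_def by (intro exI[of _ S] exI[of _ T]) auto
  qed
qed simp

end
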